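(* Let $k$ be a field of characteristic $0$. Let $H$ be a connected Hopf algebra over $k$. Let $A$ be a one-sided coideal subalgebra of $H$. Let $\mathcal{F}=(H_{(n)})_{n\ge0}$ be the coradical filtration of $H$, and let $\mathcal{F}|_A=(A\cap H_{(n)})_{n\ge0}$. Then the associated graded algebra $\mathrm{gr}(A,\mathcal{F}|_A)$ is a graded polynomial algebra over $k$ (i.e. isomorphic as a graded algebra to a polynomial algebra over $k$ in some family of graded variables), and $$\mathrm{GKdim}\,A=\mathrm{GKdim}\,\mathrm{gr}(A,\mathcal{F}|_A)\in\mathbb{N}_\infty .$$
   Context: A Hopf algebra is connected if its coradical is one-dimensional. A one-sided coideal subalgebra of $H$ is a subalgebra $A$ with $\Delta_H(A)\subseteq H\otimes A$ or $\Delta_H(A)\subseteq A\otimes H$. $\mathrm{GKdim}$ denotes Gelfand-Kirillov dimension, and $\mathbb{N}_\infty=\mathbb{N}\cup\{\infty\}$ with $0\in\mathbb{N}$. The associated graded algebra is $\mathrm{gr}(A,\mathcal{F}|_A)=\bigoplus_{n\ge0}(A\cap H_{(n)})/(A\cap H_{(n-1)})$ with $H_{(-1)}=0$. *)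

theory Defs
  imports
    Complex_Main
    "HOL-Library.Poly_Mapping"
    "HOL-Library.Extended_Real"
    "HOL-Library.Liminf_Limsup"
    "HOL-Algebra.Embedded_Algebras"
    "HOL-Algebra.RingHom"
    "HOL-Algebra.Module"
begin

section \<open>Tensor products of vector spaces\<close>

text \<open>The type \<^typ>\<open>'x \<Rightarrow>\<^sub>0 'k\<close> is the free vector space on \<^typ>\<open>'x\<close>.\<close>

definition free_scale :: "'k::field \<Rightarrow> ('x \<Rightarrow>\<^sub>0 'k) \<Rightarrow> ('x \<Rightarrow>\<^sub>0 'k)" where
  "free_scale c u = Poly_Mapping.map ((*) c) u"

definition linear_extension ::
    "('k::field \<Rightarrow> 'v::ab_group_add \<Rightarrow> 'v) \<Rightarrow> ('x \<Rightarrow> 'v) \<Rightarrow> ('x \<Rightarrow>\<^sub>0 'k) \<Rightarrow> 'v" where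
  "linear_extension s f u = (\<Sum>x\<in>Poly_Mapping.keys u. s (Poly_Mapping.lookup u x) (f x))"

definition bilinear_relations ::
    "('k::field \<Rightarrow> 'a::ab_group_add \<Rightarrow> 'a) \<Rightarrow> ('k \<Rightarrow> 'b::ab_group_add \<Rightarrow> 'b) \<Rightarrow> ('a \<times> 'b \<Rightarrow>\<^sub>0 'k) set" where
  "bilinear_relations sA sB =
     {Poly_Mapping.single (x + y, z) 1 - Poly_Mapping.single (x, z) 1 - Poly_Mapping.single (y, z) 1 | x y z. True}
   \<union> {Poly_Mapping.single (x, y + z) 1 - Poly_Mapping.single (x, y) 1 - Poly_Mapping.single (x, z) 1 | x y z. True}
   \<union> {Poly_Mapping.single (sA c x, y) 1 - Poly_Mapping.single (x, y) c | c x y. True}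
   \<union> {Poly_Mapping.single (x, sB c y) 1 - Poly_Mapping.single (x, y) c | c x y. True}"

text \<open>
  The tensor product is the quotient of the free vector space on \<open>A \<times> B\<close> by the bilinear
  relations.  As the scalar multiplications are terms, this quotient is not itself a type; the
  locale says that \<open>'t\<close>, with the map \<open>(a, b) \<mapsto> a \<otimes> b\<close>, is a copy of it: the canonical linear
  map from the free vector space is onto and its kernel is spanned by the relations.
\<close>

locale tensor_product =
  VA: vector_space sA + VB: vector_space sB + VT: vector_space sT
  for sA :: "'k::field \<Rightarrow> 'a::ab_group_add \<Rightarrow> 'a"
    and sB :: "'k \<Rightarrow> 'b::ab_group_add \<Rightarrow> 'b"
    and sT :: "'k \<Rightarrow> 't::ab_group_add \<Rightarrow> 't" +
  fixes tens :: "'a \<Rightarrow> 'b \<Rightarrow> 't"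
  assumes surjective: "surj (linear_extension sT (\<lambda>(a, b). tens a b))"
    and kernel: "{u. linear_extension sT (\<lambda>(a, b). tens a b) u = 0} =
                  module.span free_scale (bilinear_relations sA sB)"

text \<open>The linear map out of the tensor product induced by a bilinear map \<open>f\<close>.\<close>

definition tensor_lift ::
    "('k::field \<Rightarrow> 't::ab_group_add \<Rightarrow> 't) \<Rightarrow> ('k \<Rightarrow> 'v::ab_group_add \<Rightarrow> 'v) \<Rightarrow>
     ('a \<Rightarrow> 'b \<Rightarrow> 't) \<Rightarrow> ('a \<Rightarrow> 'b \<Rightarrow> 'v) \<Rightarrow> 't \<Rightarrow> 'v" where
  "tensor_lift sT sV tens f = (THE g. Vector_Spaces.linear sT sV g \<and> (\<forall>a b. g (tens a b) = f a b))"

lemma lookup_free_scale: "Poly_Mapping.lookup (free_scale c u) x = c * Poly_Mapping.lookup u x"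
  by (simp add: free_scale_def Poly_Mapping.map.rep_eq when_def)

lemma vector_space_free_scale: "vector_space free_scale"
  by unfold_locales
    (rule poly_mapping_eqI; simp add: lookup_free_scale lookup_add algebra_simps)+

lemma linear_extension_superset:
  assumes "vector_space s" "finite X" "Poly_Mapping.keys u \<subseteq> X"
  shows "linear_extension s f u = (\<Sum>x\<in>X. s (Poly_Mapping.lookup u x) (f x))"
proof -
  interpret vector_space s by fact
  show ?thesis
    unfolding linear_extension_def
    by (rule sum.mono_neutral_left) (use assms in \<open>auto simp: in_keys_iff\<close>)
qed

lemma linear_linear_extension:
  assumes "vector_space s"
  shows "Vector_Spaces.linear free_scale s (linear_extension s f)"
proof -
  interpret vector_space s by fact
  interpret free: vector_space free_scale by (rule vector_space_free_scale)
  have "linear_extension s f (u + v) = linear_extension s f u + linear_extension s f v" for u v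
  proof -
    let ?X = "Poly_Mapping.keys u \<union> Poly_Mapping.keys v"
    have "Poly_Mapping.keys (u + v) \<subseteq> ?X" by (rule keys_add)
    then show ?thesis
      by (simp add: linear_extension_superset[OF assms, of ?X] lookup_add scale_left_distrib
          sum.distrib)
  qed
  moreover have "linear_extension s f (free_scale c u) = s c (linear_extension s f u)" for c u
  proof -
    have "Poly_Mapping.keys (free_scale c u) \<subseteq> Poly_Mapping.keys u"
      by (auto simp: in_keys_iff lookup_free_scale)
    then show ?thesis
      by (simp add: linear_extension_superset[OF assms, of "Poly_Mapping.keys u"] scale_sum_right
          lookup_free_scale)
  qed
  ultimately show ?thesis
    by (intro Vector_Spaces.linear.intro Modules.module_hom.intro Modules.module_hom_axioms.intro)
      (simp_all add: vector_space_axioms module_axioms free.vector_space_axioms free.module_axioms)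
qed

lemma linear_extension_single:
  assumes "vector_space s"
  shows "linear_extension s f (Poly_Mapping.single x c) = s c (f x)"
  by (simp add: linear_extension_superset[OF assms, of "{x}"])

context tensor_product
begin

text \<open>The universal property, so \<^const>\<open>tensor_lift\<close> is well defined on bilinear maps.\<close>

theorem universal_property:
  assumes V: "vector_space sV"
    and left: "\<And>b. Vector_Spaces.linear sA sV (\<lambda>a. f a b)"
    and right: "\<And>a. Vector_Spaces.linear sB sV (f a)"
  shows "\<exists>!g. Vector_Spaces.linear sT sV g \<and> (\<forall>a b. g (tens a b) = f a b)"
proof -
  interpret V: vector_space sV by fact
  interpret free: vector_space free_scale by (rule vector_space_free_scale)
  interpret TV: vector_space_pair sT sV ..
  interpret AV: vector_space_pair sA sV ..
  interpret BV: vector_space_pair sB sV ..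
  let ?p = "linear_extension sT (\<lambda>(a, b). tens a b)"
  let ?e = "linear_extension sV (\<lambda>(a, b). f a b)"
  interpret p: Vector_Spaces.linear free_scale sT ?p
    by (rule linear_linear_extension) (rule VT.vector_space_axioms)
  interpret e: Vector_Spaces.linear free_scale sV ?e
    by (rule linear_linear_extension[OF V])
  note singles = linear_extension_single[OF V] linear_extension_single[OF VT.vector_space_axioms]
  have rel: "?e u = 0" if "u \<in> bilinear_relations sA sB" for u
    using that
    by (auto simp: bilinear_relations_def e.diff singles AV.linear_add[OF left] AV.linear_scale[OF left]
        BV.linear_add[OF right] BV.linear_scale[OF right])
  have ker: "?e u = 0" if "?p u = 0" for u
  proof -
    have "u \<in> free.span (bilinear_relations sA sB)" using that kernel by blast
    then show ?thesis
      by (induction rule: free.span_induct_alt) (simp_all add: e.add e.scale rel e.zero)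
  qed
  have eq: "?e u = ?e v" if "?p u = ?p v" for u v
    using ker[of "u - v"] that by (simp add: p.diff e.diff)
  define g where "g t = ?e (Hilbert_Choice.inv ?p t)" for t
  have g: "g (?p u) = ?e u" for u
    unfolding g_def by (rule eq) (rule surj_f_inv_f[OF surjective])
  have "Vector_Spaces.linear sT sV g"
  proof (intro Vector_Spaces.linear.intro Modules.module_hom.intro Modules.module_hom_axioms.intro)
    show "g (x + y) = g x + g y" for x y
      by (metis g p.add e.add surj_f_inv_f[OF surjective])
    show "g (sT c x) = sV c (g x)" for c x
      by (metis g p.scale e.scale surj_f_inv_f[OF surjective])
  qed (fact VT.vector_space_axioms VT.module_axioms V.vector_space_axioms V.module_axioms)+
  moreover have "g (tens a b) = f a b" for a b
    using g[of "Poly_Mapping.single (a, b) 1"] by (simp add: singles)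
  moreover have "h = g" if h: "Vector_Spaces.linear sT sV h" "\<forall>a b. h (tens a b) = f a b" for h
  proof
    fix t
    obtain u where u: "t = ?p u" using surjective by (metis surjD)
    have "h (?p u) = ?e u"
      by (simp add: linear_extension_def TV.linear_sum[OF h(1)] TV.linear_scale[OF h(1)] h(2) split_beta)
    then show "h t = g t" by (simp add: u g)
  qed
  ultimately show ?thesis by blast
qed

end

section \<open>Hopf algebras\<close>

locale k_algebra = vector_space scale
  for scale :: "'k::field \<Rightarrow> 'a::ring_1 \<Rightarrow> 'a" +
  assumes scale_mult_left: "scale c x * y = scale c (x * y)"
    and scale_mult_right: "x * scale c y = scale c (x * y)"

text \<open>
  \<open>'t\<close> is \<open>H \<otimes> H\<close> and \<open>'u\<close> is \<open>(H \<otimes> H) \<otimes> H\<close>.  In \<open>coassoc\<close> the right-hand side is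
  \<open>(id \<otimes> \<Delta>) \<circ> \<Delta>\<close> followed by the associativity isomorphism from \<open>H \<otimes> (H \<otimes> H)\<close>.
\<close>

locale coalgebra =
  H: vector_space scale + HH: tensor_product scale scale scaleT tens +
  HHH: tensor_product scaleT scale scaleU tens3
  for scale :: "'k::field \<Rightarrow> 'h::ab_group_add \<Rightarrow> 'h"
    and scaleT :: "'k \<Rightarrow> 't::ab_group_add \<Rightarrow> 't" and tens :: "'h \<Rightarrow> 'h \<Rightarrow> 't"
    and scaleU :: "'k \<Rightarrow> 'u::ab_group_add \<Rightarrow> 'u" and tens3 :: "'t \<Rightarrow> 'h \<Rightarrow> 'u" +
  fixes comult :: "'h \<Rightarrow> 't" and counit :: "'h \<Rightarrow> 'k"
  assumes comult_linear: "Vector_Spaces.linear scale scaleT comult"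
    and counit_linear: "Vector_Spaces.linear scale (*) counit"
    and coassoc:
      "tensor_lift scaleT scaleU tens (\<lambda>a b. tens3 (comult a) b) (comult x) =
       tensor_lift scaleT scaleU tens
         (\<lambda>a b. tensor_lift scaleT scaleU tens (\<lambda>c d. tens3 (tens a c) d) (comult b)) (comult x)"
    and counit_left: "tensor_lift scaleT scale tens (\<lambda>a b. scale (counit a) b) (comult x) = x"
    and counit_right: "tensor_lift scaleT scale tens (\<lambda>a b. scale (counit b) a) (comult x) = x"
begin

text \<open>The image of \<open>V \<otimes> W\<close> in \<open>H \<otimes> H\<close>.\<close>

definition tensor_subspace :: "'h set \<Rightarrow> 'h set \<Rightarrow> 't set" where
  "tensor_subspace V W = HH.VT.span {tens v w | v w. v \<in> V \<and> w \<in> W}"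

definition subcoalgebra :: "'h set \<Rightarrow> bool" where
  "subcoalgebra C \<longleftrightarrow> H.subspace C \<and> comult ` C \<subseteq> tensor_subspace C C"

definition simple_subcoalgebra :: "'h set \<Rightarrow> bool" where
  "simple_subcoalgebra C \<longleftrightarrow> subcoalgebra C \<and> C \<noteq> {0} \<and>
     (\<forall>D. subcoalgebra D \<and> D \<subseteq> C \<longrightarrow> D = {0} \<or> D = C)"

definition coradical :: "'h set" where
  "coradical = H.span (\<Union>{C. simple_subcoalgebra C})"

text \<open>\<open>H\<^sub>(\<^sub>n\<^sub>+\<^sub>1\<^sub>) = \<Delta>\<^sup>-\<^sup>1(H \<otimes> H\<^sub>(\<^sub>n\<^sub>) + H\<^sub>(\<^sub>0\<^sub>) \<otimes> H)\<close>\<close>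

primrec coradical_filtration :: "nat \<Rightarrow> 'h set" where
  "coradical_filtration 0 = coradical"
| "coradical_filtration (Suc n) =
     {x. \<exists>s \<in> tensor_subspace UNIV (coradical_filtration n).
         \<exists>t \<in> tensor_subspace coradical UNIV. comult x = s + t}"

end

locale hopf_algebra =
  k_algebra scale + coalgebra scale scaleT tens scaleU tens3 comult counit
  for scale :: "'k::field \<Rightarrow> 'h::ring_1 \<Rightarrow> 'h"
    and scaleT :: "'k \<Rightarrow> 't::ab_group_add \<Rightarrow> 't" and tens :: "'h \<Rightarrow> 'h \<Rightarrow> 't"
    and scaleU :: "'k \<Rightarrow> 'u::ab_group_add \<Rightarrow> 'u" and tens3 :: "'t \<Rightarrow> 'h \<Rightarrow> 'u"
    and comult :: "'h \<Rightarrow> 't" and counit :: "'h \<Rightarrow> 'k" +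
  fixes antipode :: "'h \<Rightarrow> 'h"
  assumes comult_one: "comult 1 = tens 1 1"
    and comult_mult:
      "comult (x * y) =
       tensor_lift scaleT scaleT tens
         (\<lambda>a b. tensor_lift scaleT scaleT tens (\<lambda>c d. tens (a * c) (b * d)) (comult y)) (comult x)"
    and counit_one: "counit 1 = 1"
    and counit_mult: "counit (x * y) = counit x * counit y"
    and antipode_linear: "Vector_Spaces.linear scale scale antipode"
    and antipode_left: "tensor_lift scaleT scale tens (\<lambda>a b. antipode a * b) (comult x) = scale (counit x) 1"
    and antipode_right: "tensor_lift scaleT scale tens (\<lambda>a b. a * antipode b) (comult x) = scale (counit x) 1"
begin

definition one_sided_coideal_subalgebra :: "'h set \<Rightarrow> bool" where
  "one_sided_coideal_subalgebra A \<longleftrightarrow>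
     subspace A \<and> 1 \<in> A \<and> (\<forall>x\<in>A. \<forall>y\<in>A. x * y \<in> A) \<and>
     (comult ` A \<subseteq> tensor_subspace UNIV A \<or> comult ` A \<subseteq> tensor_subspace A UNIV)"

end

locale connected_hopf_algebra = hopf_algebra +
  assumes coradical_one_dimensional: "dim coradical = 1"

section \<open>Algebras with explicit carrier\<close>

text \<open>
  Subalgebras, associated graded algebras and polynomial algebras are \<^typ>\<open>('k, 'a) module\<close>
  records.
\<close>

definition subset_algebra :: "('k \<Rightarrow> 'a::ring_1 \<Rightarrow> 'a) \<Rightarrow> 'a set \<Rightarrow> ('k, 'a) module" where
  "subset_algebra scale A =
     \<lparr>carrier = A, monoid.mult = (*), one = 1, zero = 0, add = (+), smult = scale\<rparr>"

text \<open>
  \<open>Span\<close> and \<open>dim\<close> of the library take scalars from a subfield of the ring, here the image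
  \<open>k \<cdot> 1\<close> of the ground field.
\<close>

definition scalars :: "('k, 'a, 'm) module_scheme \<Rightarrow> 'a set" where
  "scalars M = range (\<lambda>c. c \<odot>\<^bsub>M\<^esub> \<one>\<^bsub>M\<^esub>)"

definition words :: "('a, 'm) monoid_scheme \<Rightarrow> 'a list \<Rightarrow> nat \<Rightarrow> 'a list" where
  "words M xs n = map (\<lambda>ws. foldr (\<otimes>\<^bsub>M\<^esub>) ws \<one>\<^bsub>M\<^esub>) (concat (map (\<lambda>i. List.n_lists i xs) [0..<Suc n]))"

text \<open>
  If \<open>V\<close> is the span of \<open>xs\<close>, then the words of length at most \<open>n\<close> in \<open>xs\<close> span
  \<open>V\<^sup>0 + V\<^sup>1 + \<dots> + V\<^sup>n\<close>.  As \<open>xs\<close> varies, \<open>V\<close> runs through all finite-dimensional subspaces.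
\<close>

definition GKdim :: "('k::field, 'a, 'm) module_scheme \<Rightarrow> ereal" where
  "GKdim M = (SUP xs \<in> {xs. set xs \<subseteq> carrier M}.
     limsup (\<lambda>n. ereal (log (real n)
       (real (ring.dim M (scalars M) (ring.Span M (scalars M) (words M xs n)))))))"

section \<open>Associated graded algebras\<close>

definition previous :: "(nat \<Rightarrow> 'a::zero set) \<Rightarrow> nat \<Rightarrow> 'a set" where
  "previous F n = (case n of 0 \<Rightarrow> {0} | Suc m \<Rightarrow> F m)"

text \<open>
  For an algebra filtration \<open>F\<close>, an element of the associated graded algebra is the family of its
  homogeneous components, cosets of \<open>previous F n\<close> in \<open>F n\<close>, almost all of them zero.  The sums,
  products and multiples of cosets below collect the values at all choices of representatives;
  adding the elements \<open>f\<close> of \<open>previous F n\<close> makes the result a full coset.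
\<close>

definition associated_graded ::
    "('k \<Rightarrow> 'a::ring_1 \<Rightarrow> 'a) \<Rightarrow> (nat \<Rightarrow> 'a set) \<Rightarrow> ('k, nat \<Rightarrow> 'a set) module" where
  "associated_graded scale F =
     \<lparr>carrier = {x. (\<forall>n. \<exists>a\<in>F n. x n = (+) a ` previous F n) \<and> finite {n. x n \<noteq> previous F n}},
      monoid.mult = (\<lambda>x y n. {(\<Sum>i\<le>n. a i * b (n - i)) + f | a b f.
                         (\<forall>i\<le>n. a i \<in> x i \<and> b i \<in> y i) \<and> f \<in> previous F n}),
      one = (\<lambda>n. if n = 0 then {1} else previous F n),
      zero = previous F,
      add = (\<lambda>x y n. {a + b | a b. a \<in> x n \<and> b \<in> y n}),
      smult = (\<lambda>c x n. {scale c a + f | a f. a \<in> x n \<and> f \<in> previous F n})\<rparr>"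

definition associated_graded_component ::
    "('k \<Rightarrow> 'a::ring_1 \<Rightarrow> 'a) \<Rightarrow> (nat \<Rightarrow> 'a set) \<Rightarrow> nat \<Rightarrow> (nat \<Rightarrow> 'a set) set" where
  "associated_graded_component scale F n =
     {x \<in> carrier (associated_graded scale F). \<forall>m. m \<noteq> n \<longrightarrow> x m = previous F m}"

section \<open>Graded polynomial algebras\<close>

definition polynomial_algebra :: "'i set \<Rightarrow> ('k::field, ('i \<Rightarrow>\<^sub>0 nat) \<Rightarrow>\<^sub>0 'k) module" where
  "polynomial_algebra I =
     \<lparr>carrier = {p. \<forall>m\<in>Poly_Mapping.keys p. Poly_Mapping.keys m \<subseteq> I},
      monoid.mult = (*), one = 1, zero = 0, add = (+), smult = free_scale\<rparr>"

definition homogeneous_polynomials ::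
    "'i set \<Rightarrow> ('i \<Rightarrow> nat) \<Rightarrow> nat \<Rightarrow> (('i \<Rightarrow>\<^sub>0 nat) \<Rightarrow>\<^sub>0 'k::field) set" where
  "homogeneous_polynomials I wt n =
     {p \<in> carrier (polynomial_algebra I).
        \<forall>m\<in>Poly_Mapping.keys p. (\<Sum>i\<in>Poly_Mapping.keys m. Poly_Mapping.lookup m i * wt i) = n}"

text \<open>
  \<open>G n\<close> is the component of degree \<open>n\<close> of \<open>M\<close>.  Taking the variables from the type of the elements
  of \<open>M\<close> is no restriction, since a variable can be named by its image in \<open>M\<close>.
\<close>

definition graded_polynomial_algebra ::
    "('k::field, 'a) module \<Rightarrow> (nat \<Rightarrow> 'a set) \<Rightarrow> bool" where
  "graded_polynomial_algebra M G \<longleftrightarrow>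
     (\<exists>(I :: 'a set) (wt :: 'a \<Rightarrow> nat) \<phi>.
        \<phi> \<in> ring_iso M (polynomial_algebra I :: ('k, ('a \<Rightarrow>\<^sub>0 nat) \<Rightarrow>\<^sub>0 'k) module) \<and>
        (\<forall>c. \<forall>x\<in>carrier M. \<phi> (c \<odot>\<^bsub>M\<^esub> x) = free_scale c (\<phi> x)) \<and>
        (\<forall>n. \<phi> ` G n = homogeneous_polynomials I wt n))"

end

(*
  Let D_f = (f (x) id) o Delta for linear forms f with f(1) = 0.  The coradical filtration is
  H_0 = k 1 and H_(n+1) = {x. D_f x in H_n for all f}, and coassociativity gives the same
  filtration for the right-handed operators (id (x) f) o Delta.  Modulo H_(m+n-2) each D_f
  satisfies the Leibniz rule on H_m H_n; hence products and commutators respect the filtration,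
  and on gr A the D_f are derivations of degree -1 whose common kernel is k.

  This forces gr A to be a polynomial algebra on any minimal set of homogeneous generators: let
  p be a nonzero relation of minimal weight and x_j a variable of maximal weight in p.  Lifting
  the derivations to the polynomial ring, they annihilate p by minimality, and they commute with
  d/dx_j on p because D x_i has weight below that of x_j.  So dp/dx_j is a relation of smaller
  weight, hence zero, contradicting characteristic 0; or p is linear in the generators of its
  own weight, contradicting the minimality of the generating set.

  Monomials in lifted generators form a basis of A adapted to the filtration, so that
  A and gr A both have Gelfand-Kirillov dimension equal to the number of generators.
*)
theory Submission
  imports
    Defs
    "HOL-Library.FuncSet"
    "HOL-Library.Multiset"
    "HOL-Algebra.QuotRing"
begin

text \<open>Two obstacles shape the proof. The coradical filtration is given by a recursion, and
  nothing in it says that its union is \<open>H\<close>; yet comparing the Gelfand-Kirillov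
  dimension of \<open>A\<close> with that of the graded algebra needs \<open>A\<close> to be the
  union of its filtration steps. Connectedness is used again for this: a finite-dimensional
  subcomodule not contained in the union would give a nonzero finite-dimensional subcoalgebra, which
  must contain 1, and a form that equals the counit there although it vanishes at 1. The other
  obstacle is that \<open>A\<close> is not commutative, so evaluating polynomials at lifted
  generators is no homomorphism. Calculations are therefore made with elements of \<open>A\<close>
  modulo the preceding filtration step, where the order of factors does not matter, and the quotient
  is formed only once the polynomial structure is known. The way back to polynomials is the
  induction on the weight: a relation of smaller weight vanishes as a polynomial, and only such an
  identity can be differentiated.\<close>

abbreviation (input) keys where "keys \<equiv> Poly_Mapping.keys"
abbreviation (input) lookup where "lookup \<equiv> Poly_Mapping.lookup"
abbreviation (input) single where "single \<equiv> Poly_Mapping.single"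

section \<open>Tensor products\<close>

lemma vector_space_self: "vector_space ((*) :: 'k::field \<Rightarrow> 'k \<Rightarrow> 'k)"
  by unfold_locales (auto simp: algebra_simps)

lemma linear_sum_list:
  assumes "Vector_Spaces.linear s1 s2 f"
  shows "f (\<Sum>x\<leftarrow>xs. g x) = (\<Sum>x\<leftarrow>xs. f (g x))"
proof -
  interpret f: Vector_Spaces.linear s1 s2 f by fact
  show ?thesis by (induction xs) (simp_all add: f.zero f.add)
qed

abbreviation linear_form :: "('k::field \<Rightarrow> 'a::ab_group_add \<Rightarrow> 'a) \<Rightarrow> ('a \<Rightarrow> 'k) \<Rightarrow> bool" where
  "linear_form s \<equiv> Vector_Spaces.linear s (*)"

definition bilinear_map ::
    "('k::field \<Rightarrow> 'a::ab_group_add \<Rightarrow> 'a) \<Rightarrow> ('k \<Rightarrow> 'b::ab_group_add \<Rightarrow> 'b) \<Rightarrow>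
     ('k \<Rightarrow> 'v::ab_group_add \<Rightarrow> 'v) \<Rightarrow> ('a \<Rightarrow> 'b \<Rightarrow> 'v) \<Rightarrow> bool" where
  "bilinear_map sA sB sV f \<longleftrightarrow>
     (\<forall>b. Vector_Spaces.linear sA sV (\<lambda>a. f a b)) \<and> (\<forall>a. Vector_Spaces.linear sB sV (f a))"

lemma bilinear_map_iff:
  assumes "vector_space sA" "vector_space sB" "vector_space sV"
  shows "bilinear_map sA sB sV f \<longleftrightarrow>
     (\<forall>x y b. f (x + y) b = f x b + f y b) \<and> (\<forall>c x b. f (sA c x) b = sV c (f x b)) \<and>
     (\<forall>a x y. f a (x + y) = f a x + f a y) \<and> (\<forall>a c x. f a (sB c x) = sV c (f a x))"
  unfolding bilinear_map_def Vector_Spaces.linear_iff by (simp add: assms) (intro iffI conjI; elim conjE; simp)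

context vector_space
begin

lemma subspace_sum_list: "subspace V \<Longrightarrow> (\<And>x. x \<in> set xs \<Longrightarrow> f x \<in> V) \<Longrightarrow> (\<Sum>x\<leftarrow>xs. f x) \<in> V"
  by (induction xs) (auto intro: subspace_0 subspace_add)

lemma scale_sum_list_right: "scale c (\<Sum>x\<leftarrow>xs. f x) = (\<Sum>x\<leftarrow>xs. scale c (f x))"
  by (induction xs) (auto simp: scale_right_distrib)

lemma linear_form_representation:
  assumes "independent B" "span B = UNIV"
  shows "linear_form scale (\<lambda>x. representation B x b)"
  unfolding Vector_Spaces.linear_iff using assms
  by (simp add: vector_space_axioms vector_space_self representation_add representation_scale)

text \<open>The form is the coordinate at \<open>x\<close> in a basis of the whole space that
  contains \<open>x\<close> and a basis of \<open>V\<close>. It turns membership in a subspace into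
  scalar equations.\<close>

lemma separating_linear_form:
  assumes "subspace V" "x \<notin> V"
  obtains f where "linear_form scale f" "\<And>v. v \<in> V \<Longrightarrow> f v = 0" "f x = 1"
proof -
  obtain B where B: "B \<subseteq> V" "independent B" "V = span B"
    using basis_exists[of V] span_subspace assms(1) by metis
  have ind: "independent (insert x B)"
    by (rule independent_insertI) (use B assms(2) in simp_all)
  define C where "C = extend_basis (insert x B)"
  have C: "insert x B \<subseteq> C" "independent C" "span C = UNIV"
    unfolding C_def
    using extend_basis_superset[OF ind] independent_extend_basis[OF ind] span_extend_basis[OF ind]
    by blast+
  show ?thesis
  proof
    show "linear_form scale (\<lambda>v. representation C v x)"
      by (rule linear_form_representation) (use C in auto)
    then interpret f: Vector_Spaces.linear scale "(*)" "\<lambda>v. representation C v x" .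
    have xB: "x \<notin> B" using B assms(2) span_base by auto
    show "representation C v x = 0" if "v \<in> V" for v
    proof -
      have "v \<in> span B" using that B by simp
      then show ?thesis
      proof (induction rule: span_induct_alt)
        case base
        show ?case by (rule f.zero)
      next
        case (step c b v)
        then have "representation C b x = 0"
          using xB C by (subst representation_basis[OF C(2)]) auto
        then show ?case
          using step by (simp add: f.add f.scale)
      qed
    qed
    show "representation C x x = 1" using C by (simp add: representation_basis)
  qed
qed

end

context tensor_product
begin

abbreviation represents :: "('a \<times> 'b) list \<Rightarrow> 't \<Rightarrow> bool" where
  "represents ps T \<equiv> T = (\<Sum>(a, b)\<leftarrow>ps. tens a b)"

lemma linear_extension_tens: "Vector_Spaces.linear free_scale sT (linear_extension sT (\<lambda>(a, b). tens a b))"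
  by (rule linear_linear_extension) (rule VT.vector_space_axioms)

lemma tens_relation:
  assumes "u \<in> bilinear_relations sA sB"
  shows "linear_extension sT (\<lambda>(a, b). tens a b) u = 0"
proof -
  interpret free: vector_space free_scale by (rule vector_space_free_scale)
  show ?thesis using kernel free.span_base[OF assms] by blast
qed

lemma bilinear_tens: "bilinear_map sA sB sT tens"
proof -
  interpret p: Vector_Spaces.linear free_scale sT "linear_extension sT (\<lambda>(a, b). tens a b)"
    by (rule linear_extension_tens)
  note s = p.diff p.add linear_extension_single[OF VT.vector_space_axioms]
  have "tens (x + y) z = tens x z + tens y z" for x y z
  proof -
    have "single (x + y, z) 1 - single (x, z) 1 - single (y, z) 1
        \<in> bilinear_relations sA sB" unfolding bilinear_relations_def by blast
    from tens_relation[OF this] show ?thesis by (simp add: s algebra_simps)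
  qed
  moreover have "tens x (y + z) = tens x y + tens x z" for x y z
  proof -
    have "single (x, y + z) 1 - single (x, y) 1 - single (x, z) 1
        \<in> bilinear_relations sA sB" unfolding bilinear_relations_def by blast
    from tens_relation[OF this] show ?thesis by (simp add: s algebra_simps)
  qed
  moreover have "tens (sA c x) y = sT c (tens x y)" for c x y
  proof -
    have "single (sA c x, y) 1 - single (x, y) c
        \<in> bilinear_relations sA sB" unfolding bilinear_relations_def by blast
    from tens_relation[OF this] show ?thesis by (simp add: s)
  qed
  moreover have "tens x (sB c y) = sT c (tens x y)" for c x y
  proof -
    have "single (x, sB c y) 1 - single (x, y) c
        \<in> bilinear_relations sA sB" unfolding bilinear_relations_def by blast
    from tens_relation[OF this] show ?thesis by (simp add: s)
  qed
  ultimately show ?thesis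
    by (simp add: bilinear_map_iff VA.vector_space_axioms VB.vector_space_axioms VT.vector_space_axioms)
qed

lemmas tens_bilinear = bilinear_tens[unfolded bilinear_map_iff[OF VA.vector_space_axioms
  VB.vector_space_axioms VT.vector_space_axioms]]

lemma tens_add_left: "tens (x + y) b = tens x b + tens y b"
  and tens_scale_left: "tens (sA c x) b = sT c (tens x b)"
  and tens_add_right: "tens a (v + w) = tens a v + tens a w"
  and tens_scale_right: "tens a (sB c v) = sT c (tens a v)"
  using tens_bilinear by blast+

text \<open>The coefficients of a preimage in the free vector space are absorbed into the left
  factors, which leaves a plain sum of pure tensors.\<close>

lemma ex_represents: "\<exists>ps. represents ps T"
proof -
  obtain u where u: "T = linear_extension sT (\<lambda>(a, b). tens a b) u"
    using surjective by (metis surjD)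
  have "\<exists>ps. (\<Sum>x\<in>X. sT (lookup u x) (case x of (a, b) \<Rightarrow> tens a b))
      = (\<Sum>(a, b)\<leftarrow>ps. tens a b)" if "finite X" for X
    using that
  proof (induction X)
    case empty
    show ?case by (rule exI[of _ "[]"]) simp
  next
    case (insert x X)
    then obtain ps where ps: "(\<Sum>x\<in>X. sT (lookup u x) (case x of (a, b) \<Rightarrow> tens a b))
      = (\<Sum>(a, b)\<leftarrow>ps. tens a b)" by blast
    obtain a b where x: "x = (a, b)" by fastforce
    show ?case
      unfolding sum.insert[OF insert.hyps] ps
      by (rule exI[of _ "(sA (lookup u x) a, b) # ps"])
        (simp only: x list.map sum_list.Cons prod.case tens_scale_left)
  qed
  from this[OF finite_keys] show ?thesis unfolding u linear_extension_def .
qed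

lemma
  assumes "vector_space sV" "bilinear_map sA sB sV f"
  shows linear_tensor_lift: "Vector_Spaces.linear sT sV (tensor_lift sT sV tens f)"
    and tensor_lift_tens: "tensor_lift sT sV tens f (tens a b) = f a b"
proof -
  have "\<exists>!g. Vector_Spaces.linear sT sV g \<and> (\<forall>a b. g (tens a b) = f a b)"
    by (rule universal_property) (use assms in \<open>auto simp: bilinear_map_def\<close>)
  from theI'[OF this]
  show "Vector_Spaces.linear sT sV (tensor_lift sT sV tens f)"
    "tensor_lift sT sV tens f (tens a b) = f a b"
    unfolding tensor_lift_def by blast+
qed

lemma tensor_lift_represents:
  assumes "vector_space sV" "bilinear_map sA sB sV f" "represents ps T"
  shows "tensor_lift sT sV tens f T = (\<Sum>(a, b)\<leftarrow>ps. f a b)"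
  unfolding assms(3) linear_sum_list[OF linear_tensor_lift[OF assms(1,2)]]
  by (intro arg_cong[of _ _ sum_list] map_cong) (auto simp: tensor_lift_tens[OF assms(1,2)])

text \<open>The slice map f \<otimes> id, with \<open>k \<otimes> B\<close> identified with
  \<open>B\<close>; \<open>contract_right\<close> is id \<otimes> g.\<close>

definition contract_left :: "('a \<Rightarrow> 'k) \<Rightarrow> 't \<Rightarrow> 'b" where
  "contract_left f = tensor_lift sT sB tens (\<lambda>a b. sB (f a) b)"

definition contract_right :: "('b \<Rightarrow> 'k) \<Rightarrow> 't \<Rightarrow> 'a" where
  "contract_right g = tensor_lift sT sA tens (\<lambda>a b. sA (g b) a)"

lemma bilinear_contract_left:
  "linear_form sA f \<Longrightarrow> bilinear_map sA sB sB (\<lambda>a b. sB (f a) b)"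
  by (auto simp: bilinear_map_iff VA.vector_space_axioms VB.vector_space_axioms Vector_Spaces.linear_iff
      VB.scale_left_distrib VB.scale_right_distrib mult.commute)

lemma bilinear_contract_right:
  "linear_form sB g \<Longrightarrow> bilinear_map sA sB sA (\<lambda>a b. sA (g b) a)"
  by (auto simp: bilinear_map_iff VA.vector_space_axioms VB.vector_space_axioms Vector_Spaces.linear_iff
      VA.scale_left_distrib VA.scale_right_distrib mult.commute)

lemma contract_left_represents:
  "linear_form sA f \<Longrightarrow> represents ps T \<Longrightarrow> contract_left f T = (\<Sum>(a, b)\<leftarrow>ps. sB (f a) b)"
  unfolding contract_left_def
  by (rule tensor_lift_represents) (auto intro: VB.vector_space_axioms bilinear_contract_left)

lemma contract_right_represents:
  "linear_form sB g \<Longrightarrow> represents ps T \<Longrightarrow> contract_right g T = (\<Sum>(a, b)\<leftarrow>ps. sA (g b) a)"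
  unfolding contract_right_def
  by (rule tensor_lift_represents) (auto intro: VA.vector_space_axioms bilinear_contract_right)

lemma linear_contract_left: "linear_form sA f \<Longrightarrow> Vector_Spaces.linear sT sB (contract_left f)"
  unfolding contract_left_def
  by (rule linear_tensor_lift) (auto intro: VB.vector_space_axioms bilinear_contract_left)

lemma contract_left_tens: "linear_form sA f \<Longrightarrow> contract_left f (tens a b) = sB (f a) b"
  using contract_left_represents[of f "tens a b" "[(a, b)]"] by simp

lemma linear_contract_right: "linear_form sB g \<Longrightarrow> Vector_Spaces.linear sT sA (contract_right g)"
  unfolding contract_right_def
  by (rule linear_tensor_lift) (auto intro: VA.vector_space_axioms bilinear_contract_right)

lemma contract_right_tens: "linear_form sB g \<Longrightarrow> contract_right g (tens a b) = sA (g b) a"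
  using contract_right_represents[of g "tens a b" "[(a, b)]"] by simp

text \<open>Both sides are f \<otimes> g applied to \<open>T\<close>.\<close>

lemma contract_left_right:
  assumes "linear_form sA f" "linear_form sB g"
  shows "g (contract_left f T) = f (contract_right g T)"
proof -
  obtain ps where ps: "represents ps T" using ex_represents by blast
  interpret f: Vector_Spaces.linear sA "(*)" f by fact
  interpret g: Vector_Spaces.linear sB "(*)" g by fact
  show ?thesis
    unfolding contract_left_represents[OF assms(1) ps] contract_right_represents[OF assms(2) ps]
      linear_sum_list[OF assms(1)] linear_sum_list[OF assms(2)]
    by (intro arg_cong[of _ _ sum_list] map_cong) (auto simp: f.scale g.scale)
qed

text \<open>Through this fact the coideal condition is used: a coproduct with values in
  \<open>H \<otimes> A\<close> makes every operator (f \<otimes> id) after the coproduct preserve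
  \<open>A\<close>.\<close>

lemma contract_left_span:
  assumes f: "linear_form sA f" and W: "VB.subspace W"
    and T: "T \<in> VT.span {tens v w |v w. v \<in> V \<and> w \<in> W}"
  shows "contract_left f T \<in> W"
proof -
  interpret L: Vector_Spaces.linear sT sB "contract_left f" by (rule linear_contract_left[OF f])
  show ?thesis using T
    by (induction rule: VT.span_induct_alt)
      (auto simp: L.zero L.add L.scale contract_left_tens[OF f] intro!: VB.subspace_0 VB.subspace_add VB.subspace_scale W)
qed

lemma contract_right_span:
  assumes g: "linear_form sB g" and V: "VA.subspace V"
    and T: "T \<in> VT.span {tens v w |v w. v \<in> V \<and> w \<in> W}"
  shows "contract_right g T \<in> V"
proof -
  interpret L: Vector_Spaces.linear sT sA "contract_right g" by (rule linear_contract_right[OF g])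
  show ?thesis using T
    by (induction rule: VT.span_induct_alt)
      (auto simp: L.zero L.add L.scale contract_right_tens[OF g] intro!: VA.subspace_0 VA.subspace_add VA.subspace_scale V)
qed

text \<open>Expanding the left factors of a presentation in \<open>B\<close> and collecting terms
  gives the coefficient of each basis vector as the slice of \<open>T\<close> at its coordinate
  form. A presentation is finite, so only finitely many basis vectors occur.\<close>

lemma basis_expansion:
  assumes B: "VA.independent B" "VA.span B = UNIV"
  obtains S where "finite S" "S \<subseteq> B"
    "T = (\<Sum>b\<in>S. tens b (contract_left (\<lambda>x. VA.representation B x b) T))"
proof -
  let ?r = "\<lambda>b x. VA.representation B x b"
  have r: "linear_form sA (?r b)" for b
    by (rule VA.linear_form_representation[OF B])
  obtain ps where ps: "represents ps T" using ex_represents by blast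
  define S where "S = (\<Union>(a, b)\<in>set ps. {x. ?r x a \<noteq> 0})"
  interpret rt: Vector_Spaces.linear sB sT "tens a" for a
    using bilinear_tens by (simp add: bilinear_map_def)
  have fin: "finite S" unfolding S_def by (auto intro: VA.finite_representation)
  have "S \<subseteq> B" unfolding S_def by (auto dest: VA.representation_ne_zero)
  have a: "tens a b = (\<Sum>e\<in>S. tens e (sB (?r e a) b))" if "(a, b) \<in> set ps" for a b
  proof -
    interpret lt: Vector_Spaces.linear sA sT "\<lambda>a. tens a b"
      using bilinear_tens by (simp add: bilinear_map_def)
    have "a = (\<Sum>e | ?r e a \<noteq> 0. sA (?r e a) e)"
      by (rule VA.sum_nonzero_representation_eq[symmetric]) (use B in auto)
    also have "\<dots> = (\<Sum>e\<in>S. sA (?r e a) e)"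
      by (rule sum.mono_neutral_left) (use that fin in \<open>auto simp: S_def\<close>)
    finally have "tens a b = tens (\<Sum>e\<in>S. sA (?r e a) e) b" by simp
    then show ?thesis by (simp add: lt.sum tens_scale_left tens_scale_right)
  qed
  have "T = (\<Sum>(a, b)\<leftarrow>ps. \<Sum>e\<in>S. tens e (sB (?r e a) b))"
    unfolding ps by (intro arg_cong[of _ _ sum_list] map_cong) (auto simp: a)
  also have "\<dots> = (\<Sum>e\<in>S. \<Sum>(a, b)\<leftarrow>ps. tens e (sB (?r e a) b))"
    by (induction ps) (auto simp: sum.distrib)
  also have "\<dots> = (\<Sum>e\<in>S. tens e (contract_left (?r e) T))"
    unfolding contract_left_represents[OF r ps] rt.linear_axioms[THEN linear_sum_list]
    by (intro sum.cong arg_cong[of _ _ sum_list] map_cong) auto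
  finally show ?thesis using that fin \<open>S \<subseteq> B\<close> by blast
qed

end

section \<open>One-sided evaluation of the coproduct\<close>

lemma sum_list_swap: "(\<Sum>x\<leftarrow>xs. \<Sum>y\<leftarrow>ys. f x y) = (\<Sum>y\<leftarrow>ys. \<Sum>x\<leftarrow>xs. (f x y :: 'a::comm_monoid_add))"
  by (induction xs) (simp_all add: sum_list_addf)

lemma sum_list_sum_swap:
  "(\<Sum>(c, d)\<leftarrow>xs. \<Sum>e\<in>S. f c d e) = (\<Sum>e\<in>S. \<Sum>(c, d)\<leftarrow>xs. (f c d e :: 'a::comm_monoid_add))"
  by (induction xs) (auto simp: sum.distrib)

lemma previous_0 [simp]: "previous F 0 = {0}"
  and previous_Suc [simp]: "previous F (Suc n) = F n"
  by (simp_all add: previous_def)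

lemma (in k_algebra) mult_span_one: "x \<in> span {1} \<Longrightarrow> \<exists>c. x = scale c 1"
  by (auto simp: span_singleton)

text \<open>
  A coproduct seen only through one-sided evaluation: with \<open>terms x\<close> listing the summands
  \<open>a \<otimes> b\<close> of \<open>\<Delta> x\<close>, the map \<open>act f\<close> is \<open>(f \<otimes> id) \<circ> \<Delta>\<close>.  Swapping the two tensor factors
  gives a second instance, which covers coideals on the other side.
\<close>

locale filtered_coproduct = k_algebra scale
  for scale :: "'k::field \<Rightarrow> 'h::ring_1 \<Rightarrow> 'h" +
  fixes terms :: "'h \<Rightarrow> ('h \<times> 'h) list" and act :: "('h \<Rightarrow> 'k) \<Rightarrow> 'h \<Rightarrow> 'h"
    and counit :: "'h \<Rightarrow> 'k" and C :: "nat \<Rightarrow> 'h set"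
  assumes counit_form: "linear_form scale counit"
    and counit_1: "counit 1 = 1"
    and act_terms: "linear_form scale f \<Longrightarrow> act f x = (\<Sum>(a, b)\<leftarrow>terms x. scale (f a) b)"
    and act_linear: "linear_form scale f \<Longrightarrow> Vector_Spaces.linear scale scale (act f)"
    and act_times: "linear_form scale f \<Longrightarrow>
      act f (x * y) = (\<Sum>(a, b)\<leftarrow>terms x. \<Sum>(c, d)\<leftarrow>terms y. scale (f (a * c)) (b * d))"
    and act_counit: "act counit x = x"
    and counit_act: "linear_form scale f \<Longrightarrow> counit (act f x) = f x"
    and act_one: "linear_form scale f \<Longrightarrow> act f 1 = scale (f 1) 1"
    and C_0: "C 0 = span {1}"
    and C_Suc: "C (Suc n) = {x. \<forall>f. linear_form scale f \<longrightarrow> f 1 = 0 \<longrightarrow> act f x \<in> C n}"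
begin

definition augmentation :: "('h \<Rightarrow> 'k) set" where
  "augmentation = {f. linear_form scale f \<and> f 1 = 0}"

lemma augmentation_linear: "f \<in> augmentation \<Longrightarrow> linear_form scale f"
  and augmentation_one: "f \<in> augmentation \<Longrightarrow> f 1 = 0"
  by (simp_all add: augmentation_def)

lemma in_C_Suc_iff: "x \<in> C (Suc n) \<longleftrightarrow> (\<forall>f\<in>augmentation. act f x \<in> C n)"
  by (auto simp: C_Suc augmentation_def)

lemma act_add: "linear_form scale f \<Longrightarrow> act f (x + y) = act f x + act f y"
  and act_scale: "linear_form scale f \<Longrightarrow> act f (scale c x) = scale c (act f x)"
  and act_zero: "linear_form scale f \<Longrightarrow> act f 0 = 0"
  and act_diff: "linear_form scale f \<Longrightarrow> act f (x - y) = act f x - act f y"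
proof -
  assume "linear_form scale f"
  then interpret f: Vector_Spaces.linear scale scale "act f" by (rule act_linear)
  show "act f (x + y) = act f x + act f y" "act f (scale c x) = scale c (act f x)"
    "act f 0 = 0" "act f (x - y) = act f x - act f y"
    by (rule f.add f.scale f.zero f.diff)+
qed

lemma subspace_C: "subspace (C n)"
proof (induction n)
  case 0
  show ?case by (simp add: C_0 subspace_span)
next
  case (Suc n)
  show ?case
    by (rule subspaceI)
      (auto simp: in_C_Suc_iff act_zero act_add act_scale augmentation_linear
        intro: subspace_0 subspace_add subspace_scale Suc)
qed

lemma subspace_previous_C: "subspace (previous C n)"
  by (cases n) (simp_all add: subspace_C subspace_single_0)

text \<open>In degree 0 the operator is zero because \<open>f 1 = 0\<close>, in accordance with
  \<open>previous C 0 = {0}\<close>.\<close>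

lemma act_lower:
  assumes "f \<in> augmentation" "x \<in> C n"
  shows "act f x \<in> previous C n"
proof (cases n)
  case 0
  then obtain c where "x = scale c 1" using assms(2) mult_span_one by (auto simp: C_0)
  then show ?thesis using assms(1) 0
    by (simp add: augmentation_linear act_scale act_one augmentation_one)
next
  case (Suc m)
  then show ?thesis using assms by (simp add: in_C_Suc_iff)
qed

lemma zero_in_previous_C [simp]: "0 \<in> previous C n"
  by (rule subspace_0[OF subspace_previous_C])

lemma C_mono_Suc: "C n \<subseteq> C (Suc n)"
proof (induction n)
  case 0
  show ?case
    using act_lower[of _ _ 0] subspace_0[OF subspace_C] by (auto simp: in_C_Suc_iff)
next
  case (Suc n)
  show ?case
  proof
    fix x assume "x \<in> C (Suc n)"
    then have "\<forall>f\<in>augmentation. act f x \<in> C (Suc n)" using Suc in_C_Suc_iff by blast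
    then show "x \<in> C (Suc (Suc n))" by (simp only: in_C_Suc_iff[of x "Suc n"])
  qed
qed

lemma C_mono: "m \<le> n \<Longrightarrow> C m \<subseteq> C n"
  by (rule lift_Suc_mono_le[of C]) (rule C_mono_Suc)

lemma previous_C_subset: "previous C n \<subseteq> C n"
  by (cases n) (auto simp: C_mono_Suc[THEN subsetD] intro: subspace_0 subspace_C)

text \<open>The coordinates of \<open>L\<close> in a basis of \<open>V\<close> are forms that vanish at \<open>1\<close>.\<close>

lemma sum_terms_linear_factor:
  assumes L: "Vector_Spaces.linear scale scale L" "L 1 = 0" "\<And>c. L c \<in> V"
    and V: "subspace V" and y: "y \<in> C n"
  shows "(\<Sum>(c, d)\<leftarrow>terms y. L c * d) \<in> span {a * b |a b. a \<in> V \<and> b \<in> previous C n}"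
proof -
  interpret L: Vector_Spaces.linear scale scale L by fact
  obtain B where B: "B \<subseteq> V" "independent B" "span B = V"
    using basis_exists[of V] span_subspace V by metis
  define l where "l e c = representation B (L c) e" for e c
  have l: "l e \<in> augmentation" for e
    unfolding augmentation_def l_def mem_Collect_eq
    by (intro conjI Vector_Spaces.linear_iff[THEN iffD2] vector_space_axioms vector_space_self)
      (use B L in \<open>simp_all add: L.add L.scale representation_add representation_scale representation_zero
         vector_space_axioms vector_space_self\<close>)
  define S where "S = (\<Union>(c, d)\<in>set (terms y). {e. l e c \<noteq> 0})"
  have S: "finite S" "S \<subseteq> V"
    using B by (auto simp: S_def l_def finite_representation dest: representation_ne_zero)
  have "L c = (\<Sum>e\<in>S. scale (l e c) e)" if "(c, d) \<in> set (terms y)" for c d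
  proof -
    have "L c = (\<Sum>e | representation B (L c) e \<noteq> 0. scale (representation B (L c) e) e)"
      by (rule sum_nonzero_representation_eq[symmetric]) (use B L in auto)
    also have "\<dots> = (\<Sum>e\<in>S. scale (l e c) e)"
      unfolding l_def by (rule sum.mono_neutral_left) (use S that in \<open>auto simp: S_def l_def\<close>)
    finally show ?thesis .
  qed
  then have "(\<Sum>(c, d)\<leftarrow>terms y. L c * d) = (\<Sum>(c, d)\<leftarrow>terms y. \<Sum>e\<in>S. e * scale (l e c) d)"
    by (intro arg_cong[of _ _ sum_list] map_cong)
      (auto simp: sum_distrib_right scale_mult_left scale_mult_right)
  also have "\<dots> = (\<Sum>e\<in>S. \<Sum>(c, d)\<leftarrow>terms y. e * scale (l e c) d)"
    by (rule sum_list_sum_swap)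
  also have "\<dots> = (\<Sum>e\<in>S. e * act (l e) y)"
    by (simp add: act_terms[OF augmentation_linear[OF l]] sum_list_const_mult[symmetric] case_prod_unfold)
  also have "\<dots> \<in> span {a * b |a b. a \<in> V \<and> b \<in> previous C n}"
    by (intro span_sum span_base) (use S act_lower[OF l y] in blast)
  finally show ?thesis .
qed

text \<open>Let \<open>k a\<close> be the component of \<open>a\<close> in the kernel of the counit.
  Multiplying out f((k a + counit a)(k c + counit c)) with \<open>f 1 = 0\<close> gives the two
  Leibniz terms and the remainder \<open>g c a\<close>, which vanishes when either argument is 1. So
  the remainder lowers both factors at once.\<close>

lemma act_times_error:
  assumes f: "f \<in> augmentation" and x: "x \<in> C m" and y: "y \<in> C n"
  shows "act f (x * y) - (act f x * y + x * act f y)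
    \<in> span {a * b |a b. a \<in> previous C m \<and> b \<in> previous C n}"
proof -
  interpret f: Vector_Spaces.linear scale "(*)" f by (rule augmentation_linear[OF f])
  interpret e: Vector_Spaces.linear scale "(*)" counit by (rule counit_form)
  note f' = augmentation_linear[OF f]
  define k where "k a = a - scale (counit a) 1" for a
  define g where "g c a = f (k a * k c)" for a c
  have k: "k (a + b) = k a + k b" "k (scale c a) = scale c (k a)" "k 1 = 0" for a b c
    by (simp_all add: k_def e.add e.scale scale_left_distrib scale_right_diff_distrib counit_1)
  have g: "g c \<in> augmentation" for c
    by (simp add: augmentation_def Vector_Spaces.linear_iff vector_space_axioms vector_space_self
        g_def k distrib_right scale_mult_left f.add f.scale f.zero)
  have split: "f (a * c) = counit a * f c + f a * counit c + g c a" for a c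
    using augmentation_one[OF f]
    by (simp add: g_def k_def algebra_simps scale_mult_left scale_mult_right f.add f.diff f.scale)
  have "act f (x * y) = (\<Sum>(a, b)\<leftarrow>terms x. \<Sum>(c, d)\<leftarrow>terms y.
      scale (counit a) b * scale (f c) d + scale (f a) b * scale (counit c) d + scale (g c a) b * d)"
    unfolding act_times[OF f']
    by (intro arg_cong[of _ _ sum_list] map_cong)
      (auto simp: split scale_left_distrib scale_mult_left scale_mult_right mult.commute)
  also have "\<dots> = act counit x * act f y + act f x * act counit y
      + (\<Sum>(a, b)\<leftarrow>terms x. \<Sum>(c, d)\<leftarrow>terms y. scale (g c a) b * d)"
    unfolding act_terms[OF f'] act_terms[OF counit_form]
    by (simp add: case_prod_unfold sum_list_addf sum_list_const_mult sum_list_mult_const)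
  also have "(\<Sum>(a, b)\<leftarrow>terms x. \<Sum>(c, d)\<leftarrow>terms y. scale (g c a) b * d)
      = (\<Sum>(c, d)\<leftarrow>terms y. act (g c) x * d)"
    unfolding act_terms[OF augmentation_linear[OF g]]
    by (simp add: case_prod_unfold sum_list_mult_const[symmetric]) (rule sum_list_swap)
  finally have eq: "act f (x * y) - (act f x * y + x * act f y) = (\<Sum>(c, d)\<leftarrow>terms y. act (g c) x * d)"
    by (simp add: act_counit)
  show ?thesis
    unfolding eq
  \<comment> \<open>The map sending \<open>c\<close> to \<open>act (g c) x\<close> is linear, kills
    1 and already takes values in \<open>previous C m\<close>; its vanishing at 1 is what lowers the
    factor coming from \<open>y\<close>.\<close>
  proof (rule sum_terms_linear_factor[OF _ _ _ subspace_previous_C y])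
    show "act (g c) x \<in> previous C m" for c by (rule act_lower[OF g x])
    have "act (g (c + c')) x = act (g c) x + act (g c') x" for c c'
      unfolding act_terms[OF augmentation_linear[OF g]]
      by (simp add: g_def k distrib_left f.add scale_left_distrib case_prod_unfold sum_list_addf)
    moreover have "act (g (scale r c)) x = scale r (act (g c) x)" for c r
      unfolding act_terms[OF augmentation_linear[OF g]]
      by (simp add: g_def k scale_mult_right f.scale case_prod_unfold scale_sum_list_right)
    ultimately show "Vector_Spaces.linear scale scale (\<lambda>c. act (g c) x)"
      by (simp add: Vector_Spaces.linear_iff vector_space_axioms)
    show "act (g 1) x = 0"
      unfolding act_terms[OF augmentation_linear[OF g]] by (simp add: g_def k f.zero case_prod_unfold)
  qed
qed

text \<open>Membership in a positive step is tested by all \<open>act f\<close>. The Leibniz terms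
  of \<open>act f (x * y)\<close> have total degree one less and its error term two less, so the
  induction on \<open>m + n\<close> applies to all of them; elements of degree 0 are
  scalars.\<close>

lemma C_mult: "x \<in> C m \<Longrightarrow> y \<in> C n \<Longrightarrow> x * y \<in> C (m + n)"
proof (induction "m + n" arbitrary: m n x y rule: less_induct)
  case less
  consider "m = 0" | "n = 0" | m' n' where "m = Suc m'" "n = Suc n'"
    by (metis old.nat.exhaust)
  then show ?case
  proof cases
    case 1
    then obtain c where "x = scale c 1" using less.prems mult_span_one by (auto simp: C_0)
    then show ?thesis using less.prems 1 by (simp add: scale_mult_left subspace_scale[OF subspace_C])
  next
    case 2
    then obtain c where "y = scale c 1" using less.prems mult_span_one by (auto simp: C_0)
    then show ?thesis using less.prems 2 by (simp add: scale_mult_right subspace_scale[OF subspace_C])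
  next
    case 3
    have "act f (x * y) \<in> C (Suc (m' + n'))" if f: "f \<in> augmentation" for f
    proof -
      let ?e = "act f (x * y) - (act f x * y + x * act f y)"
      have "act f x * y \<in> C (m' + n)" "x * act f y \<in> C (m + n')"
        using less.hyps[of m' n "act f x" y] less.hyps[of m n' x "act f y"] less.prems 3 act_lower[OF f] f
        by (auto simp: in_C_Suc_iff)
      moreover have "span {a * b |a b. a \<in> previous C m \<and> b \<in> previous C n} \<subseteq> C (m' + n')"
        using less.hyps[of m' n'] 3 by (intro span_minimal subspace_C) auto
      then have "?e \<in> C (m' + n')"
        using act_times_error[OF f less.prems] by blast
      then have "?e \<in> C (Suc (m' + n'))" using C_mono_Suc by blast
      ultimately have "?e + act f x * y + x * act f y \<in> C (Suc (m' + n'))"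
        using 3 by (intro subspace_add[OF subspace_C]) simp_all
      then show ?thesis by (simp add: algebra_simps)
    qed
    then show ?thesis using 3 by (simp add: in_C_Suc_iff)
  qed
qed

text \<open>Both factors of the error are lowered, so it has degree \<open>m + n - 2\<close>,
  written as the step before \<open>m + n - 1\<close>. Truncated subtraction does no harm: if
  \<open>m\<close> or \<open>n\<close> is 0, the corresponding factor is 0.\<close>

lemma act_leibniz:
  assumes "f \<in> augmentation" "x \<in> C m" "y \<in> C n"
  shows "act f (x * y) - (act f x * y + x * act f y) \<in> previous C (m + n - 1)"
proof -
  have "a * b \<in> previous C (m + n - 1)" if "a \<in> previous C m" "b \<in> previous C n" for a b
    using that C_mult by (cases m; cases n) auto
  then have "span {a * b |a b. a \<in> previous C m \<and> b \<in> previous C n} \<subseteq> previous C (m + n - 1)"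
    by (intro span_minimal subspace_previous_C) auto
  then show ?thesis using act_times_error[OF assms] by blast
qed

text \<open>Up to Leibniz errors, \<open>act f\<close> is a derivation of the commutator, so
  \<open>act f (x * y - y * x)\<close> is a sum of two commutators of smaller total degree. This
  makes the graded algebra commutative.\<close>

lemma C_commutator: "x \<in> C m \<Longrightarrow> y \<in> C n \<Longrightarrow> x * y - y * x \<in> previous C (m + n)"
proof (induction "m + n" arbitrary: m n x y rule: less_induct)
  case less
  consider "m = 0" | "n = 0" | m' n' where "m = Suc m'" "n = Suc n'"
    by (metis old.nat.exhaust)
  then show ?case
  proof cases
    case 1
    then obtain c where "x = scale c 1" using less.prems mult_span_one by (auto simp: C_0)
    then show ?thesis by (simp add: scale_mult_left scale_mult_right)
  next
    case 2
    then obtain c where "y = scale c 1" using less.prems mult_span_one by (auto simp: C_0)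
    then show ?thesis by (simp add: scale_mult_left scale_mult_right)
  next
    case 3
    have "act f (x * y - y * x) \<in> C (m' + n')" if f: "f \<in> augmentation" for f
    proof -
      have "act f x * y - y * act f x \<in> C (m' + n')" "x * act f y - act f y * x \<in> C (m' + n')"
        using less.hyps[of m' n "act f x" y] less.hyps[of m n' x "act f y"] less.prems 3 f
        by (auto simp: in_C_Suc_iff)
      moreover have "act f (x * y) - (act f x * y + x * act f y) \<in> C (m' + n')"
        "act f (y * x) - (act f y * x + y * act f x) \<in> C (m' + n')"
        using act_leibniz[OF f less.prems] act_leibniz[OF f less.prems(2,1)] 3
        by (simp_all add: add.commute)
      ultimately have "(act f x * y - y * act f x) + (x * act f y - act f y * x)
        + (act f (x * y) - (act f x * y + x * act f y)) - (act f (y * x) - (act f y * x + y * act f x))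
        \<in> C (m' + n')"
        by (simp only: subspace_add[OF subspace_C] subspace_diff[OF subspace_C])
      then show ?thesis by (simp add: act_diff augmentation_linear[OF f] algebra_simps)
    qed
    then show ?thesis using 3 by (simp add: in_C_Suc_iff)
  qed
qed

text \<open>Only \<open>n = 0\<close> needs an argument. There all \<open>act f x\<close> vanish, so
  \<open>f x = counit (act f x) = 0\<close> for every form that kills 1, and a separating form shows
  that \<open>x\<close> is a scalar.\<close>

lemma C_detect:
  assumes "\<And>f. f \<in> augmentation \<Longrightarrow> act f x \<in> previous C n"
  shows "x \<in> C n"
proof (cases n)
  case 0
  show ?thesis
  proof (rule ccontr)
    assume "x \<notin> C n"
    then obtain f where f: "linear_form scale f" "\<And>v. v \<in> span {1} \<Longrightarrow> f v = 0" "f x = 1"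
      using separating_linear_form[of "span {1}" x] 0 by (auto simp: C_0)
    then have "f \<in> augmentation" by (simp add: augmentation_def span_base)
    then have "counit (act f x) = counit 0" using assms 0 by fastforce
    then show False
      using counit_act[OF f(1), of x] counit_act[OF f(1), of 0] act_zero[OF f(1)] f(2)[OF span_zero] f(3)
      by simp
  qed
next
  case (Suc m)
  then show ?thesis using assms by (simp add: in_C_Suc_iff)
qed

end

section \<open>Linear forms and finite-dimensional subspaces\<close>

context vector_space
begin

lemma form_iff: "linear_form scale f \<longleftrightarrow> (\<forall>x y. f (x + y) = f x + f y) \<and> (\<forall>c x. f (scale c x) = c * f x)"
  by (simp add: Vector_Spaces.linear_iff vector_space_axioms vector_space_self)

lemma form_add: "linear_form scale f \<Longrightarrow> linear_form scale g \<Longrightarrow> linear_form scale (\<lambda>t. f t + g t)"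
  and form_diff: "linear_form scale f \<Longrightarrow> linear_form scale g \<Longrightarrow> linear_form scale (\<lambda>t. f t - g t)"
  and form_cmult: "linear_form scale f \<Longrightarrow> linear_form scale (\<lambda>t. c * f t)"
  by (simp_all add: form_iff algebra_simps)

lemma scale_sum_list_left: "(\<Sum>x\<leftarrow>xs. scale (g x) v) = scale (\<Sum>x\<leftarrow>xs. g x) v"
  by (induction xs) (auto simp: scale_left_distrib)

text \<open>The finite spanning set \<open>W\<close> keeps all bases finite, so that a basis of
  \<open>S\<close> extended to one of \<open>T\<close> cannot grow without raising the
  dimension.\<close>

lemma subspace_eq_if_dim_le:
  assumes "subspace S" "S \<subseteq> T" "subspace T" "T \<subseteq> span W" "finite W" "dim T \<le> dim S"
  shows "S = T"
proof -
  obtain B where B: "B \<subseteq> S" "independent B" "S \<subseteq> span B"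
    using maximal_independent_subset by blast
  obtain B' where B': "B \<subseteq> B'" "B' \<subseteq> T" "independent B'" "T \<subseteq> span B'"
    using maximal_independent_subset_extend[of B T] B assms(2) by blast
  have "finite B'" using independent_span_bound[OF assms(5) B'(3)] B' assms by blast
  moreover have "card B' \<le> card B"
    using assms(6) basis_card_eq_dim[OF B(1,3,2)] basis_card_eq_dim[OF B'(2,4,3)] by simp
  ultimately have "B = B'" using B'(1) by (simp add: card_seteq)
  then have "T \<subseteq> span S" using B' B span_mono by blast
  then show ?thesis using assms(1,2) by (simp add: span_eq_iff[THEN iffD2] subset_antisym)
qed

lemma ex_finite_basis_of_subspace:
  assumes "T \<subseteq> span W" "finite W" "subspace T"
  obtains B where "finite B" "B \<subseteq> T" "span B = T"
proof -
  obtain B where B: "B \<subseteq> T" "independent B" "T \<subseteq> span B"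
    using maximal_independent_subset by blast
  then have "finite B" using independent_span_bound[OF assms(2) B(2)] assms by blast
  then show ?thesis using that B span_subspace assms(3) by metis
qed

end

text \<open>Converse of \<open>contract_left_span\<close> and \<open>contract_right_span\<close>.
  Expand \<open>T\<close> in a basis extending a basis of \<open>V\<close>. The coefficients are
  left slices, hence in \<open>W\<close>. The coefficient at a basis vector outside \<open>V\<close>
  is zero, because any form \<open>g\<close> of it is a coordinate outside \<open>V\<close> of the
  right slice by \<open>g\<close>, which lies in \<open>V\<close>.\<close>

lemma (in tensor_product) tensor_subspace_memI:
  assumes V: "VA.subspace V" and W: "VB.subspace W"
    and l: "\<And>f. linear_form sA f \<Longrightarrow> contract_left f T \<in> W" and r: "\<And>g. linear_form sB g \<Longrightarrow> contract_right g T \<in> V"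
  shows "T \<in> VT.span {tens v w |v w. v \<in> V \<and> w \<in> W}"
proof -
  obtain B0 where B0: "B0 \<subseteq> V" "VA.independent B0" "V \<subseteq> VA.span B0"
    using VA.maximal_independent_subset by blast
  define B where "B = VA.extend_basis B0"
  have B: "B0 \<subseteq> B" "VA.independent B" "VA.span B = UNIV"
    unfolding B_def using VA.extend_basis_superset[OF B0(2)] VA.independent_extend_basis[OF B0(2)]
      VA.span_extend_basis[OF B0(2)] by blast+
  let ?r = "\<lambda>b x. VA.representation B x b"
  have rf: "linear_form sA (?r b)" for b by (rule VA.linear_form_representation[OF B(2,3)])
  obtain S where S: "finite S" "S \<subseteq> B" "T = (\<Sum>b\<in>S. tens b (contract_left (?r b) T))"
    using basis_expansion[OF B(2,3)] by blast
  have zero: "?r b v = 0" if "v \<in> V" "b \<in> B" "b \<notin> B0" for b v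
  proof -
    have "v \<in> VA.span B0" using that B0 by blast
    then have "?r b v = VA.representation B0 v b"
      using VA.representation_extend[OF B(2) _ B(1)] by metis
    then show ?thesis using that VA.representation_ne_zero by metis
  qed
  have "contract_left (?r b) T = 0" if b: "b \<in> S" "b \<notin> B0" for b
  proof (rule ccontr)
    assume ne: "contract_left (?r b) T \<noteq> 0"
    obtain g where g: "linear_form sB g" "g (contract_left (?r b) T) = 1"
      using VB.separating_linear_form[OF VB.subspace_single_0] ne by blast
    have "g (contract_left (?r b) T) = ?r b (contract_right g T)"
      by (rule contract_left_right[OF rf g(1)])
    also have "\<dots> = 0" using zero[OF r[OF g(1)]] b S by blast
    finally show False using g by simp
  qed
  then have "tens b (contract_left (?r b) T) \<in> VT.span {tens v w |v w. v \<in> V \<and> w \<in> W}"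
    if "b \<in> S" for b
  proof (cases "b \<in> B0")
    case True
    then show ?thesis using l[OF rf] B0(1) by (intro VT.span_base) blast
  next
    case False
    then have "tens b (contract_left (?r b) T) = tens 0 0"
      using \<open>\<And>b. b \<in> S \<Longrightarrow> b \<notin> B0 \<Longrightarrow> contract_left (?r b) T = 0\<close>[OF that False]
        tens_scale_right[of b 0 0] tens_scale_right[of 0 0 0] by simp
    then show ?thesis
      using VA.subspace_0[OF V] VB.subspace_0[OF W] by (intro VT.span_base) blast
  qed
  then show ?thesis by (subst S(3)) (rule VT.span_sum)
qed

section \<open>Coassociativity in terms of one-sided evaluations\<close>

context coalgebra
begin

text \<open>Stands in for Sweedler notation: one arbitrary presentation of the coproduct is fixed
  for every element.\<close>

definition summands :: "'h \<Rightarrow> ('h \<times> 'h) list" where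
  "summands x = (SOME ps. HH.represents ps (comult x))"

lemma comult_summands: "comult x = (\<Sum>(a, b)\<leftarrow>summands x. tens a b)"
  unfolding summands_def by (rule someI_ex) (rule HH.ex_represents)

definition eval_left :: "('h \<Rightarrow> 'k) \<Rightarrow> 'h \<Rightarrow> 'h" where
  "eval_left f x = HH.contract_left f (comult x)"

definition eval_right :: "('h \<Rightarrow> 'k) \<Rightarrow> 'h \<Rightarrow> 'h" where
  "eval_right g x = HH.contract_right g (comult x)"

lemma eval_left_summands: "linear_form scale f \<Longrightarrow> eval_left f x = (\<Sum>(a, b)\<leftarrow>summands x. scale (f a) b)"
  unfolding eval_left_def by (rule HH.contract_left_represents) (auto intro: comult_summands)

lemma eval_right_summands: "linear_form scale g \<Longrightarrow> eval_right g x = (\<Sum>(a, b)\<leftarrow>summands x. scale (g b) a)"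
  unfolding eval_right_def by (rule HH.contract_right_represents) (auto intro: comult_summands)

lemma linear_eval_left: "linear_form scale f \<Longrightarrow> Vector_Spaces.linear scale scale (eval_left f)"
  unfolding eval_left_def
  using Vector_Spaces.linear_compose[OF comult_linear HH.linear_contract_left] by (simp add: o_def)

lemma linear_eval_right: "linear_form scale f \<Longrightarrow> Vector_Spaces.linear scale scale (eval_right f)"
  unfolding eval_right_def
  using Vector_Spaces.linear_compose[OF comult_linear HH.linear_contract_right] by (simp add: o_def)

lemma form_eval_left: "linear_form scale h \<Longrightarrow> linear_form scale f \<Longrightarrow> linear_form scale (\<lambda>t. h (eval_left f t))"
  using Vector_Spaces.linear_compose[OF linear_eval_left] by (simp add: o_def)

text \<open>A bilinear \<open>P\<close> on \<open>H \<otimes> H\<close> and \<open>H\<close> is a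
  linear map on the triple tensor product, and the coassociativity axiom is pushed through it. The
  composition laws of evaluations below arise by choosing \<open>P\<close>.\<close>

lemma coassoc_sum:
  assumes V: "vector_space sV" and P: "bilinear_map scaleT scale sV P"
  shows "(\<Sum>(a, b)\<leftarrow>summands x. P (comult a) b) = (\<Sum>(a, b)\<leftarrow>summands x. \<Sum>(c, d)\<leftarrow>summands b. P (tens a c) d)"
proof -
  let ?p = "tensor_lift scaleU sV tens3 P"
  note lin = HHH.linear_tensor_lift[OF V P] and p = HHH.tensor_lift_tens[OF V P]
  note vs = H.vector_space_axioms HH.VT.vector_space_axioms HHH.VT.vector_space_axioms
  interpret co: Vector_Spaces.linear scale scaleT comult by (rule comult_linear)
  have b1: "bilinear_map scale scale scaleU (\<lambda>a b. tens3 (comult a) b)"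
    by (simp add: bilinear_map_iff vs co.add co.scale HHH.tens_add_left HHH.tens_add_right
        HHH.tens_scale_left HHH.tens_scale_right)
  have b2: "bilinear_map scale scale scaleU (\<lambda>c d. tens3 (tens a c) d)" for a
    by (simp add: bilinear_map_iff vs HHH.tens_add_left HHH.tens_add_right
        HHH.tens_scale_left HHH.tens_scale_right HH.tens_add_right HH.tens_scale_right)
  have l2: "tensor_lift scaleT scaleU tens (\<lambda>c d. tens3 (tens a c) d) (comult b)
      = (\<Sum>(c, d)\<leftarrow>summands b. tens3 (tens a c) d)" for a b
    by (rule HH.tensor_lift_represents[OF HHH.VT.vector_space_axioms b2 comult_summands])
  interpret l: Vector_Spaces.linear scaleT scaleU "tensor_lift scaleT scaleU tens (\<lambda>c d. tens3 (tens a c) d)" for a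
    by (rule HH.linear_tensor_lift[OF HHH.VT.vector_space_axioms b2])
  have b3: "bilinear_map scale scale scaleU
      (\<lambda>a b. tensor_lift scaleT scaleU tens (\<lambda>c d. tens3 (tens a c) d) (comult b))"
    (is "bilinear_map _ _ _ ?f")
    unfolding bilinear_map_iff[OF vs(1) vs(1) vs(3)]
  proof (intro conjI allI)
    show "?f (x + y) b = ?f x b + ?f y b" for x y b
      unfolding l2 by (simp add: HH.tens_add_left HHH.tens_add_left sum_list_addf case_prod_unfold)
    show "?f (scale c x) b = scaleU c (?f x b)" for c x b
      unfolding l2
      by (simp add: HH.tens_scale_left HHH.tens_scale_left HHH.VT.scale_sum_list_right case_prod_unfold)
  qed (simp_all add: l.add l.scale co.add co.scale)
  have "(\<Sum>(a, b)\<leftarrow>summands x. tens3 (comult a) b)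
      = (\<Sum>(a, b)\<leftarrow>summands x. \<Sum>(c, d)\<leftarrow>summands b. tens3 (tens a c) d)"
    using coassoc[of x]
    unfolding HH.tensor_lift_represents[OF HHH.VT.vector_space_axioms b1 comult_summands]
      HH.tensor_lift_represents[OF HHH.VT.vector_space_axioms b3 comult_summands]
    by (simp only: l2)
  from arg_cong[OF this, of ?p] show ?thesis
    by (simp add: linear_sum_list[OF lin] p case_prod_unfold)
qed

lemma eval_left_right:
  assumes "linear_form scale f" "linear_form scale g"
  shows "g (eval_left f x) = f (eval_right g x)"
  unfolding eval_left_def eval_right_def by (rule HH.contract_left_right[OF assms])

text \<open>Both sides are f \<otimes> id \<otimes> g applied to the twofold coproduct.\<close>

lemma eval_left_eval_right:
  assumes f: "linear_form scale f" and g: "linear_form scale g"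
  shows "eval_left f (eval_right g x) = eval_right g (eval_left f x)"
proof -
  interpret c: Vector_Spaces.linear scaleT scale "HH.contract_left f" by (rule HH.linear_contract_left[OF f])
  interpret g: Vector_Spaces.linear scale "(*)" g by fact
  interpret d: Vector_Spaces.linear scale scale "eval_left f" by (rule linear_eval_left[OF f])
  interpret e: Vector_Spaces.linear scale scale "eval_right g" by (rule linear_eval_right[OF g])
  have "bilinear_map scaleT scale scale (\<lambda>T c. scale (g c) (HH.contract_left f T))"
    by (simp add: bilinear_map_iff H.vector_space_axioms HH.VT.vector_space_axioms c.add c.scale
        g.add g.scale H.scale_left_distrib H.scale_right_distrib mult.commute)
  from coassoc_sum[OF H.vector_space_axioms this, of x]
  have "(\<Sum>(a, b)\<leftarrow>summands x. scale (g b) (eval_left f a))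
      = (\<Sum>(a, b)\<leftarrow>summands x. scale (f a) (eval_right g b))"
    unfolding eval_left_def[symmetric] HH.contract_left_tens[OF f] eval_right_summands[OF g]
      H.scale_sum_list_right
    by (simp add: case_prod_unfold mult.commute)
  then show ?thesis
    unfolding eval_right_summands[OF g, of x] eval_left_summands[OF f, of x]
      linear_sum_list[OF d.linear_axioms] linear_sum_list[OF e.linear_axioms]
    by (simp add: case_prod_unfold d.scale e.scale)
qed

text \<open>Both sides are f \<otimes> h \<otimes> id applied to the twofold coproduct. The form on
  the right is the convolution product of \<open>f\<close> and \<open>h\<close>, so left evaluation
  makes \<open>H\<close> a module over the convolution algebra of forms.\<close>

lemma eval_left_eval_left:
  assumes f: "linear_form scale f" and h: "linear_form scale h"
  shows "eval_left h (eval_left f x) = eval_left (\<lambda>t. h (eval_left f t)) x"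
proof -
  interpret c: Vector_Spaces.linear scaleT scale "HH.contract_left f" by (rule HH.linear_contract_left[OF f])
  interpret h: Vector_Spaces.linear scale "(*)" h by fact
  interpret d: Vector_Spaces.linear scale scale "eval_left h" by (rule linear_eval_left[OF h])
  have "bilinear_map scaleT scale scale (\<lambda>T c. scale (h (HH.contract_left f T)) c)"
    by (simp add: bilinear_map_iff H.vector_space_axioms HH.VT.vector_space_axioms c.add c.scale
        h.add h.scale H.scale_left_distrib H.scale_right_distrib mult.commute)
  from coassoc_sum[OF H.vector_space_axioms this, of x]
  have "(\<Sum>(a, b)\<leftarrow>summands x. scale (h (eval_left f a)) b)
      = (\<Sum>(a, b)\<leftarrow>summands x. scale (f a) (eval_left h b))"
    unfolding eval_left_def[of f, symmetric] HH.contract_left_tens[OF f] eval_left_summands[OF h]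
      H.scale_sum_list_right
    by (simp add: case_prod_unfold h.scale)
  then show ?thesis
    unfolding eval_left_summands[OF form_eval_left[OF h f]] eval_left_summands[OF f, of x]
      linear_sum_list[OF d.linear_axioms]
    by (simp add: case_prod_unfold d.scale eval_left_summands[OF f])
qed

text \<open>Both sides are id \<otimes> g \<otimes> f applied to the twofold coproduct.\<close>

lemma eval_right_eval_right:
  assumes f: "linear_form scale f" and g: "linear_form scale g"
  shows "eval_right g (eval_right f x) = eval_right (\<lambda>t. f (eval_left g t)) x"
proof -
  interpret c: Vector_Spaces.linear scaleT scale "HH.contract_right g" by (rule HH.linear_contract_right[OF g])
  interpret f: Vector_Spaces.linear scale "(*)" f by fact
  interpret d: Vector_Spaces.linear scale scale "eval_right g" by (rule linear_eval_right[OF g])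
  have "bilinear_map scaleT scale scale (\<lambda>T c. scale (f c) (HH.contract_right g T))"
    by (simp add: bilinear_map_iff H.vector_space_axioms HH.VT.vector_space_axioms c.add c.scale
        f.add f.scale H.scale_left_distrib H.scale_right_distrib mult.commute)
  from coassoc_sum[OF H.vector_space_axioms this, of x]
  have "(\<Sum>(a, b)\<leftarrow>summands x. scale (f b) (eval_right g a))
      = (\<Sum>(a, b)\<leftarrow>summands x. scale (f (eval_left g b)) a)"
    unfolding eval_right_def[symmetric] HH.contract_right_tens[OF g] eval_left_summands[OF g]
      linear_sum_list[OF f.linear_axioms]
    by (simp add: case_prod_unfold f.scale H.scale_sum_list_left mult.commute)
  then show ?thesis
    unfolding eval_right_summands[OF form_eval_left[OF f g]] eval_right_summands[OF f, of x]
      linear_sum_list[OF d.linear_axioms]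
    by (simp add: case_prod_unfold d.scale)
qed

lemma eval_left_counit: "eval_left counit x = x"
  using counit_left by (simp add: eval_left_def HH.contract_left_def)

lemma eval_right_counit: "eval_right counit x = x"
  using counit_right by (simp add: eval_right_def HH.contract_right_def)

lemma counit_eval_left: "linear_form scale f \<Longrightarrow> counit (eval_left f x) = f x"
  using eval_left_right[OF _ counit_linear, of f x] by (simp add: eval_right_counit)

lemma counit_eval_right: "linear_form scale g \<Longrightarrow> counit (eval_right g x) = g x"
  using eval_left_right[OF counit_linear, of g x] by (simp add: eval_left_counit)

lemma eval_left_linear_form:
  assumes "linear_form scale f" "linear_form scale g"
  shows "eval_left (\<lambda>t. f t + g t) x = eval_left f x + eval_left g x"
    "eval_left (\<lambda>t. f t - g t) x = eval_left f x - eval_left g x"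
    "eval_left (\<lambda>t. c * f t) x = scale c (eval_left f x)"
proof -
  have "linear_form scale (\<lambda>t. f t + g t)" "linear_form scale (\<lambda>t. f t - g t)" "linear_form scale (\<lambda>t. c * f t)"
    using assms by (simp_all add: H.form_iff algebra_simps)
  then show "eval_left (\<lambda>t. f t + g t) x = eval_left f x + eval_left g x"
    "eval_left (\<lambda>t. f t - g t) x = eval_left f x - eval_left g x"
    "eval_left (\<lambda>t. c * f t) x = scale c (eval_left f x)"
    using assms
    by (simp_all add: eval_left_summands case_prod_unfold H.scale_left_distrib H.scale_left_diff_distrib
        sum_list_addf sum_list_subtractf H.scale_sum_list_right)
qed

end

section \<open>Connected Hopf algebras\<close>

context hopf_algebra
begin

lemma comult_times:
  "comult (x * y) = (\<Sum>(a, b)\<leftarrow>summands x. \<Sum>(c, d)\<leftarrow>summands y. tens (a * c) (b * d))"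
proof -
  note vs = vector_space_axioms HH.VT.vector_space_axioms
  interpret co: Vector_Spaces.linear scale scaleT comult by (rule comult_linear)
  have b2: "bilinear_map scale scale scaleT (\<lambda>c d. tens (a * c) (b * d))" for a b
    by (simp add: bilinear_map_iff vs distrib_left scale_mult_right HH.tens_add_left HH.tens_add_right
        HH.tens_scale_left HH.tens_scale_right)
  have l2: "tensor_lift scaleT scaleT tens (\<lambda>c d. tens (a * c) (b * d)) (comult y)
      = (\<Sum>(c, d)\<leftarrow>summands y. tens (a * c) (b * d))" for a b
    by (rule HH.tensor_lift_represents[OF HH.VT.vector_space_axioms b2 comult_summands])
  have b3: "bilinear_map scale scale scaleT
      (\<lambda>a b. tensor_lift scaleT scaleT tens (\<lambda>c d. tens (a * c) (b * d)) (comult y))"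
    unfolding bilinear_map_iff[OF vs(1) vs(1) vs(2)] l2
    by (simp add: distrib_right scale_mult_left HH.tens_add_left HH.tens_add_right
        HH.tens_scale_left HH.tens_scale_right sum_list_addf HH.VT.scale_sum_list_right case_prod_unfold)
  show ?thesis
    unfolding comult_mult HH.tensor_lift_represents[OF HH.VT.vector_space_axioms b3 comult_summands]
    by (simp only: l2)
qed

lemma eval_left_times:
  assumes "linear_form scale f"
  shows "eval_left f (x * y)
    = (\<Sum>(a, b)\<leftarrow>summands x. \<Sum>(c, d)\<leftarrow>summands y. scale (f (a * c)) (b * d))"
  unfolding eval_left_def comult_times
  by (simp add: linear_sum_list[OF HH.linear_contract_left[OF assms]] HH.contract_left_tens[OF assms]
      case_prod_unfold)

lemma eval_right_times:
  assumes "linear_form scale f"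
  shows "eval_right f (x * y)
    = (\<Sum>(a, b)\<leftarrow>summands x. \<Sum>(c, d)\<leftarrow>summands y. scale (f (b * d)) (a * c))"
  unfolding eval_right_def comult_times
  by (simp add: linear_sum_list[OF HH.linear_contract_right[OF assms]] HH.contract_right_tens[OF assms]
      case_prod_unfold)

lemma eval_left_one: "linear_form scale f \<Longrightarrow> eval_left f 1 = scale (f 1) 1"
  by (simp add: eval_left_def comult_one HH.contract_left_tens)

lemma eval_right_one: "linear_form scale f \<Longrightarrow> eval_right f 1 = scale (f 1) 1"
  by (simp add: eval_right_def comult_one HH.contract_right_tens)

end

context connected_hopf_algebra
begin

text \<open>Since 1 is group-like, the line through it is a subcoalgebra, and a line is simple. It
  therefore lies in the coradical, whose dimension leaves no room for more.\<close>

lemma coradical_eq: "coradical = span {1}"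
proof -
  have "subcoalgebra (span {1})"
    unfolding subcoalgebra_def
  proof (intro conjI subspace_span image_subsetI)
    interpret co: Vector_Spaces.linear scale scaleT comult by (rule comult_linear)
    fix x assume "x \<in> span {1 :: 'b}"
    then obtain c where "x = scale c 1" using mult_span_one by blast
    then have "comult x = scaleT c (tens 1 1)" by (simp add: co.scale comult_one)
    then show "comult x \<in> tensor_subspace (span {1}) (span {1})"
      unfolding tensor_subspace_def \<open>comult x = scaleT c (tens 1 1)\<close>
      using span_base[of 1 "{1}"] by (intro HH.VT.span_scale HH.VT.span_base) blast
  qed
  moreover have "D = {0} \<or> D = span {1}" if D: "subcoalgebra D" "D \<subseteq> span {1}" for D
  proof (cases "D \<subseteq> {0}")
    case True
    then show ?thesis using that subspace_0[of D] by (auto simp: subcoalgebra_def)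
  next
    case False
    then obtain x where x: "x \<in> D" "x \<noteq> 0" by blast
    then obtain c where c: "x = scale c 1" using D mult_span_one[of x] by blast
    then have "1 = scale (inverse c) x" using x by auto
    then have "1 \<in> D" using x D subspace_scale[of D x "inverse c"] by (simp add: subcoalgebra_def)
    then have "span {1} \<subseteq> D" using that by (intro span_minimal) (auto simp: subcoalgebra_def)
    then show ?thesis using that by blast
  qed
  moreover have "span {1 :: 'b} \<noteq> {0}" using span_base[of 1 "{1 :: 'b}"] by auto
  ultimately have "simple_subcoalgebra (span {1})" by (auto simp: simple_subcoalgebra_def)
  then have sub: "span {1} \<subseteq> coradical"
    unfolding coradical_def by (intro subset_trans[OF _ span_superset]) blast
  obtain B where B: "B \<subseteq> coradical" "independent B" "coradical \<subseteq> span B" "card B = dim coradical"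
    using basis_exists by blast
  then obtain v where "B = {v}" using coradical_one_dimensional by (auto simp: card_1_singleton_iff)
  then have "coradical \<subseteq> span {v}" using B by simp
  moreover have "1 \<in> coradical" using sub span_base by blast
  ultimately have "1 \<in> span {v}" by blast
  then obtain c where c: "1 = scale c v" by (auto simp: span_singleton)
  then have "c \<noteq> 0" by auto
  then have "scale (inverse c) (scale c v) = v" by simp
  then have "v = scale (inverse c) 1" using c by simp
  then have "v \<in> span {1}" by (metis span_base span_scale singletonI)
  then have "span {v} \<subseteq> span {1}" by (intro span_minimal) auto
  then show ?thesis using sub \<open>coradical \<subseteq> span {v}\<close> by blast
qed

text \<open>A form that kills 1 annihilates the part of the coproduct in
  \<open>coradical \<otimes> H\<close>, so its slice sees only the other part. Conversely, expand
  the coproduct in a basis containing 1: the term at 1 lies in \<open>coradical \<otimes> H\<close>,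
  and every other coordinate form kills 1. The subspace hypothesis comes from the induction in
  \<open>subspace_coradical_filtration\<close>, whose step uses this description.\<close>

lemma coradical_filtration_Suc:
  assumes "subspace (coradical_filtration n)"
  shows "coradical_filtration (Suc n) =
    {x. \<forall>f. linear_form scale f \<longrightarrow> f 1 = 0 \<longrightarrow> eval_left f x \<in> coradical_filtration n}"
proof (intro equalityI subsetI CollectI allI impI)
  fix x f assume x: "x \<in> coradical_filtration (Suc n)" and f: "linear_form scale f" "f 1 = 0"
  interpret c: Vector_Spaces.linear scaleT scale "HH.contract_left f" by (rule HH.linear_contract_left[OF f(1)])
  interpret f: Vector_Spaces.linear scale "(*)" f by (rule f(1))
  obtain s t where st: "s \<in> tensor_subspace UNIV (coradical_filtration n)"
    "t \<in> tensor_subspace coradical UNIV" "comult x = s + t"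
    using x by auto
  have "HH.contract_left f s \<in> coradical_filtration n"
    using st(1)[unfolded tensor_subspace_def] by (rule HH.contract_left_span[OF f(1) assms])
  moreover have "HH.contract_left f t = 0"
    using st(2) unfolding tensor_subspace_def
  proof (induction rule: HH.VT.span_induct_alt)
    case (step r T T')
    then obtain v w where "T = tens v w" "v \<in> span {1}" by (auto simp: coradical_eq)
    moreover then obtain d where "v = scale d 1" using mult_span_one by blast
    ultimately show ?case using step f(2) by (simp add: c.add c.scale f.scale HH.contract_left_tens[OF f(1)])
  qed (simp add: c.zero)
  ultimately show "eval_left f x \<in> coradical_filtration n"
    by (simp add: eval_left_def st c.add)
next
  fix x
  assume x: "x \<in> {x. \<forall>f. linear_form scale f \<longrightarrow> f 1 = 0 \<longrightarrow> eval_left f x \<in> coradical_filtration n}"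
  have ind: "independent {1 :: 'b}" by simp
  define B where "B = extend_basis {1 :: 'b}"
  have B: "1 \<in> B" "independent B" "span B = UNIV"
    unfolding B_def using extend_basis_superset[OF ind] independent_extend_basis[OF ind]
      span_extend_basis[OF ind] by blast+
  let ?r = "\<lambda>b x. representation B x b"
  have rf: "linear_form scale (?r b)" for b by (rule linear_form_representation[OF B(2,3)])
  obtain S where S: "finite S" "S \<subseteq> B" "comult x = (\<Sum>b\<in>S. tens b (HH.contract_left (?r b) (comult x)))"
    using HH.basis_expansion[OF B(2,3)] by blast
  let ?t = "\<lambda>b. tens b (HH.contract_left (?r b) (comult x))"
  have "comult x = (\<Sum>b\<in>S - {1}. ?t b) + (\<Sum>b\<in>S \<inter> {1}. ?t b)"
    using S(1) by (subst S(3), subst add.commute) (rule sum.Int_Diff)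
  moreover have "(\<Sum>b\<in>S - {1}. ?t b) \<in> tensor_subspace UNIV (coradical_filtration n)"
    unfolding tensor_subspace_def
  proof (rule HH.VT.span_sum, rule HH.VT.span_base)
    fix b assume "b \<in> S - {1}"
    then have "?r b 1 = 0" using representation_basis[OF B(2,1)] by auto
    then have "eval_left (?r b) x \<in> coradical_filtration n" using x rf by blast
    then show "?t b \<in> {tens v w |v w. v \<in> UNIV \<and> w \<in> coradical_filtration n}"
      by (auto simp: eval_left_def)
  qed
  moreover have "(\<Sum>b\<in>S \<inter> {1}. ?t b) \<in> tensor_subspace coradical UNIV"
    unfolding tensor_subspace_def coradical_eq
    by (rule HH.VT.span_sum, rule HH.VT.span_base) (auto intro: span_base)
  ultimately show "x \<in> coradical_filtration (Suc n)" by auto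
qed

lemma subspace_coradical_filtration: "subspace (coradical_filtration n)"
proof (induction n)
  case 0
  show ?case by (simp add: coradical_eq subspace_span)
next
  case (Suc n)
  show ?case
    unfolding coradical_filtration_Suc[OF Suc]
  proof (rule subspaceI; intro CollectI allI impI; (unfold mem_Collect_eq)?)
    fix f assume f: "linear_form scale f" "f 1 = 0"
    interpret e: Vector_Spaces.linear scale scale "eval_left f" by (rule linear_eval_left[OF f(1)])
    show "eval_left f 0 \<in> coradical_filtration n" by (simp add: e.zero subspace_0[OF Suc])
    show "eval_left f (x + y) \<in> coradical_filtration n"
      if "\<forall>f. linear_form scale f \<longrightarrow> f 1 = 0 \<longrightarrow> eval_left f x \<in> coradical_filtration n"
        "\<forall>f. linear_form scale f \<longrightarrow> f 1 = 0 \<longrightarrow> eval_left f y \<in> coradical_filtration n" for x y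
      using that f by (simp add: e.add subspace_add[OF Suc])
    show "eval_left f (scale c x) \<in> coradical_filtration n"
      if "\<forall>f. linear_form scale f \<longrightarrow> f 1 = 0 \<longrightarrow> eval_left f x \<in> coradical_filtration n" for c x
      using that f by (simp add: e.scale subspace_scale[OF Suc])
  qed
qed

lemma filtered_coproduct_left:
  "filtered_coproduct scale summands eval_left counit coradical_filtration"
proof (intro filtered_coproduct.intro filtered_coproduct_axioms.intro)
  show "coradical_filtration (Suc n) = {x. \<forall>f. linear_form scale f \<longrightarrow> f 1 = 0 \<longrightarrow>
      eval_left f x \<in> coradical_filtration n}" for n
    by (rule coradical_filtration_Suc[OF subspace_coradical_filtration])
  show "coradical_filtration 0 = span {1}" by (simp add: coradical_eq)
qed (fact k_algebra_axioms counit_linear counit_one eval_left_summands linear_eval_left eval_left_times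
    eval_left_counit counit_eval_left eval_left_one)+

sublocale left: filtered_coproduct scale summands eval_left counit coradical_filtration
  by (rule filtered_coproduct_left)

text \<open>In degree 1 the condition is that all scalars (f \<otimes> g) of the coproduct vanish
  for \<open>f\<close> and \<open>g\<close> killing 1, which is symmetric in the two sides. The
  induction step works because left and right evaluations commute.\<close>

lemma in_coradical_filtration_Suc_iff_right:
  "x \<in> coradical_filtration (Suc n) \<longleftrightarrow> (\<forall>g\<in>left.augmentation. eval_right g x \<in> coradical_filtration n)"
proof (induction n arbitrary: x)
  case 0
  have iff: "y \<in> coradical_filtration 0 \<longleftrightarrow> (\<forall>g\<in>left.augmentation. g y = 0)" for y
  proof
    assume "y \<in> coradical_filtration 0"
    then obtain c where "y = scale c 1" using mult_span_one by (auto simp: coradical_eq)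
    then show "\<forall>g\<in>left.augmentation. g y = 0"
      by (auto simp: left.augmentation_def form_iff)
  next
    assume g: "\<forall>g\<in>left.augmentation. g y = 0"
    show "y \<in> coradical_filtration 0"
    proof (rule ccontr)
      assume "y \<notin> coradical_filtration 0"
      then obtain f where "linear_form scale f" "\<And>v. v \<in> span {1} \<Longrightarrow> f v = 0" "f y = 1"
        using separating_linear_form[of "span {1}" y] by (auto simp: coradical_eq)
      then show False using g by (force simp: left.augmentation_def span_base)
    qed
  qed
  have "g (eval_left f x) = f (eval_right g x)" if "f \<in> left.augmentation" "g \<in> left.augmentation" for f g
    using that by (intro eval_left_right left.augmentation_linear)
  then show ?case
    unfolding left.in_C_Suc_iff iff by metis
next
  case (Suc n)
  have "eval_left f (eval_right g x) = eval_right g (eval_left f x)"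
    if "f \<in> left.augmentation" "g \<in> left.augmentation" for f g
    using that by (intro eval_left_eval_right left.augmentation_linear)
  moreover have "x \<in> coradical_filtration (Suc (Suc n)) \<longleftrightarrow>
      (\<forall>f\<in>left.augmentation. \<forall>g\<in>left.augmentation. eval_right g (eval_left f x) \<in> coradical_filtration n)"
    by (simp only: left.in_C_Suc_iff[of x] Suc)
  moreover have "(\<forall>g\<in>left.augmentation. eval_right g x \<in> coradical_filtration (Suc n)) \<longleftrightarrow>
      (\<forall>g\<in>left.augmentation. \<forall>f\<in>left.augmentation. eval_left f (eval_right g x) \<in> coradical_filtration n)"
    by (simp only: left.in_C_Suc_iff)
  ultimately show ?case by auto
qed

lemma filtered_coproduct_right:
  "filtered_coproduct scale (\<lambda>x. map prod.swap (summands x)) eval_right counit coradical_filtration"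
proof (intro filtered_coproduct.intro filtered_coproduct_axioms.intro)
  show "coradical_filtration (Suc n) = {x. \<forall>f. linear_form scale f \<longrightarrow> f 1 = 0 \<longrightarrow>
      eval_right f x \<in> coradical_filtration n}" for n
    using in_coradical_filtration_Suc_iff_right by (auto simp: left.augmentation_def simp del: coradical_filtration.simps(2))
  show "coradical_filtration 0 = span {1}" by (simp add: coradical_eq)
  show "eval_right f x = (\<Sum>(a, b)\<leftarrow>map prod.swap (summands x). scale (f a) b)"
    if "linear_form scale f" for f x
    unfolding eval_right_summands[OF that] by (simp add: o_def case_prod_unfold)
  show "eval_right f (x * y) = (\<Sum>(a, b)\<leftarrow>map prod.swap (summands x).
      \<Sum>(c, d)\<leftarrow>map prod.swap (summands y). scale (f (a * c)) (b * d))"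
    if "linear_form scale f" for f x y
    unfolding eval_right_times[OF that] by (simp add: o_def case_prod_unfold)
qed (fact k_algebra_axioms counit_linear counit_one linear_eval_right eval_right_counit counit_eval_right
    eval_right_one)+

sublocale right: filtered_coproduct scale "\<lambda>x. map prod.swap (summands x)" eval_right counit coradical_filtration
  by (rule filtered_coproduct_right)

end

section \<open>Exhaustiveness of the coradical filtration\<close>

context connected_hopf_algebra
begin

lemma augmentation_zero: "(\<lambda>t. 0) \<in> left.augmentation"
  by (simp add: left.augmentation_def form_iff)

lemma augmentation_add: "f \<in> left.augmentation \<Longrightarrow> g \<in> left.augmentation \<Longrightarrow> (\<lambda>t. f t + g t) \<in> left.augmentation"
  and augmentation_diff: "f \<in> left.augmentation \<Longrightarrow> g \<in> left.augmentation \<Longrightarrow> (\<lambda>t. f t - g t) \<in> left.augmentation"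
  and augmentation_cmult: "f \<in> left.augmentation \<Longrightarrow> (\<lambda>t. c * f t) \<in> left.augmentation"
  by (simp_all add: left.augmentation_def form_add form_diff form_cmult)

lemma form_eval_left_augmentation:
  assumes "f \<in> left.augmentation" "linear_form scale h"
  shows "(\<lambda>t. h (eval_left f t)) \<in> left.augmentation"
proof -
  interpret h: Vector_Spaces.linear scale "(*)" h by fact
  show ?thesis
    using assms form_eval_left[OF assms(2) left.augmentation_linear[OF assms(1)]]
    by (simp add: left.augmentation_def eval_left_one h.scale)
qed

text \<open>Split \<open>h\<close> into \<open>h 1\<close> times the counit, which acts as a scalar,
  and a form that kills 1, which lowers the degree.\<close>

lemma eval_left_filtration:
  assumes h: "linear_form scale h" and x: "x \<in> coradical_filtration n"
  shows "eval_left h x \<in> coradical_filtration n"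
proof -
  define f where "f = (\<lambda>t. h t - h 1 * counit t)"
  have c: "linear_form scale (\<lambda>t. h 1 * counit t)" by (rule form_cmult[OF counit_linear])
  have f: "f \<in> left.augmentation"
    unfolding left.augmentation_def f_def using form_diff[OF h c] by (simp add: counit_one)
  have fx: "eval_left f x = eval_left h x - scale (h 1) x"
    unfolding f_def eval_left_linear_form(2)[OF h c] eval_left_linear_form(3)[OF counit_linear counit_linear]
    by (simp only: eval_left_counit)
  have "eval_left f x \<in> coradical_filtration n"
    using left.act_lower[OF f x] left.previous_C_subset by blast
  then have "eval_left f x + scale (h 1) x \<in> coradical_filtration n"
    using x by (intro subspace_add[OF subspace_coradical_filtration] subspace_scale[OF subspace_coradical_filtration])
  then show ?thesis by (simp add: fx)
qed

text \<open>A nonzero subcoalgebra of least dimension inside \<open>U\<close> is simple, so it lies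
  in the coradical, which is the line through 1.\<close>

lemma one_in_subcoalgebra:
  assumes U: "subcoalgebra U" "U \<noteq> {0}" "U \<subseteq> span W" "finite W"
  shows "1 \<in> U"
proof -
  define P where "P D \<longleftrightarrow> subcoalgebra D \<and> D \<subseteq> U \<and> D \<noteq> {0}" for D
  obtain D where D: "P D" "\<And>E. P E \<Longrightarrow> dim D \<le> dim E"
    using ex_has_least_nat[of P U dim] U by (auto simp: P_def)
  have "simple_subcoalgebra D"
    unfolding simple_subcoalgebra_def
  proof (intro conjI allI impI)
    fix E assume E: "subcoalgebra E \<and> E \<subseteq> D"
    show "E = {0} \<or> E = D"
    proof (rule disjCI)
      assume "E \<noteq> D"
      show "E = {0}"
      proof (rule ccontr)
        assume "E \<noteq> {0}"
        then have "P E" using E D by (auto simp: P_def)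
        then have "dim D \<le> dim E" by (rule D)
        then have "E = D"
          using E D U by (intro subspace_eq_if_dim_le[of E D W]) (auto simp: P_def subcoalgebra_def)
        then show False using \<open>E \<noteq> D\<close> by simp
      qed
    qed
  qed (use D in \<open>auto simp: P_def\<close>)
  then have "D \<subseteq> span {1}"
    using span_superset[of "\<Union> (Collect simple_subcoalgebra)"] coradical_eq
    unfolding coradical_def by blast
  moreover have sD: "subspace D" using D by (simp add: P_def subcoalgebra_def)
  then obtain x where x: "x \<in> D" "x \<noteq> 0" using D subspace_0[of D] by (auto simp: P_def)
  ultimately obtain c where c: "x = scale c 1" using mult_span_one by blast
  then have "scale (inverse c) x = 1" using x by auto
  then have "1 \<in> D" using subspace_scale[OF sD x(1), of "inverse c"] by simp
  then show ?thesis using D by (auto simp: P_def)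
qed

text \<open>
  The dual algebra of a finite-dimensional subcomodule acts on it, and the augmentation ideal
  consists of the forms vanishing at \<open>1\<close>.  If some element were outside the filtration, a
  minimal submodule \<open>M'\<close> not contained in it would be a module on which the augmentation ideal
  acts transitively modulo \<open>N\<close>; repeating \<open>1 - f' = (1 - a)(1 - f)\<close> over a basis gives an element
  of the ideal acting as the identity of \<open>M'/N\<close>.  This contradicts the fact that the coefficient
  coalgebra \<open>U\<close> of \<open>M'/N\<close> contains \<open>1\<close>.
\<close>

theorem coradical_filtration_exhaustive: "\<exists>n. x \<in> coradical_filtration n"
proof (rule ccontr)
  define Cinf where "Cinf = (\<Union>n. coradical_filtration n)"
  define aug where "aug = left.augmentation"
  assume "\<nexists>n. x \<in> coradical_filtration n"
  then have x: "x \<notin> Cinf" by (auto simp: Cinf_def simp del: coradical_filtration.simps)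
  note subC = subspace_coradical_filtration
  have directed: "\<exists>n. S \<subseteq> coradical_filtration n" if "finite S" "S \<subseteq> Cinf" for S
    using that
  proof (induction S)
    case (insert s S)
    then obtain m n where "s \<in> coradical_filtration m" "S \<subseteq> coradical_filtration n"
      by (auto simp: Cinf_def simp del: coradical_filtration.simps)
    then have "insert s S \<subseteq> coradical_filtration (max m n)"
      using left.C_mono[of m "max m n"] left.C_mono[of n "max m n"] by auto
    then show ?case by blast
  qed simp
  have subCinf: "subspace Cinf"
  proof (rule subspaceI)
    show "0 \<in> Cinf" using subspace_0[OF subC] by (auto simp: Cinf_def)
    show "y + z \<in> Cinf" if "y \<in> Cinf" "z \<in> Cinf" for y z
      using directed[of "{y, z}"] that subspace_add[OF subC] by (auto simp: Cinf_def)
    show "scale c y \<in> Cinf" if "y \<in> Cinf" for c y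
      using that subspace_scale[OF subC] by (auto simp: Cinf_def)
  qed
  have Cinf_stable: "eval_left h y \<in> Cinf" if "linear_form scale h" "y \<in> Cinf" for h y
    using eval_left_filtration[OF that(1)] that(2) by (auto simp: Cinf_def)
  define stable where "stable M \<longleftrightarrow> (\<forall>h. linear_form scale h \<longrightarrow> eval_left h ` M \<subseteq> M)" for M
  \<comment> \<open>The subcomodule generated by \<open>x\<close>. It contains \<open>x\<close> as
    its evaluation at the counit and is finite-dimensional, being spanned by right factors of one
    presentation of the coproduct of \<open>x\<close>.\<close>
  define M where "M = {eval_left f x | f. linear_form scale f}"
  define W where "W = snd ` set (summands x)"
  have finW: "finite W" by (simp add: W_def)
  have aug_form: "linear_form scale f" if "f \<in> aug" for f
    using that by (simp add: aug_def left.augmentation_def)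
  have zero_form: "linear_form scale (\<lambda>t. 0)" by (simp add: form_iff)
  have eval_zero: "eval_left (\<lambda>t. 0) y = 0" for y
    using eval_left_linear_form(3)[OF counit_linear counit_linear, of 0] by simp
  have M: "subspace M" "stable M" "M \<subseteq> span W" "x \<in> M"
  proof -
    show "subspace M"
    proof (rule subspaceI)
      show "0 \<in> M" unfolding M_def using zero_form eval_zero by (intro CollectI exI[of _ "\<lambda>t. 0"]) simp
      show "y + z \<in> M" if yz: "y \<in> M" "z \<in> M" for y z
      proof -
        obtain f g where "linear_form scale f" "linear_form scale g" "y = eval_left f x" "z = eval_left g x"
          using yz by (auto simp: M_def)
        then show ?thesis
          unfolding M_def using eval_left_linear_form(1)[of f g x, symmetric]
          by (intro CollectI exI[of _ "\<lambda>t. f t + g t"]) (simp add: form_add)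
      qed
      show "scale c y \<in> M" if y: "y \<in> M" for c y
      proof -
        obtain f where "linear_form scale f" "y = eval_left f x" using y by (auto simp: M_def)
        then show ?thesis
          unfolding M_def using eval_left_linear_form(3)[of f f c x, symmetric]
          by (intro CollectI exI[of _ "\<lambda>t. c * f t"]) (simp add: form_cmult)
      qed
    qed
    show "stable M"
      unfolding stable_def M_def using eval_left_eval_left form_eval_left by blast
    show "M \<subseteq> span W"
      unfolding M_def W_def
      by (auto simp: eval_left_summands intro!: subspace_sum_list[OF subspace_span] span_scale)
        (force intro: span_base)
    show "x \<in> M" unfolding M_def using eval_left_counit counit_linear by (metis (mono_tags, lifting) mem_Collect_eq)
  qed
  define N where "N = M \<inter> Cinf"
  have N: "subspace N" "stable N" "N \<subseteq> span W"
    using M subCinf Cinf_stable by (auto simp: N_def subspace_inter stable_def)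
  define P where "P T \<longleftrightarrow> subspace T \<and> stable T \<and> N \<subseteq> T \<and> T \<subseteq> M \<and> \<not> T \<subseteq> N" for T
  have "P M" using M x by (auto simp: P_def N_def)
  then obtain M' where M': "P M'" "\<And>T. P T \<Longrightarrow> dim M' \<le> dim T"
    using ex_has_least_nat[of P M dim] by blast
  have M'_props: "subspace M'" "stable M'" "N \<subseteq> M'" "M' \<subseteq> M" "\<not> M' \<subseteq> N"
    using M'(1) by (auto simp: P_def)
  have M'_min: "T = M'" if "P T" "T \<subseteq> M'" for T
    using that M' M by (intro subspace_eq_if_dim_le[of T M' W]) (auto simp: P_def finW)
  \<comment> \<open>Otherwise all forms killing 1 send \<open>s\<close> into \<open>N\<close>. As
    \<open>N\<close> is finite-dimensional, it lies in a single filtration step, so \<open>s\<close>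
    lies in the next one and hence in \<open>N\<close>.\<close>
  have act_out: "\<exists>f\<in>aug. eval_left f s \<notin> N" if s: "s \<in> M'" "s \<notin> N" for s
  proof (rule ccontr)
    assume "\<not> ?thesis"
    then have into: "eval_left f s \<in> N" if "f \<in> aug" for f using that by blast
    obtain B where B: "finite B" "B \<subseteq> N" "span B = N"
      using ex_finite_basis_of_subspace[OF N(3) finW N(1)] by blast
    then obtain n where "B \<subseteq> coradical_filtration n"
      using directed[of B] by (auto simp: N_def)
    then have "N \<subseteq> coradical_filtration n" using B span_minimal[OF _ subC] by blast
    then have "s \<in> coradical_filtration (Suc n)"
      using into unfolding left.in_C_Suc_iff aug_def by blast
    then show False using s M'_props unfolding N_def Cinf_def by blast
  qed
  have transitive: "\<exists>f\<in>aug. s - eval_left f s \<in> N" if s: "s \<in> M'" for s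
  proof (cases "s \<in> N")
    case True
    then show ?thesis
      using augmentation_zero by (intro bexI[of _ "\<lambda>t. 0"]) (simp_all add: aug_def eval_zero)
  next
    case False
    \<comment> \<open>The submodule generated by \<open>N\<close> and the images of \<open>s\<close>
      under forms killing 1. It is not inside \<open>N\<close> by \<open>act_out\<close>, so
      minimality gives \<open>Q = M'\<close>, and \<open>s\<close> itself is such an image modulo
      \<open>N\<close>.\<close>
    define Q where "Q = {eval_left f s + v | f v. f \<in> aug \<and> v \<in> N}"
    have "P Q"
      unfolding P_def
    proof (intro conjI)
      show "subspace Q"
      proof (rule subspaceI)
        have "0 = eval_left (\<lambda>t. 0) s + 0" by (simp add: eval_zero)
        then show "0 \<in> Q" unfolding Q_def aug_def using subspace_0[OF N(1)] augmentation_zero by blast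
        show "y + z \<in> Q" if yz: "y \<in> Q" "z \<in> Q" for y z
        proof -
          obtain f g v w where fg: "f \<in> aug" "g \<in> aug" "v \<in> N" "w \<in> N"
            "y = eval_left f s + v" "z = eval_left g s + w" using yz by (auto simp: Q_def)
          have "(\<lambda>t. f t + g t) \<in> aug" using fg by (simp add: aug_def augmentation_add)
          moreover have "y + z = eval_left (\<lambda>t. f t + g t) s + (v + w)"
            using fg aug_form by (simp add: eval_left_linear_form(1))
          ultimately show ?thesis using fg subspace_add[OF N(1)] unfolding Q_def by blast
        qed
        show "scale c y \<in> Q" if y: "y \<in> Q" for c y
        proof -
          obtain f v where fv: "f \<in> aug" "v \<in> N" "y = eval_left f s + v" using y by (auto simp: Q_def)
          have "(\<lambda>t. c * f t) \<in> aug" using fv by (simp add: aug_def augmentation_cmult)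
          moreover have "scale c y = eval_left (\<lambda>t. c * f t) s + scale c v"
            using fv aug_form by (simp add: eval_left_linear_form(3)[of f f] scale_right_distrib)
          ultimately show ?thesis using fv subspace_scale[OF N(1)] unfolding Q_def by blast
        qed
      qed
      show "stable Q"
        unfolding stable_def
      proof (intro allI impI image_subsetI)
        fix h y assume h: "linear_form scale h" and "y \<in> Q"
        then obtain f v where fv: "f \<in> aug" "v \<in> N" "y = eval_left f s + v" by (auto simp: Q_def)
        interpret h: Vector_Spaces.linear scale scale "eval_left h" by (rule linear_eval_left[OF h])
        have "eval_left h y = eval_left (\<lambda>t. h (eval_left f t)) s + eval_left h v"
          using fv aug_form h by (simp add: h.add eval_left_eval_left)
        moreover have "(\<lambda>t. h (eval_left f t)) \<in> aug"
          using form_eval_left_augmentation fv h by (simp add: aug_def)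
        moreover have "eval_left h v \<in> N" using N(2) h fv by (auto simp: stable_def)
        ultimately show "eval_left h y \<in> Q" unfolding Q_def by blast
      qed
      show "N \<subseteq> Q"
      proof
        fix v assume "v \<in> N"
        moreover have "(\<lambda>t. 0) \<in> aug" using augmentation_zero by (simp add: aug_def)
        moreover have "v = eval_left (\<lambda>t. 0) s + v" by (simp add: eval_zero)
        ultimately show "v \<in> Q" unfolding Q_def by blast
      qed
      have "Q \<subseteq> M'"
        unfolding Q_def using M'_props s aug_form
        by (auto simp: stable_def intro!: subspace_add[OF M'_props(1)])
      then show "Q \<subseteq> M" using M'_props by blast
      obtain f where "f \<in> aug" "eval_left f s \<notin> N" using act_out s False by blast
      moreover then have "eval_left f s + 0 \<in> Q" unfolding Q_def using subspace_0[OF N(1)] by blast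
      ultimately show "\<not> Q \<subseteq> N" by auto
    qed
    moreover have "Q \<subseteq> M'"
      unfolding Q_def using M'_props s aug_form
      by (auto simp: stable_def intro!: subspace_add[OF M'_props(1)])
    ultimately have "Q = M'" by (rule M'_min)
    then obtain f v where "f \<in> aug" "v \<in> N" "s = eval_left f s + v" using s by (auto simp: Q_def)
    moreover from this have "s - eval_left f s = v" by (metis add_diff_cancel_left')
    ultimately show ?thesis by (intro bexI[of _ f]) simp_all
  qed
  have common: "\<exists>f\<in>aug. \<forall>s\<in>S. s - eval_left f s \<in> N" if "finite S" "S \<subseteq> M'" for S
    using that
  proof (induction S)
    case empty
    then show ?case using augmentation_zero by (auto simp: aug_def)
  next
    case (insert t S)
    then obtain f where f: "f \<in> aug" "\<And>s. s \<in> S \<Longrightarrow> s - eval_left f s \<in> N" by auto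
    have "t - eval_left f t \<in> M'"
      by (rule subspace_diff[OF M'_props(1)])
        (use insert.prems M'_props(2) aug_form[OF f(1)] in \<open>auto simp: stable_def\<close>)
    then obtain a where a: "a \<in> aug" "(t - eval_left f t) - eval_left a (t - eval_left f t) \<in> N"
      using transitive by blast
    interpret a: Vector_Spaces.linear scale scale "eval_left a" by (rule linear_eval_left[OF aug_form[OF a(1)]])
    \<comment> \<open>In the convolution algebra, 1 - g is the composite of 1 - f followed by 1 - a.
      It sends \<open>S\<close> into \<open>N\<close> because 1 - f does and \<open>N\<close> is
      stable, and it sends \<open>t\<close> there by the choice of \<open>a\<close>.\<close>
    define g where "g = (\<lambda>t. (f t + a t) - a (eval_left f t))"
    have af: "(\<lambda>t. a (eval_left f t)) \<in> aug"
      using form_eval_left_augmentation f a aug_form by (simp add: aug_def)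
    have fa: "(\<lambda>t. f t + a t) \<in> aug" using f a by (simp add: aug_def augmentation_add)
    have "g \<in> aug" unfolding g_def using af fa by (simp add: aug_def augmentation_diff)
    moreover have "s - eval_left g s = (s - eval_left f s) - eval_left a (s - eval_left f s)" for s
      unfolding g_def eval_left_linear_form(2)[OF aug_form[OF fa] aug_form[OF af]]
        eval_left_linear_form(1)[OF aug_form[OF f(1)] aug_form[OF a(1)]] a.diff
        eval_left_eval_left[OF aug_form[OF f(1)] aug_form[OF a(1)]]
      by simp
    moreover have "(s - eval_left f s) - eval_left a (s - eval_left f s) \<in> N" if "s \<in> S" for s
      by (rule subspace_diff[OF N(1) f(2)[OF that]])
        (use f(2)[OF that] N(2) aug_form[OF a(1)] in \<open>auto simp: stable_def\<close>)
    ultimately show ?case using a by (metis insertE)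
  qed
  obtain W' where W': "finite W'" "W' \<subseteq> M'" "span W' = M'"
    using ex_finite_basis_of_subspace[of M' W] M'_props M finW by blast
  obtain f where f: "f \<in> aug" "\<And>s. s \<in> W' \<Longrightarrow> s - eval_left f s \<in> N"
    using common[OF W'(1,2)] by blast
  interpret ef: Vector_Spaces.linear scale scale "eval_left f" by (rule linear_eval_left[OF aug_form[OF f(1)]])
  have f_id: "s - eval_left f s \<in> N" if "s \<in> M'" for s
  proof -
    have "s \<in> span W'" using that W' by simp
    then show ?thesis
    proof (induction rule: span_induct_alt)
      case base
      show ?case by (simp add: ef.zero subspace_0[OF N(1)])
    next
      case (step c y z)
      have "scale c y + z - eval_left f (scale c y + z) = scale c (y - eval_left f y) + (z - eval_left f z)"
        by (simp add: ef.add ef.scale scale_right_diff_distrib)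
      moreover have "\<dots> \<in> N"
        using step f(2) by (intro subspace_add[OF N(1)] subspace_scale[OF N(1)])
      ultimately show ?case by (simp only:)
    qed
  qed
  define \<Phi> where "\<Phi> = {\<phi>. linear_form scale \<phi> \<and> (\<forall>v\<in>N. \<phi> v = 0)}"
  \<comment> \<open>The matrix coefficients of the comodule \<open>M'\<close> modulo
    \<open>N\<close>: slices of coproducts of elements of \<open>M'\<close> by forms that vanish on
    \<open>N\<close>.\<close>
  define U0 where "U0 = {eval_right \<phi> s | \<phi> s. \<phi> \<in> \<Phi> \<and> s \<in> M'}"
  define U where "U = span U0"
  have U0_left: "eval_left g u \<in> U0" if g: "linear_form scale g" and u: "u \<in> U0" for g u
  proof -
    obtain \<phi> s where "\<phi> \<in> \<Phi>" "s \<in> M'" "u = eval_right \<phi> s" using u by (auto simp: U0_def)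
    then have "eval_left g u = eval_right \<phi> (eval_left g s)" "eval_left g s \<in> M'"
      using g M'_props(2) eval_left_eval_right by (auto simp: \<Phi>_def stable_def image_subset_iff)
    then show ?thesis using \<open>\<phi> \<in> \<Phi>\<close> by (auto simp: U0_def)
  qed
  have U0_right: "eval_right g u \<in> U0" if g: "linear_form scale g" and u: "u \<in> U0" for g u
  proof -
    obtain \<phi> s where \<phi>: "\<phi> \<in> \<Phi>" "s \<in> M'" "u = eval_right \<phi> s" using u by (auto simp: U0_def)
    then have "eval_right g u = eval_right (\<lambda>t. \<phi> (eval_left g t)) s"
      using g eval_right_eval_right by (auto simp: \<Phi>_def)
    moreover have "(\<lambda>t. \<phi> (eval_left g t)) \<in> \<Phi>"
      using \<phi> g form_eval_left N(2) by (auto simp: \<Phi>_def stable_def image_subset_iff)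
    ultimately show ?thesis using \<phi> by (auto simp: U0_def)
  qed
  have sT: "HH.VT.subspace (tensor_subspace U U)" by (simp add: tensor_subspace_def HH.VT.subspace_span)
  have "subcoalgebra U"
    unfolding subcoalgebra_def
  proof (intro conjI image_subsetI)
    show "subspace U" by (simp add: U_def)
    interpret co: Vector_Spaces.linear scale scaleT comult by (rule comult_linear)
    \<comment> \<open>Stability under evaluation on both sides puts the coproduct into
      \<open>U \<otimes> U\<close>.\<close>
    have U0_comult: "comult u \<in> tensor_subspace U U" if "u \<in> U0" for u
      unfolding tensor_subspace_def
      by (rule HH.tensor_subspace_memI)
        (use U0_left[OF _ that] U0_right[OF _ that] in
          \<open>auto simp: U_def eval_left_def eval_right_def intro: span_base\<close>)
    fix u assume "u \<in> U"
    then have "u \<in> span U0" by (simp add: U_def)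
    then show "comult u \<in> tensor_subspace U U"
    proof (induction rule: span_induct_alt)
      case base
      show ?case by (simp add: co.zero HH.VT.subspace_0[OF sT])
    next
      case (step c y z)
      then show ?case
        by (simp add: co.add co.scale HH.VT.subspace_add[OF sT] HH.VT.subspace_scale[OF sT] U0_comult)
    qed
  qed
  moreover have "U \<noteq> {0}"
  proof -
    obtain s where s: "s \<in> M'" "s \<notin> N" using M'_props by blast
    obtain \<phi> where \<phi>: "linear_form scale \<phi>" "\<And>v. v \<in> N \<Longrightarrow> \<phi> v = 0" "\<phi> s = 1"
      using separating_linear_form[OF N(1) s(2)] by blast
    interpret e: Vector_Spaces.linear scale "(*)" counit by (rule counit_linear)
    have "counit (eval_right \<phi> s) = 1" using \<phi> by (simp add: counit_eval_right)
    then have "eval_right \<phi> s \<noteq> 0" using e.zero by auto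
    moreover have "eval_right \<phi> s \<in> U" unfolding U_def U0_def using \<phi> s by (intro span_base) (auto simp: \<Phi>_def)
    ultimately show ?thesis by blast
  qed
  moreover have "U \<subseteq> span (\<Union>w\<in>W'. fst ` set (summands w))" (is "_ \<subseteq> span ?V")
    unfolding U_def
  proof (rule span_minimal[OF _ subspace_span], rule subsetI)
    fix u assume "u \<in> U0"
    then obtain \<phi> s where \<phi>: "linear_form scale \<phi>" "s \<in> span W'" "u = eval_right \<phi> s"
      using W' by (auto simp: U0_def \<Phi>_def)
    interpret er: Vector_Spaces.linear scale scale "eval_right \<phi>" by (rule linear_eval_right[OF \<phi>(1)])
    have w: "eval_right \<phi> w \<in> span ?V" if "w \<in> W'" for w
      unfolding eval_right_summands[OF \<phi>(1)]
      by (rule subspace_sum_list[OF subspace_span]) (use that in \<open>force intro: span_scale span_base\<close>)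
    show "u \<in> span ?V"
      unfolding \<phi>(3) using \<phi>(2)
      by (induction rule: span_induct_alt) (auto simp: er.zero er.add er.scale span_zero intro!: span_add span_scale w)
  qed
  moreover have "finite (\<Union>w\<in>W'. fst ` set (summands w))" using W' by blast
  ultimately have "1 \<in> U" by (rule one_in_subcoalgebra)
  \<comment> \<open>On a matrix coefficient, \<open>f\<close> takes the value of a form on
    \<open>eval_left f s\<close>, which agrees with \<open>s\<close> modulo \<open>N\<close>; the
    counit gives the value on \<open>s\<close>. At the element 1 of \<open>U\<close> this equality
    reads 0 = 1.\<close>
  moreover have "f u = counit u" if "u \<in> U" for u
  proof -
    interpret f: Vector_Spaces.linear scale "(*)" f by (rule aug_form[OF f(1)])
    interpret e: Vector_Spaces.linear scale "(*)" counit by (rule counit_linear)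
    have gen: "f u = counit u" if "u \<in> U0" for u
    proof -
      obtain \<phi> s where \<phi>: "\<phi> \<in> \<Phi>" "s \<in> M'" "u = eval_right \<phi> s" using \<open>u \<in> U0\<close> by (auto simp: U0_def)
      then have lf: "linear_form scale \<phi>" by (simp add: \<Phi>_def)
      interpret p: Vector_Spaces.linear scale "(*)" \<phi> by (rule lf)
      have "f u = \<phi> (eval_left f s)" using \<phi> eval_left_right[OF aug_form[OF f(1)] lf] by simp
      also have "\<dots> = \<phi> s - \<phi> (s - eval_left f s)" by (simp add: p.diff)
      also have "\<dots> = counit u" using \<phi> f_id counit_eval_right[OF lf] by (simp add: \<Phi>_def)
      finally show ?thesis .
    qed
    have "u \<in> span U0" using that by (simp add: U_def)
    then show ?thesis
      by (induction rule: span_induct_alt) (auto simp: f.zero e.zero f.add e.add f.scale e.scale gen)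
  qed
  ultimately have "f 1 = counit 1" by blast
  then show False using f(1) by (simp add: aug_def left.augmentation_def counit_one)
qed

end

section \<open>Polynomials\<close>

lemma poly_mapping_sum_single: "p = (\<Sum>m\<in>keys p. single m (lookup p m))"
proof (rule poly_mapping_eqI)
  fix k
  have "(\<Sum>m\<in>keys p. lookup (single m (lookup p m)) k)
      = (\<Sum>m\<in>keys p. if m = k then lookup p k else 0)"
    by (intro sum.cong) (auto simp: lookup_single when_def)
  also have "\<dots> = lookup p k" by (simp add: in_keys_iff)
  finally show "lookup p k = lookup
      (\<Sum>m\<in>keys p. single m (lookup p m)) k"
    by (simp add: lookup_sum)
qed

text \<open>The monomials added are restricted to those of the fixed \<open>p0\<close>, so that
  bounds on its support remain available in the step.\<close>

lemma poly_mapping_single_induct: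
  fixes p0 :: "'a \<Rightarrow>\<^sub>0 'b::comm_monoid_add"
  assumes "P 0" "\<And>m c p. m \<in> keys p0 \<Longrightarrow> P p \<Longrightarrow> P (single m c + p)"
  shows "P p0"
proof -
  have "P (\<Sum>m\<in>X. single m (lookup p0 m))"
    if "finite X" "X \<subseteq> keys p0" for X
    using that by (induction X) (simp_all add: assms)
  then show ?thesis using poly_mapping_sum_single[of p0] by (metis finite_keys order_refl)
qed

lemma free_scale_single [simp]: "free_scale c (single m d) = single m (c * d)"
  by (rule poly_mapping_eqI) (simp add: lookup_free_scale lookup_single when_def)

lemma free_scale_mult_left: "free_scale c p * q = free_scale c (p * (q :: ('i \<Rightarrow>\<^sub>0 nat) \<Rightarrow>\<^sub>0 'k::field))"
  unfolding free_scale_def mult_map_scale_conv_mult by (simp add: mult.assoc)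

interpretation poly: k_algebra "free_scale :: 'k::field \<Rightarrow> (('i \<Rightarrow>\<^sub>0 nat) \<Rightarrow>\<^sub>0 'k) \<Rightarrow> _"
proof -
  interpret vector_space "free_scale :: 'k::field \<Rightarrow> (('i \<Rightarrow>\<^sub>0 nat) \<Rightarrow>\<^sub>0 'k) \<Rightarrow> _"
    by (rule vector_space_free_scale)
  show "k_algebra (free_scale :: 'k::field \<Rightarrow> (('i \<Rightarrow>\<^sub>0 nat) \<Rightarrow>\<^sub>0 'k) \<Rightarrow> _)"
    by unfold_locales (metis free_scale_mult_left mult.commute)+
qed

section \<open>Weights and homogeneous polynomials\<close>

definition weight :: "('i \<Rightarrow> nat) \<Rightarrow> ('i \<Rightarrow>\<^sub>0 nat) \<Rightarrow> nat" where
  "weight w m = (\<Sum>i\<in>keys m. lookup m i * w i)"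

lemma weight_superset:
  "finite X \<Longrightarrow> keys m \<subseteq> X \<Longrightarrow> weight w m = (\<Sum>i\<in>X. lookup m i * w i)"
  unfolding weight_def by (rule sum.mono_neutral_left) (auto simp: in_keys_iff)

lemma weight_zero [simp]: "weight w 0 = 0"
  by (simp add: weight_def)

lemma keys_add_nat: "keys (a + b :: 'i \<Rightarrow>\<^sub>0 nat) = keys a \<union> keys b"
  by (auto simp: in_keys_iff lookup_add)

lemma weight_add [simp]: "weight w (a + b) = weight w a + weight w b"
proof -
  let ?X = "keys a \<union> keys b"
  show ?thesis
    by (simp add: weight_superset[of ?X] keys_add_nat lookup_add sum.distrib distrib_right)
qed

lemma weight_single [simp]: "weight w (single i n) = n * w i"
  by (simp add: weight_superset[of "{i}"])

lemma weight_ge: "i \<in> keys m \<Longrightarrow> w i \<le> weight w m"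
proof -
  assume i: "i \<in> keys m"
  have "w i \<le> lookup m i * w i" using i by (simp add: in_keys_iff)
  also have "\<dots> \<le> weight w m" unfolding weight_def using i by (intro member_le_sum) auto
  finally show ?thesis .
qed

lemma homogeneous_polynomials_iff:
  "p \<in> homogeneous_polynomials I w n \<longleftrightarrow>
    (\<forall>m\<in>keys p. keys m \<subseteq> I \<and> weight w m = n)"
  by (auto simp: homogeneous_polynomials_def polynomial_algebra_def weight_def)

lemma homogeneous_zero [simp]: "0 \<in> homogeneous_polynomials I w n"
  by (simp add: homogeneous_polynomials_iff)

lemma homogeneous_single:
  "keys m \<subseteq> I \<Longrightarrow> weight w m = n \<Longrightarrow> single m c \<in> homogeneous_polynomials I w n"
  by (simp add: homogeneous_polynomials_iff)

lemma homogeneous_add: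
  "p \<in> homogeneous_polynomials I w n \<Longrightarrow> q \<in> homogeneous_polynomials I w n \<Longrightarrow>
    p + q \<in> homogeneous_polynomials I w n"
  unfolding homogeneous_polynomials_iff using keys_add[of p q] by (meson UnE subsetD)

lemma homogeneous_sum:
  "(\<And>x. x \<in> X \<Longrightarrow> f x \<in> homogeneous_polynomials I w n) \<Longrightarrow> sum f X \<in> homogeneous_polynomials I w n"
  by (induction X rule: infinite_finite_induct) (auto intro: homogeneous_add)

lemma homogeneous_scale:
  "p \<in> homogeneous_polynomials I w n \<Longrightarrow> free_scale c p \<in> homogeneous_polynomials I w n"
  by (auto simp: homogeneous_polynomials_iff in_keys_iff lookup_free_scale)

lemma homogeneous_mult:
  assumes "p \<in> homogeneous_polynomials I w m" "q \<in> homogeneous_polynomials I w n"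
  shows "p * q \<in> homogeneous_polynomials I w (m + n)"
  unfolding homogeneous_polynomials_iff
proof
  fix k assume "k \<in> keys (p * q)"
  then obtain a b where "k = a + b" "a \<in> keys p" "b \<in> keys q"
    using keys_mult by blast
  then show "keys k \<subseteq> I \<and> weight w k = m + n"
    using assms by (auto simp: homogeneous_polynomials_iff keys_add_nat)
qed

lemma homogeneous_induct [consumes 1, case_names zero add]:
  assumes "p \<in> homogeneous_polynomials I w n" "P 0"
    and "\<And>m c p. keys m \<subseteq> I \<Longrightarrow> weight w m = n \<Longrightarrow> P p \<Longrightarrow> P (single m c + p)"
  shows "P p"
  by (rule poly_mapping_single_induct) (use assms in \<open>auto simp: homogeneous_polynomials_iff\<close>)

text \<open>The subtraction of exponents is truncated only where \<open>lookup m i = 0\<close>, and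
  there the coefficient is 0 as well.\<close>

definition pdiff :: "'i \<Rightarrow> (('i \<Rightarrow>\<^sub>0 nat) \<Rightarrow>\<^sub>0 'k::field) \<Rightarrow> (('i \<Rightarrow>\<^sub>0 nat) \<Rightarrow>\<^sub>0 'k)" where
  "pdiff i = linear_extension free_scale
     (\<lambda>m. single (m - single i 1) (of_nat (lookup m i)))"

interpretation pdiff: Vector_Spaces.linear free_scale free_scale "pdiff i"
  unfolding pdiff_def by (rule linear_linear_extension) (rule vector_space_free_scale)

lemma pdiff_single:
  "pdiff i (single m c)
    = single (m - single i 1) (c * of_nat (lookup m i))"
  unfolding pdiff_def linear_extension_single[OF vector_space_free_scale] by simp

lemma pdiff_one [simp]: "pdiff i 1 = 0"
  using pdiff_single[of i 0 1] by simp

lemma monomial_diff_eq_iff: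
  fixes m k :: "'i \<Rightarrow>\<^sub>0 nat"
  assumes "lookup m i \<noteq> 0"
  shows "m - single i 1 = k \<longleftrightarrow> m = k + single i 1"
proof
  assume "m - single i 1 = k"
  then show "m = k + single i 1"
    using assms by (auto intro!: poly_mapping_eqI simp: lookup_add lookup_minus lookup_single when_def)
qed simp

text \<open>The truncated subtraction disappears in this coefficient formula, from which commutation
  and the kernel of \<open>pdiff\<close> can be read off.\<close>

lemma lookup_pdiff:
  fixes p :: "('i \<Rightarrow>\<^sub>0 nat) \<Rightarrow>\<^sub>0 'k::field"
  shows "lookup (pdiff i p) k
    = of_nat (Suc (lookup k i)) * lookup p (k + single i 1)"
proof (rule poly_mapping_single_induct[of _ p])
  fix m :: "'i \<Rightarrow>\<^sub>0 nat" and c :: 'k and p :: "('i \<Rightarrow>\<^sub>0 nat) \<Rightarrow>\<^sub>0 'k"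
  assume "lookup (pdiff i p) k
    = of_nat (Suc (lookup k i)) * lookup p (k + single i 1)"
  moreover have "lookup (pdiff i (single m c)) k
    = of_nat (Suc (lookup k i)) * lookup (single m c) (k + single i 1)"
  proof (cases "lookup m i = 0")
    case True
    then have "m \<noteq> k + single i 1" by (auto simp: lookup_add)
    then show ?thesis using True by (simp add: pdiff_single lookup_single when_def)
  next
    case False
    then show ?thesis
      using monomial_diff_eq_iff[OF False, of k]
      by (auto simp: pdiff_single lookup_single when_def lookup_add)
  qed
  ultimately show "lookup (pdiff i (single m c + p)) k
    = of_nat (Suc (lookup k i)) * lookup (single m c + p) (k + single i 1)"
    by (simp add: pdiff.add lookup_add algebra_simps)
qed (simp add: pdiff.zero)

lemma pdiff_commute: "pdiff i (pdiff j p) = pdiff j (pdiff i p)"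
proof (rule poly_mapping_eqI)
  fix k
  show "lookup (pdiff i (pdiff j p)) k = lookup (pdiff j (pdiff i p)) k"
    by (cases "i = j") (simp_all add: lookup_pdiff lookup_add lookup_single add_ac)
qed

lemma pdiff_mult:
  fixes p :: "('i \<Rightarrow>\<^sub>0 nat) \<Rightarrow>\<^sub>0 'k::field"
  shows "pdiff i (p * q) = pdiff i p * q + p * pdiff i q"
proof -
  have single: "pdiff i (single a c * single b d)
    = pdiff i (single a c) * single b d
      + single a c * pdiff i (single b d)"
    for a b :: "'i \<Rightarrow>\<^sub>0 nat" and c d :: 'k
  proof -
    have "lookup a i \<noteq> 0 \<Longrightarrow> a - single i 1 + b = a + b - single i 1"
      "lookup b i \<noteq> 0 \<Longrightarrow> a + (b - single i 1) = a + b - single i 1"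
      by (auto intro!: poly_mapping_eqI simp: lookup_add lookup_minus lookup_single when_def)
    then show ?thesis
      by (cases "lookup a i = 0"; cases "lookup b i = 0")
        (simp_all add: mult_single pdiff_single lookup_add algebra_simps flip: single_add)
  qed
  have right: "pdiff i (single a c * q)
    = pdiff i (single a c) * q + single a c * pdiff i q" for a c
    by (rule poly_mapping_single_induct[of _ q])
      (simp_all add: pdiff.zero pdiff.add distrib_left single algebra_simps)
  show ?thesis
    by (rule poly_mapping_single_induct[of _ p])
      (simp_all add: pdiff.zero pdiff.add distrib_right right add_ac)
qed

text \<open>The second fact covers the case in which the natural number \<open>n - w j\<close> is
  not the true difference.\<close>

lemma pdiff_homogeneous:
  assumes p: "p \<in> homogeneous_polynomials I w n"
  shows "pdiff j p \<in> homogeneous_polynomials I w (n - w j)"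
    and "n < w j \<Longrightarrow> pdiff j p = 0"
proof -
  have *: "keys m \<subseteq> I \<and> weight w m + w j = n" if "m \<in> keys (pdiff j p)" for m
  proof -
    have "m + single j 1 \<in> keys p"
      using that by (auto simp: in_keys_iff lookup_pdiff)
    then have "keys (m + single j 1) \<subseteq> I \<and> weight w (m + single j 1) = n"
      using p unfolding homogeneous_polynomials_iff by blast
    then show ?thesis by (simp add: keys_add_nat)
  qed
  then show "pdiff j p \<in> homogeneous_polynomials I w (n - w j)"
    by (fastforce simp: homogeneous_polynomials_iff)
  show "pdiff j p = 0" if "n < w j"
  proof (rule ccontr)
    assume "pdiff j p \<noteq> 0"
    then obtain m where "m \<in> keys (pdiff j p)" by (meson all_not_in_conv keys_eq_empty)
    then show False using * that by fastforce
  qed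
qed

text \<open>Characteristic 0 enters here: the factor \<open>Suc (lookup k i)\<close> in the
  coefficient formula must be nonzero in the field.\<close>

lemma pdiff_eq_0_iff:
  fixes p :: "('i \<Rightarrow>\<^sub>0 nat) \<Rightarrow>\<^sub>0 'k::field_char_0"
  shows "pdiff j p = 0 \<longleftrightarrow> (\<forall>m\<in>keys p. j \<notin> keys m)"
proof
  assume 0: "pdiff j p = 0"
  show "\<forall>m\<in>keys p. j \<notin> keys m"
  proof (intro ballI notI)
    fix m assume m: "m \<in> keys p" "j \<in> keys m"
    define k where "k = m - single j 1"
    have "m = k + single j 1"
      using m(2) monomial_diff_eq_iff[of m j k] by (simp add: k_def in_keys_iff)
    then have "lookup (pdiff j p) k \<noteq> 0"
      using m(1) by (simp add: lookup_pdiff in_keys_iff del: of_nat_Suc)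
    then show False using 0 by simp
  qed
next
  assume "\<forall>m\<in>keys p. j \<notin> keys m"
  then have "k + single j 1 \<notin> keys p" for k
    by (auto simp: in_keys_iff[of j] lookup_add)
  then show "pdiff j p = 0"
    by (intro poly_mapping_eqI) (simp add: lookup_pdiff in_keys_iff)
qed

section \<open>Filtrations with lowering derivations\<close>

text \<open>What is left of a coideal subalgebra once its coproduct is forgotten.
  \<open>D_lower\<close> makes each \<open>D\<close> an operator of degree -1 on the graded algebra,
  and \<open>D_detect\<close> says that no nonzero class of positive degree is killed by all of
  them.\<close>

locale derivation_filtration = k_algebra scale
  for scale :: "'k::field_char_0 \<Rightarrow> 'h::ring_1 \<Rightarrow> 'h" +
  fixes F :: "nat \<Rightarrow> 'h set" and \<D> :: "('h \<Rightarrow> 'h) set"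
  assumes subspace_F: "subspace (F n)"
    and F_Suc: "F n \<subseteq> F (Suc n)"
    and F_0: "F 0 = span {1}"
    and F_mult: "x \<in> F m \<Longrightarrow> y \<in> F n \<Longrightarrow> x * y \<in> F (m + n)"
    and F_commutator: "x \<in> F m \<Longrightarrow> y \<in> F n \<Longrightarrow> x * y - y * x \<in> previous F (m + n)"
    and D_linear: "D \<in> \<D> \<Longrightarrow> Vector_Spaces.linear scale scale D"
    and D_lower: "D \<in> \<D> \<Longrightarrow> x \<in> F n \<Longrightarrow> D x \<in> previous F n"
    and D_detect: "x \<in> F (Suc n) \<Longrightarrow> (\<And>D. D \<in> \<D> \<Longrightarrow> D x \<in> previous F n) \<Longrightarrow> x \<in> F n"
    and D_leibniz: "D \<in> \<D> \<Longrightarrow> x \<in> F m \<Longrightarrow> y \<in> F n \<Longrightarrow>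
      D (x * y) - (D x * y + x * D y) \<in> previous F (m + n - 1)"
begin

lemma subspace_previous: "subspace (previous F n)"
  by (cases n) (simp_all add: subspace_F subspace_single_0)

lemma F_mono: "m \<le> n \<Longrightarrow> F m \<subseteq> F n"
  by (rule lift_Suc_mono_le[of F]) (rule F_Suc)

lemma previous_subset: "previous F n \<subseteq> F n"
  by (cases n) (use subspace_0[OF subspace_F] F_Suc in auto)

lemma F_subset_previous: "m < n \<Longrightarrow> F m \<subseteq> previous F n"
  by (cases n) (use F_mono in auto)

lemma zero_in_F [simp]: "0 \<in> F n" and zero_in_previous [simp]: "0 \<in> previous F n"
  by (rule subspace_0[OF subspace_F] subspace_0[OF subspace_previous])+

lemma previous_mult_left: "x \<in> previous F m \<Longrightarrow> y \<in> F n \<Longrightarrow> x * y \<in> previous F (m + n)"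
  by (cases m) (auto simp: F_mult)

lemma previous_mult_right: "x \<in> F m \<Longrightarrow> y \<in> previous F n \<Longrightarrow> x * y \<in> previous F (m + n)"
  by (cases n) (auto simp: F_mult)

lemma D_previous: "D \<in> \<D> \<Longrightarrow> x \<in> previous F n \<Longrightarrow> D x \<in> previous F (n - 1)"
proof (cases n)
  case 0
  assume D: "D \<in> \<D>" "x \<in> previous F n"
  interpret D: Vector_Spaces.linear scale scale D by (rule D_linear[OF D(1)])
  show ?thesis using D 0 by (simp add: D.zero)
qed (auto simp: D_lower)

text \<open>Equality of classes in degree \<open>n\<close> of the graded algebra, expressed on
  representatives so that calculations stay inside the algebra.\<close>

definition eqv :: "nat \<Rightarrow> 'h \<Rightarrow> 'h \<Rightarrow> bool" where
  "eqv n x y \<longleftrightarrow> x - y \<in> previous F n"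

lemma eqv_refl [simp]: "eqv n x x"
  by (simp add: eqv_def)

lemma eqv_sym: "eqv n x y \<Longrightarrow> eqv n y x"
  using subspace_neg[OF subspace_previous] by (force simp: eqv_def)

lemma eqv_trans [trans]: "eqv n x y \<Longrightarrow> eqv n y z \<Longrightarrow> eqv n x z"
  using subspace_add[OF subspace_previous, of "x - y" n "y - z"] by (simp add: eqv_def)

lemma eqv_add: "eqv n x x' \<Longrightarrow> eqv n y y' \<Longrightarrow> eqv n (x + y) (x' + y')"
  using subspace_add[OF subspace_previous, of "x - x'" n "y - y'"] by (simp add: eqv_def algebra_simps)

lemma eqv_scale: "eqv n x x' \<Longrightarrow> eqv n (scale c x) (scale c x')"
  using subspace_scale[OF subspace_previous, of "x - x'" n c]
  by (simp add: eqv_def scale_right_diff_distrib)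

lemma eqv_sum: "(\<And>i. i \<in> S \<Longrightarrow> eqv n (f i) (g i)) \<Longrightarrow> eqv n (sum f S) (sum g S)"
  by (induction S rule: infinite_finite_induct) (auto intro: eqv_add)

lemma eqv_0_iff: "eqv n x 0 \<longleftrightarrow> x \<in> previous F n"
  by (simp add: eqv_def)

lemma eqv_mem: "eqv n x y \<Longrightarrow> y \<in> previous F n \<Longrightarrow> x \<in> previous F n"
  using eqv_trans eqv_0_iff by blast

lemma eqv_mem_F: "eqv n x y \<Longrightarrow> y \<in> F n \<Longrightarrow> x \<in> F n"
  using subspace_add[OF subspace_F, of "x - y" n y] previous_subset by (auto simp: eqv_def)

lemma eqv_mult_right: "eqv m x x' \<Longrightarrow> y \<in> F n \<Longrightarrow> eqv (m + n) (x * y) (x' * y)"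
  using previous_mult_left[of "x - x'" m y n] by (simp add: eqv_def left_diff_distrib)

lemma eqv_mult_left: "x \<in> F m \<Longrightarrow> eqv n y y' \<Longrightarrow> eqv (m + n) (x * y) (x * y')"
  using previous_mult_right[of x m "y - y'" n] by (simp add: eqv_def right_diff_distrib)

lemma eqv_mult: "eqv m x x' \<Longrightarrow> eqv n y y' \<Longrightarrow> x' \<in> F m \<Longrightarrow> y \<in> F n \<Longrightarrow> eqv (m + n) (x * y) (x' * y')"
  by (rule eqv_trans[OF eqv_mult_right eqv_mult_left])

lemma eqv_commute: "x \<in> F m \<Longrightarrow> y \<in> F n \<Longrightarrow> eqv (m + n) (x * y) (y * x)"
  using F_commutator by (simp add: eqv_def)

lemma eqv_D: "D \<in> \<D> \<Longrightarrow> eqv n x y \<Longrightarrow> eqv (n - 1) (D x) (D y)"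
proof -
  assume D: "D \<in> \<D>" "eqv n x y"
  interpret D: Vector_Spaces.linear scale scale D by (rule D_linear[OF D(1)])
  show ?thesis using D_previous[OF D(1), of "x - y" n] D(2) by (simp add: eqv_def D.diff)
qed

text \<open>Modulo \<open>previous F n\<close> their span is the degree \<open>n\<close> part of the
  square of the ideal of positive degree elements. A complement to it in each degree is a minimal
  set of generators.\<close>

definition decomposables :: "nat \<Rightarrow> 'h set" where
  "decomposables n = {a * b |a b i j. i + j = n \<and> 0 < i \<and> 0 < j \<and> a \<in> F i \<and> b \<in> F j}"

end

text \<open>The generators of weight \<open>n\<close> form a basis of \<open>F n\<close> modulo
  decomposables and lower terms: \<open>gen_span\<close> makes the family generate and
  \<open>gen_independent\<close> makes it minimal.\<close>

locale graded_generators = derivation_filtration scale F \<D>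
  for scale :: "'k::field_char_0 \<Rightarrow> 'h::ring_1 \<Rightarrow> 'h" and F :: "nat \<Rightarrow> 'h set" and \<D> :: "('h \<Rightarrow> 'h) set" +
  fixes I :: "'i set" and w :: "'i \<Rightarrow> nat" and gen :: "'i \<Rightarrow> 'h"
  assumes w_pos: "i \<in> I \<Longrightarrow> 0 < w i"
    and gen_F: "i \<in> I \<Longrightarrow> gen i \<in> F (w i)"
    and gen_span: "0 < n \<Longrightarrow> F n \<subseteq> span (gen ` {i \<in> I. w i = n} \<union> decomposables n \<union> previous F n)"
    and gen_independent: "finite S \<Longrightarrow> S \<subseteq> {i \<in> I. w i = n} \<Longrightarrow>
      (\<Sum>i\<in>S. scale (c i) (gen i)) \<in> span (decomposables n \<union> previous F n) \<Longrightarrow> i \<in> S \<Longrightarrow> c i = 0"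
begin

abbreviation P :: "nat \<Rightarrow> (('i \<Rightarrow>\<^sub>0 nat) \<Rightarrow>\<^sub>0 'k) set" where
  "P \<equiv> homogeneous_polynomials I w"

text \<open>The order of the factors chosen here does not matter modulo lower filtration steps.\<close>

definition var_list :: "('i \<Rightarrow>\<^sub>0 nat) \<Rightarrow> 'i list" where
  "var_list m = (SOME l. \<forall>i. count_list l i = lookup m i)"

definition mon :: "('i \<Rightarrow>\<^sub>0 nat) \<Rightarrow> 'h" where
  "mon m = prod_list (map gen (var_list m))"

lemma ex_var_list: "\<exists>l. \<forall>i. count_list l i = lookup (m :: 'i \<Rightarrow>\<^sub>0 nat) i"
proof (rule poly_mapping_single_induct[where P = "\<lambda>m. \<exists>l. \<forall>i. count_list l i = lookup m i"])
  show "\<exists>l. \<forall>i. count_list l i = lookup (0 :: 'i \<Rightarrow>\<^sub>0 nat) i" by (rule exI[of _ "[]"]) simp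
  fix j :: 'i and c and p :: "'i \<Rightarrow>\<^sub>0 nat"
  assume "\<exists>l. \<forall>i. count_list l i = lookup p i"
  then obtain l where l: "\<And>i. count_list l i = lookup p i" by blast
  have "count_list (replicate c j) i = (if i = j then c else 0)" for i by (induction c) auto
  then show "\<exists>l. \<forall>i. count_list l i = lookup (single j c + p) i"
    using l by (intro exI[of _ "replicate c j @ l"]) (simp add: lookup_add lookup_single when_def)
qed

lemma count_var_list: "count_list (var_list m) i = lookup m i"
  unfolding var_list_def by (rule someI_ex[OF ex_var_list, THEN spec])

lemma set_var_list: "set (var_list m) = keys m"
proof -
  have "i \<in> set (var_list m) \<longleftrightarrow> i \<in> keys m" for i
    using count_list_0_iff[of "var_list m" i] by (simp add: count_var_list in_keys_iff)
  then show ?thesis by blast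
qed

lemma sum_var_list: "(\<Sum>i\<leftarrow>var_list m. single i (1::nat)) = m"
proof (rule poly_mapping_eqI)
  fix k :: 'i
  have "lookup (\<Sum>i\<leftarrow>l. single i (1::nat)) k = count_list l k" for l
    by (induction l) (auto simp: lookup_add lookup_single when_def)
  then show "lookup (\<Sum>i\<leftarrow>var_list m. single i (1::nat)) k = lookup m k"
    by (simp add: count_var_list)
qed

lemma weight_var_list: "sum_list (map v (var_list m)) = weight v m"
  unfolding sum_list_map_eq_sum_count weight_def set_var_list count_var_list ..

lemma prod_gen_F: "set l \<subseteq> I \<Longrightarrow> prod_list (map gen l) \<in> F (sum_list (map w l))"
proof (induction l)
  case Nil
  show ?case by (simp add: F_0 span_base)
qed (auto intro: F_mult gen_F)

text \<open>Bring the first letter of \<open>l\<close> into its place in \<open>l'\<close> by moving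
  it past the block \<open>u\<close>; the commutator that this costs lies in a lower step.\<close>

lemma prod_gen_perm:
  "set l \<subseteq> I \<Longrightarrow> mset l = mset l' \<Longrightarrow>
    eqv (sum_list (map w l)) (prod_list (map gen l)) (prod_list (map gen l'))"
proof (induction l arbitrary: l')
  case (Cons i t)
  then have "i \<in> set l'" by (metis list.set_intros(1) set_mset_mset)
  then obtain u v where l': "l' = u @ i # v" by (meson split_list)
  have mset: "mset t = mset (u @ v)" using Cons.prems l' by simp
  have sub: "set u \<subseteq> I" "set v \<subseteq> I" "set t \<subseteq> I" "i \<in> I"
    using Cons.prems l' mset_eq_setD[OF mset] by auto
  have wt: "sum_list (map w t) = sum_list (map w u) + sum_list (map w v)"
    using mset by (metis map_append mset_map sum_list.append sum_mset_sum_list)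
  let ?p = "\<lambda>l. prod_list (map gen l)"
  have "eqv (w i + sum_list (map w t)) (gen i * ?p t) (gen i * ?p (u @ v))"
    by (rule eqv_mult_left[OF gen_F[OF sub(4)] Cons.IH[OF sub(3) mset]])
  also have "gen i * ?p (u @ v) = gen i * ?p u * ?p v" by (simp add: mult.assoc)
  also have "eqv (w i + sum_list (map w t)) (gen i * ?p u * ?p v) (?p u * gen i * ?p v)"
    using eqv_mult_right[OF eqv_commute[OF gen_F[OF sub(4)] prod_gen_F[OF sub(1)]] prod_gen_F[OF sub(2)]]
    by (simp add: wt add.assoc)
  also have "?p u * gen i * ?p v = ?p l'" by (simp add: l' mult.assoc)
  finally show ?case by simp
qed simp

lemma mon_F: "keys m \<subseteq> I \<Longrightarrow> mon m \<in> F (weight w m)"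
  unfolding mon_def weight_var_list[symmetric] by (rule prod_gen_F) (simp add: set_var_list)

lemma mon_eqv_prod:
  assumes "set l \<subseteq> I" "\<And>i. count_list l i = lookup m i"
  shows "eqv (weight w m) (prod_list (map gen l)) (mon m)"
proof -
  have mset: "mset l = mset (var_list m)"
    by (rule multiset_eqI) (simp add: count_mset assms count_var_list)
  then have "sum_list (map w l) = weight w m"
    unfolding weight_var_list[symmetric] by (metis mset_map sum_mset_sum_list)
  then show ?thesis using prod_gen_perm[OF assms(1) mset] by (simp add: mon_def)
qed

lemma mon_add:
  assumes "keys a \<subseteq> I" "keys b \<subseteq> I"
  shows "eqv (weight w (a + b)) (mon a * mon b) (mon (a + b))"
  using mon_eqv_prod[of "var_list a @ var_list b" "a + b"] assms
  by (simp add: set_var_list count_var_list lookup_add mon_def)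

lemma mon_0 [simp]: "mon 0 = 1"
  using set_var_list[of 0] by (simp add: mon_def)

lemma mon_single [simp]: "mon (single i 1) = gen i"
proof -
  have c: "count_list (var_list (single i 1)) j = (if j = i then 1 else 0)" for j
    by (simp add: count_var_list lookup_single when_def)
  have "mset (var_list (single i 1)) = {#i#}"
    by (rule multiset_eqI) (use c in \<open>simp add: count_mset\<close>)
  then have "var_list (single i 1) = [i]" by simp
  then show ?thesis by (simp add: mon_def)
qed

text \<open>Evaluation at the generators, with the chosen order of factors in every monomial. It is
  linear, but multiplicative only up to lower terms.\<close>

definition ev :: "(('i \<Rightarrow>\<^sub>0 nat) \<Rightarrow>\<^sub>0 'k) \<Rightarrow> 'h" where
  "ev = linear_extension scale mon"

sublocale ev: Vector_Spaces.linear free_scale scale ev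
  unfolding ev_def by (rule linear_linear_extension) (rule vector_space_axioms)

lemma ev_single: "ev (single m c) = scale c (mon m)"
  unfolding ev_def by (rule linear_extension_single) (rule vector_space_axioms)

lemma ev_one [simp]: "ev 1 = 1"
  using ev_single[of 0 1] by simp

lemma ev_F: "p \<in> P n \<Longrightarrow> ev p \<in> F n"
proof (induction rule: homogeneous_induct)
  case (add m c p)
  then show ?case
    using mon_F[of m] by (auto simp: ev.add ev_single intro: subspace_add[OF subspace_F] subspace_scale[OF subspace_F])
qed (simp add: ev.zero)

lemma ev_mult:
  assumes p: "p \<in> P a" and q: "q \<in> P b"
  shows "eqv (a + b) (ev p * ev q) (ev (p * q))"
  using p
proof (induction rule: homogeneous_induct)
  case (add m c p)
  have "eqv (a + b) (scale c (mon m) * ev q) (ev (single m c * q))"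
    using q
  proof (induction rule: homogeneous_induct)
    case (add k d q)
    have "eqv (a + b) (scale (c * d) (mon m * mon k)) (scale (c * d) (mon (m + k)))"
      using mon_add[of m k] add \<open>weight w m = a\<close> \<open>keys m \<subseteq> I\<close> by (intro eqv_scale) simp
    then show ?case
      using eqv_add[OF _ add(3), of "scale (c * d) (mon m * mon k)"]
      by (simp add: distrib_left ev.add ev_single mult_single scale_mult_left scale_mult_right
            mult.commute[of d c])
  qed (simp add: ev.zero)
  then show ?case using eqv_add[OF _ add(3)] by (simp add: distrib_right ev.add ev_single)
qed (simp add: ev.zero)

text \<open>The elements that agree with some \<open>ev p\<close> form a subspace containing
  generators and lower terms; products of elements of smaller degree belong to it by the induction
  hypothesis and \<open>ev_mult\<close>. By \<open>gen_span\<close> this is all of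
  \<open>F n\<close>.\<close>

lemma ev_surj: "y \<in> F n \<Longrightarrow> \<exists>p\<in>P n. eqv n y (ev p)"
proof (induction n arbitrary: y rule: less_induct)
  case (less n)
  show ?case
  proof (cases "n = 0")
    case True
    then obtain c where c: "y = scale c 1" using less.prems mult_span_one by (auto simp: F_0)
    then show ?thesis
      using True by (intro bexI[of _ "single 0 c"]) (simp_all add: ev_single homogeneous_single)
  next
    case False
    define T where "T = {y. \<exists>p\<in>P n. eqv n y (ev p)}"
    have T: "subspace T"
    proof (rule subspaceI)
      show "0 \<in> T" unfolding T_def by (intro CollectI bexI[of _ 0]) (simp_all add: ev.zero)
      show "x + y \<in> T" if xy: "x \<in> T" "y \<in> T" for x y
      proof -
        obtain p q where "p \<in> P n" "q \<in> P n" "eqv n x (ev p)" "eqv n y (ev q)" using xy by (auto simp: T_def)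
        then show ?thesis unfolding T_def
          by (intro CollectI bexI[of _ "p + q"]) (simp_all add: ev.add eqv_add homogeneous_add)
      qed
      show "scale c x \<in> T" if x: "x \<in> T" for c x
      proof -
        obtain p where "p \<in> P n" "eqv n x (ev p)" using x by (auto simp: T_def)
        then show ?thesis unfolding T_def
          by (intro CollectI bexI[of _ "free_scale c p"]) (simp_all add: ev.scale eqv_scale homogeneous_scale)
      qed
    qed
    have "gen i \<in> T" if "i \<in> I" "w i = n" for i
      unfolding T_def using that
      by (intro CollectI bexI[of _ "single (single i 1) 1"])
        (simp_all add: ev_single homogeneous_single del: One_nat_def)
    moreover have "y \<in> T" if "y \<in> decomposables n" for y
    proof -
      obtain a b i j where ab: "y = a * b" "i + j = n" "0 < i" "0 < j" "a \<in> F i" "b \<in> F j"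
        using \<open>y \<in> decomposables n\<close> by (auto simp: decomposables_def)
      then obtain p q where pq: "p \<in> P i" "q \<in> P j" "eqv i a (ev p)" "eqv j b (ev q)"
        using less.IH[of i a] less.IH[of j b] by auto
      have "eqv (i + j) (a * b) (ev p * ev q)" using pq ab ev_F by (intro eqv_mult)
      also have "eqv (i + j) (ev p * ev q) (ev (p * q))" by (rule ev_mult[OF pq(1,2)])
      finally show ?thesis unfolding T_def using ab pq homogeneous_mult by blast
    qed
    moreover have "y \<in> T" if "y \<in> previous F n" for y
      unfolding T_def using that by (intro CollectI bexI[of _ 0]) (simp_all add: ev.zero eqv_0_iff)
    ultimately have "span (gen ` {i \<in> I. w i = n} \<union> decomposables n \<union> previous F n) \<subseteq> T"
      by (intro span_minimal T) auto
    then show ?thesis using gen_span[of n] less.prems False by (auto simp: T_def)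
  qed
qed

text \<open>Chain rule for one monomial, obtained from the Leibniz rule letter by letter along a
  word. The set \<open>J\<close> may be larger than the set of letters, so that one index set serves
  all monomials of a polynomial in \<open>D_ev\<close>.\<close>

lemma D_mon:
  assumes D: "D \<in> \<D>" and J: "finite J"
  shows "set l \<subseteq> I \<Longrightarrow> set l \<subseteq> J \<Longrightarrow>
    eqv (sum_list (map w l) - 1) (D (ev (single (\<Sum>i\<leftarrow>l. single i 1) 1)))
      (\<Sum>j\<in>J. ev (pdiff j (single (\<Sum>i\<leftarrow>l. single i 1) 1)) * D (gen j))"
proof (induction l)
  case Nil
  interpret D: Vector_Spaces.linear scale scale D by (rule D_linear[OF D])
  have "D 1 \<in> previous F 0" by (rule D_lower[OF D]) (simp add: F_0 span_base)
  then show ?case by (simp add: pdiff_one ev.zero D.zero)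
next
  case (Cons i l)
  interpret D: Vector_Spaces.linear scale scale D by (rule D_linear[OF D])
  define n where "n = sum_list (map w l)"
  define m where "m = (\<Sum>i\<leftarrow>l. single i (1::nat))"
  define T where "T = single m (1::'k)"
  define X where "X = single (single i (1::nat)) (1::'k)"
  have iI: "i \<in> I" "i \<in> J" using Cons.prems by auto
  have m: "keys m \<subseteq> I" "weight w m = n"
    unfolding m_def n_def using Cons.prems by (induction l) (auto simp: keys_add_nat)
  have T: "T \<in> P n" unfolding T_def by (rule homogeneous_single[OF m])
  have X: "X \<in> P (w i)" unfolding X_def by (rule homogeneous_single) (use iI in auto)
  have XT: "single (\<Sum>i\<leftarrow>i # l. single i (1::nat)) (1::'k) = X * T"
    by (simp add: X_def T_def m_def mult_single)
  have evX: "ev X = gen i" by (simp add: X_def ev_single del: One_nat_def)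
  have wi: "0 < w i" using w_pos iI by blast
  have "eqv (w i + n - 1) (D (ev (X * T))) (D (ev X * ev T))"
    by (rule eqv_D[OF D eqv_sym[OF ev_mult[OF X T]]])
  also have "eqv (w i + n - 1) (D (ev X * ev T)) (D (ev X) * ev T + ev X * D (ev T))"
    using D_leibniz[OF D ev_F[OF X] ev_F[OF T]] by (simp add: eqv_def)
  also have "eqv (w i + n - 1) (D (ev X) * ev T + ev X * D (ev T))
      (ev T * D (gen i) + (\<Sum>j\<in>J. ev (X * pdiff j T) * D (gen j)))"
  proof (rule eqv_add)
    have "D (ev X) \<in> F (w i - 1)" using D_lower[OF D ev_F[OF X]] wi by (cases "w i") auto
    from eqv_commute[OF this ev_F[OF T]] show "eqv (w i + n - 1) (D (ev X) * ev T) (ev T * D (gen i))"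
      using wi by (simp add: evX)
    have IH: "eqv (n - 1) (D (ev T)) (\<Sum>j\<in>J. ev (pdiff j T) * D (gen j))"
      using Cons by (simp add: T_def m_def n_def)
    have "eqv (w i + (n - 1)) (ev X * D (ev T)) (ev X * (\<Sum>j\<in>J. ev (pdiff j T) * D (gen j)))"
      by (rule eqv_mult_left[OF ev_F[OF X] IH])
    then have "eqv (w i + n - 1) (ev X * D (ev T)) (ev X * (\<Sum>j\<in>J. ev (pdiff j T) * D (gen j)))"
    \<comment> \<open>For \<open>n = 0\<close> the bounds \<open>w i + (n - 1)\<close> and
      \<open>w i + n - 1\<close> differ; then both \<open>D (ev T)\<close> and the sum are 0,
      because \<open>previous F 0 = {0}\<close>.\<close>
    proof (cases "n = 0")
      case True
      then have "D (ev T) = 0" "(\<Sum>j\<in>J. ev (pdiff j T) * D (gen j)) = 0"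
        using D_lower[OF D ev_F[OF T]] IH by (auto simp: eqv_def)
      then show ?thesis by simp
    qed simp
    also have "ev X * (\<Sum>j\<in>J. ev (pdiff j T) * D (gen j)) = (\<Sum>j\<in>J. ev X * ev (pdiff j T) * D (gen j))"
      by (simp add: sum_distrib_left mult.assoc)
    also have "eqv (w i + n - 1) (\<Sum>j\<in>J. ev X * ev (pdiff j T) * D (gen j))
        (\<Sum>j\<in>J. ev (X * pdiff j T) * D (gen j))"
    proof (rule eqv_sum)
      fix j
      show "eqv (w i + n - 1) (ev X * ev (pdiff j T) * D (gen j)) (ev (X * pdiff j T) * D (gen j))"
      proof (cases "pdiff j T = 0")
        case False
        then have j: "w j \<le> n" using pdiff_homogeneous(2)[OF T, of j] by force
        have "j \<in> I"
        proof -
          obtain k where "k \<in> keys T" "j \<in> keys k"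
            using False by (auto simp: pdiff_eq_0_iff)
          then show ?thesis using T by (auto simp: homogeneous_polynomials_iff)
        qed
        then have jw: "0 < w j" by (rule w_pos)
        have Dj: "D (gen j) \<in> F (w j - 1)"
          using D_lower[OF D gen_F[OF \<open>j \<in> I\<close>]] jw by (cases "w j") simp_all
        have "eqv (w i + (n - w j)) (ev X * ev (pdiff j T)) (ev (X * pdiff j T))"
          by (rule ev_mult[OF X pdiff_homogeneous(1)[OF T]])
        from eqv_mult_right[OF this Dj] show ?thesis using j jw by (simp add: add.assoc)
      qed (simp add: ev.zero)
    qed
    finally show "eqv (w i + n - 1) (ev X * D (ev T)) (\<Sum>j\<in>J. ev (X * pdiff j T) * D (gen j))" .
  qed
  also have "ev T * D (gen i) + (\<Sum>j\<in>J. ev (X * pdiff j T) * D (gen j))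
      = (\<Sum>j\<in>J. ev (pdiff j (X * T)) * D (gen j))"
  proof -
    have "pdiff j X = (if j = i then 1 else 0)" for j
      by (simp add: X_def pdiff_single lookup_single when_def del: One_nat_def)
    then have "(\<Sum>j\<in>J. ev (pdiff j (X * T)) * D (gen j))
        = (\<Sum>j\<in>J. (if j = i then ev T * D (gen j) else 0) + ev (X * pdiff j T) * D (gen j))"
      by (intro sum.cong) (auto simp: pdiff_mult ev.add distrib_right)
    then show ?thesis using J iI by (simp add: sum.distrib)
  qed
  finally show ?case unfolding XT by (simp add: n_def)
qed

lemma D_ev:
  assumes D: "D \<in> \<D>" and J: "finite J" and p: "p \<in> P n" "\<And>m. m \<in> keys p \<Longrightarrow> keys m \<subseteq> J"
  shows "eqv (n - 1) (D (ev p)) (\<Sum>j\<in>J. ev (pdiff j p) * D (gen j))"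
proof (rule poly_mapping_single_induct[where P = "\<lambda>p. eqv (n - 1) (D (ev p)) (\<Sum>j\<in>J. ev (pdiff j p) * D (gen j))"])
  interpret D: Vector_Spaces.linear scale scale D by (rule D_linear[OF D])
  show "eqv (n - 1) (D (ev 0)) (\<Sum>j\<in>J. ev (pdiff j 0) * D (gen j))"
    by (simp add: ev.zero pdiff.zero D.zero)
  fix m c q
  assume m: "m \<in> keys p"
    and q: "eqv (n - 1) (D (ev q)) (\<Sum>j\<in>J. ev (pdiff j q) * D (gen j))"
  have mI: "keys m \<subseteq> I" "weight w m = n" "keys m \<subseteq> J"
    using p m by (auto simp: homogeneous_polynomials_iff)
  have "eqv (n - 1) (D (ev (single m 1))) (\<Sum>j\<in>J. ev (pdiff j (single m 1)) * D (gen j))"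
    using D_mon[OF D J, of "var_list m"] mI by (simp only: sum_var_list set_var_list weight_var_list)
  from eqv_scale[OF this, of c]
  have "eqv (n - 1) (D (ev (single m c))) (\<Sum>j\<in>J. ev (pdiff j (single m c)) * D (gen j))"
    by (simp add: ev_single pdiff_single D.scale scale_sum_right scale_mult_left[symmetric])
  from eqv_add[OF this q]
  show "eqv (n - 1) (D (ev (single m c + q)))
      (\<Sum>j\<in>J. ev (pdiff j (single m c + q)) * D (gen j))"
    by (simp add: ev.add pdiff.add D.add distrib_right sum.distrib)
qed

end

section \<open>Homogeneous parts of polynomials\<close>

definition homogeneous_part :: "('i \<Rightarrow> nat) \<Rightarrow> nat \<Rightarrow> (('i \<Rightarrow>\<^sub>0 nat) \<Rightarrow>\<^sub>0 'k::field) \<Rightarrow> (('i \<Rightarrow>\<^sub>0 nat) \<Rightarrow>\<^sub>0 'k)" where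
  "homogeneous_part w n = linear_extension free_scale
     (\<lambda>m. if weight w m = n then single m 1 else 0)"

interpretation homogeneous_part: Vector_Spaces.linear free_scale free_scale "homogeneous_part w n"
  unfolding homogeneous_part_def by (rule linear_linear_extension) (rule vector_space_free_scale)

lemma homogeneous_part_single:
  "homogeneous_part w n (single m c) = (if weight w m = n then single m c else 0)"
  unfolding homogeneous_part_def linear_extension_single[OF vector_space_free_scale] by simp

lemma lookup_homogeneous_part:
  fixes p :: "('i \<Rightarrow>\<^sub>0 nat) \<Rightarrow>\<^sub>0 'k::field"
  shows "lookup (homogeneous_part w n p) m = (if weight w m = n then lookup p m else 0)"
  by (rule poly_mapping_single_induct[of _ p])
    (auto simp: homogeneous_part.zero homogeneous_part.add homogeneous_part_single lookup_add lookup_single when_def)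

lemma homogeneous_part_eqI: "(\<And>n. homogeneous_part w n p = homogeneous_part w n q) \<Longrightarrow> p = q"
  by (rule poly_mapping_eqI) (metis lookup_homogeneous_part)

lemma homogeneous_part_homogeneous:
  "p \<in> homogeneous_polynomials I w m \<Longrightarrow> homogeneous_part w n p = (if n = m then p else 0)"
  by (rule poly_mapping_eqI) (auto simp: lookup_homogeneous_part homogeneous_polynomials_iff in_keys_iff)

lemma carrier_polynomial_algebra:
  "p \<in> carrier (polynomial_algebra I) \<longleftrightarrow> (\<forall>m\<in>keys p. keys m \<subseteq> I)"
  by (simp add: polynomial_algebra_def)

lemma homogeneous_part_in:
  "p \<in> carrier (polynomial_algebra I) \<Longrightarrow> homogeneous_part w n p \<in> homogeneous_polynomials I w n"
  by (auto simp: homogeneous_polynomials_iff carrier_polynomial_algebra in_keys_iff lookup_homogeneous_part split: if_splits)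

lemma homogeneous_subset_carrier: "homogeneous_polynomials I w n \<subseteq> carrier (polynomial_algebra I)"
  by (auto simp: homogeneous_polynomials_def)

lemma homogeneous_part_mult:
  fixes p :: "('i \<Rightarrow>\<^sub>0 nat) \<Rightarrow>\<^sub>0 'k::field"
  shows "homogeneous_part w n (p * q) = (\<Sum>i\<le>n. homogeneous_part w i p * homogeneous_part w (n - i) q)"
proof -
  have single: "homogeneous_part w n (single a c * single b d)
      = (\<Sum>i\<le>n. homogeneous_part w i (single a c) * homogeneous_part w (n - i) (single b d))"
    for a b :: "'i \<Rightarrow>\<^sub>0 nat" and c d :: 'k
  proof -
    have "(\<Sum>i\<le>n. homogeneous_part w i (single a c) * homogeneous_part w (n - i) (single b d))
      = (\<Sum>i\<le>n. if i = weight w a then (if weight w b = n - weight w a then single (a + b) (c * d) else 0) else 0)"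
      by (intro sum.cong) (auto simp: homogeneous_part_single mult_single)
    then show ?thesis by (auto simp: mult_single homogeneous_part_single)
  qed
  have right: "homogeneous_part w n (single a c * q)
      = (\<Sum>i\<le>n. homogeneous_part w i (single a c) * homogeneous_part w (n - i) q)" for a c
    by (rule poly_mapping_single_induct[of _ q])
      (simp_all add: homogeneous_part.zero homogeneous_part.add distrib_left single sum.distrib)
  show ?thesis
    by (rule poly_mapping_single_induct[of _ p])
      (simp_all add: homogeneous_part.zero homogeneous_part.add distrib_right right sum.distrib)
qed

section \<open>Algebraic independence of the classes of the generators\<close>

context graded_generators
begin

text \<open>Strong induction on the weight replaces the choice of a relation of minimal weight.
  \<open>V\<close> is the set of variables of \<open>p\<close>, and \<open>j\<close> has the largest
  weight among them.\<close>

lemma ev_inj: "p \<in> P n \<Longrightarrow> ev p \<in> previous F n \<Longrightarrow> p = 0"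
proof (induction n arbitrary: p rule: less_induct)
  case (less n)
  note p = \<open>p \<in> P n\<close>
  have keys: "keys m \<subseteq> I" "weight w m = n" if "m \<in> keys p" for m
    using p that by (auto simp: homogeneous_polynomials_iff)
  define V where "V = (\<Union>m\<in>keys p. keys m)"
  have V: "finite V" "V \<subseteq> I" "\<And>m. m \<in> keys p \<Longrightarrow> keys m \<subseteq> V"
    using keys by (auto simp: V_def)
  show ?case
  proof (cases "V = {}")
    case True
    then have "keys p \<subseteq> {0}" by (auto simp: V_def)
    then have p0: "p = single 0 (lookup p 0)"
      by (intro poly_mapping_eqI) (auto simp: lookup_single when_def in_keys_iff)
    show ?thesis
    proof (rule ccontr)
      assume "p \<noteq> 0"
      then have c: "lookup p 0 \<noteq> 0" using p0 by (metis single_zero)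
      then have "n = 0" using keys(2)[of 0] by (simp add: in_keys_iff)
      moreover have "ev p = scale (lookup p 0) 1" by (subst p0) (simp add: ev_single)
      ultimately show False using less.prems c by simp
    qed
  next
    case False
    have "Max (w ` V) \<in> w ` V" using V(1) False by (intro Max_in) auto
    then obtain j where jV: "j \<in> V" "Max (w ` V) = w j" by blast
    have j: "j \<in> V" "\<And>i. i \<in> V \<Longrightarrow> w i \<le> w j"
      using V(1) jV Max_ge[of "w ` V"] by auto
    have wj: "0 < w j" using j V w_pos by blast
    have pj: "pdiff j p \<noteq> 0" using j by (auto simp: pdiff_eq_0_iff V_def)
    then have wjn: "w j \<le> n" using pdiff_homogeneous(2)[OF p, of j] by force
    note Pj = pdiff_homogeneous(1)[OF p]
    have False
    proof (cases "w j = n")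
      case False
      define k where "k = n - w j - 1"
      have k: "n - w j = Suc k" using False wjn by (simp add: k_def)
      \<comment> \<open>The step \<open>F k\<close> is \<open>previous F (n - w j)\<close>, so this
        says that the derivative of \<open>p\<close> is again a relation, of weight
        \<open>n - w j\<close>.\<close>
      have "ev (pdiff j p) \<in> F k"
      proof (rule D_detect)
        show "ev (pdiff j p) \<in> F (Suc k)" using ev_F[OF Pj[of j]] by (simp add: k)
        fix D assume D: "D \<in> \<D>"
        \<comment> \<open>A lift of \<open>D (gen i)\<close> to a polynomial \<open>q i\<close>
          makes \<open>D\<close> into the polynomial derivation sending each variable
          \<open>i\<close> to \<open>q i\<close>.\<close>
        have "\<exists>q. q \<in> P (w i - 1) \<and> eqv (w i - 1) (D (gen i)) (ev q)" if "i \<in> V" for i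
        proof -
          have i: "i \<in> I" "0 < w i" using that V w_pos by auto
          then have "D (gen i) \<in> F (w i - 1)" using D_lower[OF D gen_F[of i]] by (cases "w i") auto
          then show ?thesis using ev_surj by blast
        qed
        then obtain q where q: "\<And>i. i \<in> V \<Longrightarrow> q i \<in> P (w i - 1)"
          "\<And>i. i \<in> V \<Longrightarrow> eqv (w i - 1) (D (gen i)) (ev (q i))" by metis
        have prod: "eqv (N - 1) (ev (pdiff i r) * D (gen i)) (ev (pdiff i r * q i))"
          and prod_P: "pdiff i r * q i \<in> P (N - 1)" if "r \<in> P N" "i \<in> V" for r N i
        proof -
          have i: "0 < w i" using that V w_pos by auto
          show "eqv (N - 1) (ev (pdiff i r) * D (gen i)) (ev (pdiff i r * q i))"
            "pdiff i r * q i \<in> P (N - 1)"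
          proof (atomize (full), cases "pdiff i r = 0")
            case True
            then show "eqv (N - 1) (ev (pdiff i r) * D (gen i)) (ev (pdiff i r * q i)) \<and> pdiff i r * q i \<in> P (N - 1)"
              by (simp add: ev.zero)
          next
            case False
            then have N: "N - w i + (w i - 1) = N - 1" using pdiff_homogeneous(2)[OF that(1), of i] i by fastforce
            note r = pdiff_homogeneous(1)[OF that(1), of i]
            have "eqv (N - w i + (w i - 1)) (ev (pdiff i r) * D (gen i)) (ev (pdiff i r) * ev (q i))"
              by (rule eqv_mult_left[OF ev_F[OF r] q(2)[OF that(2)]])
            also have "eqv (N - w i + (w i - 1)) (ev (pdiff i r) * ev (q i)) (ev (pdiff i r * q i))"
              by (rule ev_mult[OF r q(1)[OF that(2)]])
            finally show "eqv (N - 1) (ev (pdiff i r) * D (gen i)) (ev (pdiff i r * q i)) \<and> pdiff i r * q i \<in> P (N - 1)"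
              using homogeneous_mult[OF r q(1)[OF that(2)]] unfolding N by (rule conjI)
          qed
        qed
        have ev_sum: "eqv (N - 1) (\<Sum>i\<in>V. ev (pdiff i r) * D (gen i)) (ev (\<Sum>i\<in>V. pdiff i r * q i))"
          if "r \<in> P N" for r N
          unfolding ev.sum using prod[OF that] by (rule eqv_sum)
        \<comment> \<open>The lifted derivation applied to \<open>p\<close>. It is a relation of
          weight \<open>n - 1\<close>, hence zero as a polynomial by the induction hypothesis. Its
          derivative by the variable \<open>j\<close> is then zero too, and equals the lifted
          derivation applied to \<open>pdiff j p\<close>, since \<open>j\<close> does not occur in
          any \<open>q i\<close>.\<close>
        define R where "R = (\<Sum>i\<in>V. pdiff i p * q i)"
        have "R = 0"
        proof (rule less.IH[of "n - 1"])
          show "n - 1 < n" using wj wjn by simp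
          show "R \<in> P (n - 1)" unfolding R_def by (rule homogeneous_sum) (rule prod_P[OF p])
          have "eqv (n - 1) (D (ev p)) (\<Sum>i\<in>V. ev (pdiff i p) * D (gen i))"
            by (rule D_ev[OF D V(1) p V(3)])
          also have "eqv (n - 1) \<dots> (ev R)" unfolding R_def by (rule ev_sum[OF p])
          finally show "ev R \<in> previous F (n - 1)"
            using eqv_mem[OF eqv_sym] D_previous[OF D less.prems(2)] by blast
        qed
        have "pdiff j (q i) = 0" if "i \<in> V" for i
        proof (rule pdiff_homogeneous(2)[OF q(1)[OF that]])
          have "0 < w i" using that V w_pos by auto
          then show "w i - 1 < w j" using j(2)[OF that] by simp
        qed
        then have "pdiff j R = (\<Sum>i\<in>V. pdiff i (pdiff j p) * q i)"
          unfolding R_def pdiff.sum pdiff_mult by (intro sum.cong) (simp_all add: pdiff_commute[of j])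
        then have "(\<Sum>i\<in>V. pdiff i (pdiff j p) * q i) = 0" by (simp add: \<open>R = 0\<close> pdiff.zero)
        moreover have "eqv (Suc k - 1) (D (ev (pdiff j p))) (\<Sum>i\<in>V. ev (pdiff i (pdiff j p)) * D (gen i))"
        proof (rule D_ev[OF D V(1)])
          show "pdiff j p \<in> P (Suc k)" using Pj[of j] by (simp add: k)
          fix m assume "m \<in> keys (pdiff j p)"
          then have "m + single j 1 \<in> keys p"
            by (auto simp: in_keys_iff lookup_pdiff)
          then have "keys (m + single j 1) \<subseteq> V" by (rule V(3))
          then show "keys m \<subseteq> V" by (simp add: keys_add_nat)
        qed
        moreover have "eqv (Suc k - 1) (\<Sum>i\<in>V. ev (pdiff i (pdiff j p)) * D (gen i))
            (ev (\<Sum>i\<in>V. pdiff i (pdiff j p) * q i))"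
          using Pj[of j] by (intro ev_sum) (simp add: k)
        ultimately show "D (ev (pdiff j p)) \<in> previous F k"
          using eqv_trans eqv_0_iff by (fastforce simp: ev.zero)
      qed
      moreover have "n - w j < n" using wj wjn by linarith
      ultimately have "pdiff j p = 0"
        using less.IH[of "n - w j" "pdiff j p"] Pj[of j] by (simp add: k)
      then show False using pj by simp
    next
      case True
      let ?W = "span (decomposables n \<union> previous F n)"
      \<comment> \<open>The variables that occur in \<open>p\<close> as a monomial of their own.
        Every other monomial of \<open>p\<close> splits into two factors of positive weight, so its
        value lies in \<open>?W\<close>; since \<open>ev p\<close> does too, so does the linear
        part, and independence kills its coefficients.\<close>
      define S where "S = {i \<in> I. w i = n \<and> single i 1 \<in> keys p}"
      have S: "finite S"
        by (rule finite_subset[OF _ V(1)]) (auto simp: S_def V_def intro!: bexI[of _ "single _ 1"])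
      define K where "K = (\<lambda>i. single i (1::nat)) ` S"
      have K: "K \<subseteq> keys p" by (auto simp: K_def S_def)
      have inj: "inj_on (\<lambda>i. single i (1::nat)) S"
        by (rule inj_onI) (metis keys_single singleton_inject zero_neq_one)
      have mon_W: "mon m \<in> ?W" if m: "m \<in> keys p" "m \<notin> K" for m
      proof -
        have "m \<noteq> 0" using keys(2)[OF m(1)] wj True by auto
        then obtain i where i: "i \<in> keys m" by (meson all_not_in_conv keys_eq_empty)
        define b where "b = m - single i 1"
        have mb: "m = b + single i 1"
          using i monomial_diff_eq_iff[of m i b] by (simp add: b_def in_keys_iff)
        have iI: "i \<in> I" "keys b \<subseteq> I" "weight w b + w i = n" "0 < w i"
          using keys[OF m(1)] i w_pos by (auto simp: mb keys_add_nat)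
        have "b \<noteq> 0"
        proof
          assume "b = 0"
          then have "i \<in> S" using iI m mb by (auto simp: S_def)
          then show False using m mb \<open>b = 0\<close> by (auto simp: K_def)
        qed
        then obtain l where "l \<in> keys b" by (meson all_not_in_conv keys_eq_empty)
        then have "0 < weight w b" using weight_ge[of l b w] w_pos[of l] iI by fastforce
        then have "mon b * gen i \<in> decomposables n"
          unfolding decomposables_def using iI mon_F[of b] gen_F[of i] by blast
        then have "mon b * gen i \<in> ?W" by (intro span_base) simp
        moreover have "eqv n (mon b * gen i) (mon m)"
          using mon_add[of b "single i 1"] iI keys(2)[OF m(1)] by (simp add: mb del: One_nat_def)
        then have "mon b * gen i - mon m \<in> ?W" unfolding eqv_def by (intro span_base) simp
        ultimately have "mon b * gen i - (mon b * gen i - mon m) \<in> ?W" by (rule span_diff)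
        then show ?thesis by simp
      qed
      have "ev p = (\<Sum>m\<in>keys p. scale (lookup p m) (mon m))"
        by (simp add: ev_def linear_extension_def)
      also have "\<dots> = (\<Sum>m\<in>keys p - K. scale (lookup p m) (mon m))
          + (\<Sum>m\<in>K. scale (lookup p m) (mon m))"
        by (rule sum.subset_diff[OF K]) simp
      also have "(\<Sum>m\<in>K. scale (lookup p m) (mon m))
          = (\<Sum>i\<in>S. scale (lookup p (single i 1)) (gen i))"
        unfolding K_def sum.reindex[OF inj] by (simp del: One_nat_def)
      finally have "(\<Sum>i\<in>S. scale (lookup p (single i 1)) (gen i))
          = ev p - (\<Sum>m\<in>keys p - K. scale (lookup p m) (mon m))"
        by simp
      also have "\<dots> \<in> ?W"
        using less.prems mon_W by (intro span_diff span_sum span_scale) (auto intro: span_base)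
      finally have zero: "i \<in> S \<Longrightarrow> lookup p (single i 1) = 0" for i
        using gen_independent[OF S, of n "\<lambda>i. lookup p (single i 1)"]
        by (auto simp: S_def)
      \<comment> \<open>As \<open>w j = n\<close>, a monomial of weight \<open>n\<close> containing
        the variable \<open>j\<close> has no room for another one. It is a member of the linear
        part, whose coefficients vanish.\<close>
      obtain m where m: "m \<in> keys p" "j \<in> keys m" using j by (auto simp: V_def)
      define b where "b = m - single j 1"
      have mb: "m = b + single j 1"
        using m monomial_diff_eq_iff[of m j b] by (simp add: b_def in_keys_iff)
      have "b = 0"
      proof (rule ccontr)
        assume "b \<noteq> 0"
        then obtain l where l: "l \<in> keys b" by (meson all_not_in_conv keys_eq_empty)
        then have "l \<in> I" using keys(1)[OF m(1)] by (auto simp: mb keys_add_nat)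
        then show False
          using keys(2)[OF m(1)] True weight_ge[OF l, of w] w_pos[of l] by (simp add: mb)
      qed
      then have "j \<in> S" using m mb j V True by (auto simp: S_def)
      then show False using zero[of j] by (auto simp: S_def in_keys_iff)
    qed
    then show ?thesis ..
  qed
qed

end

section \<open>The associated graded algebra\<close>

text \<open>Extend a basis of \<open>span W\<close> to one of \<open>V\<close>; the added vectors
  represent a basis of the quotient.\<close>

lemma (in vector_space) ex_basis_modulo:
  assumes "subspace V" "span W \<subseteq> V"
  shows "\<exists>X. X \<subseteq> V \<and> V \<subseteq> span (X \<union> W) \<and>
    (\<forall>S c x. finite S \<longrightarrow> S \<subseteq> X \<longrightarrow> (\<Sum>x\<in>S. scale (c x) x) \<in> span W \<longrightarrow> x \<in> S \<longrightarrow> c x = 0)"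
proof -
  obtain B0 where B0: "B0 \<subseteq> span W" "independent B0" "span W \<subseteq> span B0"
    using maximal_independent_subset[of "span W"] by blast
  then have "B0 \<subseteq> V" using assms(2) by blast
  then obtain B where B: "B0 \<subseteq> B" "B \<subseteq> V" "independent B" "V \<subseteq> span B"
    using maximal_independent_subset_extend[of B0 V] B0(2) by blast
  show ?thesis
  proof (intro exI[of _ "B - B0"] conjI allI impI)
    show "B - B0 \<subseteq> V" using B by blast
    have "B0 \<subseteq> span (B - B0 \<union> W)" using B0(1) span_mono[of W "B - B0 \<union> W"] by blast
    then have "B \<subseteq> span (B - B0 \<union> W)" using span_superset[of "B - B0 \<union> W"] by blast
    then show "V \<subseteq> span (B - B0 \<union> W)" using B(4) span_minimal[OF _ subspace_span] by blast
    fix S c x assume S: "finite S" "S \<subseteq> B - B0" "(\<Sum>x\<in>S. scale (c x) x) \<in> span W" "x \<in> S"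
    show "c x = 0"
    proof (rule ccontr)
      assume c: "c x \<noteq> 0"
      have "span B0 \<subseteq> span (B - {x})" using B S by (intro span_mono) auto
      then have "(\<Sum>x\<in>S. scale (c x) x) \<in> span (B - {x})" using S B0 by blast
      moreover have "(\<Sum>y\<in>S - {x}. scale (c y) y) \<in> span (B - {x})"
        using S by (intro span_sum span_scale span_base) auto
      ultimately have "(\<Sum>x\<in>S. scale (c x) x) - (\<Sum>y\<in>S - {x}. scale (c y) y) \<in> span (B - {x})"
        by (rule span_diff)
      then have "scale (c x) x \<in> span (B - {x})" using S by (simp add: sum.remove[of S x])
      then have "scale (inverse (c x)) (scale (c x) x) \<in> span (B - {x})" by (rule span_scale)
      then have "x \<in> span (B - {x})" using c by simp
      moreover have "x \<in> B" using S by blast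
      ultimately show False using B(3) by (auto simp: dependent_def)
    qed
  qed
qed

section \<open>Cosets of the preceding filtration step\<close>

context derivation_filtration
begin

definition coset :: "nat \<Rightarrow> 'h \<Rightarrow> 'h set" where
  "coset n a = (+) a ` previous F n"

lemma mem_coset_iff: "y \<in> coset n a \<longleftrightarrow> eqv n y a"
proof
  assume "eqv n y a"
  then show "y \<in> coset n a"
    unfolding coset_def eqv_def by (intro image_eqI[of _ _ "y - a"]) simp_all
qed (auto simp: coset_def eqv_def)

lemma coset_eq_iff: "coset n a = coset n b \<longleftrightarrow> eqv n a b"
proof
  assume "coset n a = coset n b"
  moreover have "a \<in> coset n a" by (simp add: mem_coset_iff)
  ultimately show "eqv n a b" by (simp add: mem_coset_iff)
next
  assume "eqv n a b"
  then show "coset n a = coset n b"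
    using eqv_trans eqv_sym unfolding set_eq_iff mem_coset_iff by blast
qed

lemma coset_zero: "coset n 0 = previous F n"
  by (simp add: coset_def)

lemma coset_eq_previous_iff: "coset n a = previous F n \<longleftrightarrow> a \<in> previous F n"
  using coset_eq_iff[of n a 0] by (simp add: coset_zero eqv_0_iff)

lemma coset_add: "{x + y | x y. x \<in> coset n a \<and> y \<in> coset n b} = coset n (a + b)" (is "?L = _")
proof (intro equalityI subsetI)
  fix z assume "z \<in> coset n (a + b)"
  then have "z - b \<in> coset n a" by (simp add: mem_coset_iff eqv_def algebra_simps)
  moreover have "b \<in> coset n b" by (simp add: mem_coset_iff)
  ultimately have "(z - b) + b \<in> ?L" by blast
  then show "z \<in> ?L" by simp
qed (auto simp: mem_coset_iff intro: eqv_add)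

lemma coset_scale: "{scale c x + f | x f. x \<in> coset n a \<and> f \<in> previous F n} = coset n (scale c a)" (is "?L = _")
proof (intro equalityI subsetI)
  fix z assume "z \<in> coset n (scale c a)"
  then have "z - scale c a \<in> previous F n" by (simp add: mem_coset_iff eqv_def)
  moreover have "a \<in> coset n a" by (simp add: mem_coset_iff)
  ultimately have "scale c a + (z - scale c a) \<in> ?L" by blast
  then show "z \<in> ?L" by simp
next
  fix z assume "z \<in> ?L"
  then obtain x f where z: "z = scale c x + f" "eqv n x a" "eqv n f 0" by (auto simp: mem_coset_iff eqv_0_iff)
  then have "eqv n (scale c x + f) (scale c a + 0)" by (intro eqv_add eqv_scale)
  then show "z \<in> coset n (scale c a)" by (simp add: z mem_coset_iff)
qed

text \<open>Changing representatives in degrees \<open>i\<close> and \<open>n - i\<close> alters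
  their product by lower terms only, so the products over all choices fill exactly one
  coset.\<close>

lemma coset_mult:
  assumes "\<And>i. a i \<in> F i" "\<And>i. b i \<in> F i"
  shows "{(\<Sum>i\<le>n. x i * y (n - i)) + f | x y f.
      (\<forall>i\<le>n. x i \<in> coset i (a i) \<and> y i \<in> coset i (b i)) \<and> f \<in> previous F n}
    = coset n (\<Sum>i\<le>n. a i * b (n - i))" (is "?L = _")
proof (intro equalityI subsetI)
  fix z assume "z \<in> coset n (\<Sum>i\<le>n. a i * b (n - i))"
  then have "z - (\<Sum>i\<le>n. a i * b (n - i)) \<in> previous F n" by (simp add: mem_coset_iff eqv_def)
  moreover have "\<forall>i\<le>n. a i \<in> coset i (a i) \<and> b i \<in> coset i (b i)" by (simp add: mem_coset_iff)
  ultimately have "(\<Sum>i\<le>n. a i * b (n - i)) + (z - (\<Sum>i\<le>n. a i * b (n - i))) \<in> ?L" by blast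
  then show "z \<in> ?L" by simp
next
  fix z assume "z \<in> ?L"
  then obtain x y f where z: "z = (\<Sum>i\<le>n. x i * y (n - i)) + f" "f \<in> previous F n"
    and xy: "\<And>i. i \<le> n \<Longrightarrow> eqv i (x i) (a i)" "\<And>i. i \<le> n \<Longrightarrow> eqv i (y i) (b i)"
    by (auto simp: mem_coset_iff)
  have "eqv n (\<Sum>i\<le>n. x i * y (n - i)) (\<Sum>i\<le>n. a i * b (n - i))"
  proof (rule eqv_sum)
    fix i assume "i \<in> {..n}"
    then have i: "i \<le> n" by simp
    have "y (n - i) \<in> F (n - i)" by (rule eqv_mem_F[OF xy(2) assms(2)]) simp
    then have "eqv (i + (n - i)) (x i * y (n - i)) (a i * b (n - i))"
      by (intro eqv_mult xy assms) (use i in auto)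
    then show "eqv n (x i * y (n - i)) (a i * b (n - i))" using i by simp
  qed
  then have "eqv n ((\<Sum>i\<le>n. x i * y (n - i)) + f) ((\<Sum>i\<le>n. a i * b (n - i)) + 0)"
    by (rule eqv_add) (simp add: eqv_0_iff z)
  then show "z \<in> coset n (\<Sum>i\<le>n. a i * b (n - i))" by (simp add: z mem_coset_iff)
qed

lemma decomposables_subset: "decomposables n \<subseteq> F n"
  unfolding decomposables_def using F_mult by blast

text \<open>A generator is indexed by its class in the associated graded algebra.\<close>

lemma ex_graded_generators:
  "\<exists>(I :: (nat \<Rightarrow> 'h set) set) w gen. graded_generators scale F \<D> I w gen"
proof -
  have "\<exists>X. X \<subseteq> F n \<and> F n \<subseteq> span (X \<union> (decomposables n \<union> previous F n)) \<and>
      (\<forall>S c x. finite S \<longrightarrow> S \<subseteq> X \<longrightarrow> (\<Sum>x\<in>S. scale (c x) x) \<in> span (decomposables n \<union> previous F n)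
        \<longrightarrow> x \<in> S \<longrightarrow> c x = 0)" for n
  proof -
    have "span (decomposables n \<union> previous F n) \<subseteq> F n"
      using decomposables_subset previous_subset by (intro span_minimal subspace_F) auto
    from ex_basis_modulo[OF subspace_F this] show ?thesis .
  qed
  then have "\<exists>X. \<forall>n. X n \<subseteq> F n \<and> F n \<subseteq> span (X n \<union> (decomposables n \<union> previous F n)) \<and>
      (\<forall>S c x. finite S \<longrightarrow> S \<subseteq> X n \<longrightarrow> (\<Sum>x\<in>S. scale (c x) x) \<in> span (decomposables n \<union> previous F n)
        \<longrightarrow> x \<in> S \<longrightarrow> c x = 0)"
    by (intro choice allI)
  then obtain X where X0: "\<forall>n. X n \<subseteq> F n \<and> F n \<subseteq> span (X n \<union> (decomposables n \<union> previous F n)) \<and>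
      (\<forall>S c x. finite S \<longrightarrow> S \<subseteq> X n \<longrightarrow> (\<Sum>x\<in>S. scale (c x) x) \<in> span (decomposables n \<union> previous F n)
        \<longrightarrow> x \<in> S \<longrightarrow> c x = 0)" ..
  have X: "X n \<subseteq> F n" "F n \<subseteq> span (X n \<union> (decomposables n \<union> previous F n))"
    "finite S \<Longrightarrow> S \<subseteq> X n \<Longrightarrow>
      (\<Sum>x\<in>S. scale (c x) x) \<in> span (decomposables n \<union> previous F n) \<Longrightarrow> x \<in> S \<Longrightarrow> c x = 0"
    for n S c x
    using X0[THEN spec[of _ n]] by simp_all
  define symb where "symb = (\<lambda>(n, x). \<lambda>m. if m = n then coset n x else previous F m)"
  define Y where "Y = {(n, x). 0 < n \<and> x \<in> X n}"
  have nz: "x \<notin> previous F n" if "x \<in> X n" for n x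
  proof
    assume "x \<in> previous F n"
    then have "(\<Sum>y\<in>{x}. scale 1 y) \<in> span (decomposables n \<union> previous F n)" by (auto intro: span_base)
    then show False using X(3)[of "{x}" n "\<lambda>_. 1" x] that by simp
  qed
  \<comment> \<open>Independence makes each element of \<open>X n\<close> nonzero modulo lower
    terms, so its class reveals the degree; within one degree it also separates the classes of
    distinct elements. Weight and lift can thus be recovered from the class.\<close>
  have inj: "inj_on symb Y"
  proof (rule inj_onI)
    fix u v assume "u \<in> Y" "v \<in> Y" and eq: "symb u = symb v"
    then obtain m x n y where uv: "u = (m, x)" "v = (n, y)" "x \<in> X m" "y \<in> X n" by (auto simp: Y_def)
    have "m = n"
    proof (rule ccontr)
      assume "m \<noteq> n"
      then have "coset m x = previous F m" using fun_cong[OF eq, of m] by (simp add: uv symb_def)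
      then show False using nz uv by (simp add: coset_eq_previous_iff)
    qed
    moreover have "x = y"
    proof (rule ccontr)
      assume ne: "x \<noteq> y"
      have "coset n x = coset n y" using fun_cong[OF eq, of m] \<open>m = n\<close> by (simp add: uv symb_def)
      then have "x - y \<in> previous F n" by (simp add: coset_eq_iff eqv_def)
      then have "(\<Sum>z\<in>{x, y}. scale (if z = x then 1 else - 1) z) \<in> span (decomposables n \<union> previous F n)"
        using ne by (auto intro: span_base)
      then show False
        using X(3)[of "{x, y}" n "\<lambda>z. if z = x then 1 else - 1" x] uv \<open>m = n\<close> by simp
    qed
    ultimately show "u = v" by (simp add: uv)
  qed
  define I where "I = symb ` Y"
  define w where "w = (\<lambda>i. fst (inv_into Y symb i))"
  define gen where "gen = (\<lambda>i. snd (inv_into Y symb i))"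
  have I: "i \<in> I \<longleftrightarrow> (\<exists>n x. 0 < n \<and> x \<in> X n \<and> i = symb (n, x))" for i
    by (auto simp: I_def Y_def)
  have wg: "w (symb (n, x)) = n" "gen (symb (n, x)) = x" if "0 < n" "x \<in> X n" for n x
    using that inv_into_f_f[OF inj, of "(n, x)"] by (simp_all add: w_def gen_def Y_def)
  have "graded_generators scale F \<D> I w gen"
  proof unfold_locales
    show "0 < w i" "gen i \<in> F (w i)" if "i \<in> I" for i
      using that X(1)[THEN subsetD] by (auto simp: I wg)
    have gen: "gen ` {i \<in> I. w i = n} = X n" if "0 < n" for n
      using that by (force simp: I wg image_iff)
    show "F n \<subseteq> span (gen ` {i \<in> I. w i = n} \<union> decomposables n \<union> previous F n)" if "0 < n" for n
      using X(2)[of n] by (simp add: gen[OF that] Un_assoc)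
    fix S n c i
    assume S: "finite S" "S \<subseteq> {i \<in> I. w i = n}" "i \<in> S"
      and sum: "(\<Sum>i\<in>S. scale (c i) (gen i)) \<in> span (decomposables n \<union> previous F n)"
    have n: "0 < n" using S by (auto simp: I wg)
    have gi: "symb (n, gen i) = i" if "i \<in> S" for i using that S by (auto simp: I wg)
    then have inj_gen: "inj_on gen S" by (metis inj_onI)
    have "(\<Sum>x\<in>gen ` S. scale (c (symb (n, x))) x) = (\<Sum>i\<in>S. scale (c i) (gen i))"
      unfolding sum.reindex[OF inj_gen] by (simp add: gi)
    moreover have "gen ` S \<subseteq> X n" using S gen[OF n] by blast
    ultimately have "c (symb (n, gen i)) = 0"
      using X(3)[of "gen ` S" n "\<lambda>x. c (symb (n, x))" "gen i"] S sum by simp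
    then show "c i = 0" using gi S by simp
  qed
  then show ?thesis by blast
qed

end

section \<open>The isomorphism with the polynomial algebra\<close>

context graded_generators
begin

abbreviation part :: "nat \<Rightarrow> (('i \<Rightarrow>\<^sub>0 nat) \<Rightarrow>\<^sub>0 'k) \<Rightarrow> (('i \<Rightarrow>\<^sub>0 nat) \<Rightarrow>\<^sub>0 'k)" where
  "part \<equiv> homogeneous_part w"

abbreviation Pol :: "('k, ('i \<Rightarrow>\<^sub>0 nat) \<Rightarrow>\<^sub>0 'k) module" where
  "Pol \<equiv> polynomial_algebra I"

abbreviation gr :: "('k, nat \<Rightarrow> 'h set) module" where
  "gr \<equiv> associated_graded scale F"

text \<open>Evaluation taken degree by degree, each part modulo its own lower terms. In this form it
  is exactly multiplicative, unlike \<open>ev\<close>.\<close>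

definition to_gr :: "(('i \<Rightarrow>\<^sub>0 nat) \<Rightarrow>\<^sub>0 'k) \<Rightarrow> nat \<Rightarrow> 'h set" where
  "to_gr p n = coset n (ev (part n p))"

lemma carrier_gr:
  "x \<in> carrier gr \<longleftrightarrow> (\<forall>n. \<exists>a\<in>F n. x n = coset n a) \<and> finite {n. x n \<noteq> previous F n}"
  by (simp add: associated_graded_def coset_def)

lemma Pol_simps:
  "\<one>\<^bsub>Pol\<^esub> = 1" "p \<otimes>\<^bsub>Pol\<^esub> q = p * q" "p \<oplus>\<^bsub>Pol\<^esub> q = p + q" "c \<odot>\<^bsub>Pol\<^esub> p = free_scale c p"
  by (simp_all add: polynomial_algebra_def)

lemma Pol_closed:
  "1 \<in> carrier Pol" "p \<in> carrier Pol \<Longrightarrow> q \<in> carrier Pol \<Longrightarrow> p * q \<in> carrier Pol"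
  "p \<in> carrier Pol \<Longrightarrow> q \<in> carrier Pol \<Longrightarrow> p + q \<in> carrier Pol"
  "p \<in> carrier Pol \<Longrightarrow> free_scale c p \<in> carrier Pol"
proof -
  show "1 \<in> carrier Pol" by (simp add: carrier_polynomial_algebra)
  show "p * q \<in> carrier Pol" if "p \<in> carrier Pol" "q \<in> carrier Pol"
    unfolding carrier_polynomial_algebra
  proof
    fix m assume "m \<in> keys (p * q)"
    then obtain a b where "m = a + b" "a \<in> keys p" "b \<in> keys q"
      using keys_mult by blast
    then show "keys m \<subseteq> I" using that by (auto simp: carrier_polynomial_algebra keys_add_nat)
  qed
  show "p + q \<in> carrier Pol" if "p \<in> carrier Pol" "q \<in> carrier Pol"
    using that keys_add[of p q] unfolding carrier_polynomial_algebra by (meson UnE subsetD)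
  show "free_scale c p \<in> carrier Pol" if "p \<in> carrier Pol"
    using that by (auto simp: carrier_polynomial_algebra in_keys_iff lookup_free_scale)
qed

lemma ev_part_F: "p \<in> carrier Pol \<Longrightarrow> ev (part n p) \<in> F n"
  by (rule ev_F[OF homogeneous_part_in])

lemma to_gr_in: "p \<in> carrier Pol \<Longrightarrow> to_gr p \<in> carrier gr"
proof -
  assume p: "p \<in> carrier Pol"
  have "{n. to_gr p n \<noteq> previous F n} \<subseteq> weight w ` keys p"
  proof (rule ccontr)
    assume "\<not> ?thesis"
    then obtain n where n: "to_gr p n \<noteq> previous F n" "n \<notin> weight w ` keys p" by blast
    then have "part n p = 0"
      by (intro poly_mapping_eqI) (auto simp: lookup_homogeneous_part in_keys_iff image_iff)
    then show False using n by (simp add: to_gr_def ev.zero coset_zero)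
  qed
  then have "finite {n. to_gr p n \<noteq> previous F n}" by (rule finite_subset) simp
  then show ?thesis
    unfolding carrier_gr using ev_part_F[OF p] by (auto simp: to_gr_def)
qed

lemma part_carrier: "p \<in> carrier Pol \<Longrightarrow> part n p \<in> P n"
  by (rule homogeneous_part_in)

lemma to_gr_inj: "inj_on to_gr (carrier Pol)"
proof (rule inj_onI)
  fix p q assume pq: "p \<in> carrier Pol" "q \<in> carrier Pol" "to_gr p = to_gr q"
  show "p = q"
  proof (rule homogeneous_part_eqI)
    fix n
    have "eqv n (ev (part n p)) (ev (part n q))"
      using fun_cong[OF pq(3), of n] by (simp add: to_gr_def coset_eq_iff)
    then have "ev (part n p - part n q) \<in> previous F n" by (simp add: eqv_def ev.diff)
    moreover have "part n p - part n q \<in> P n"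
      using part_carrier[OF pq(1), of n] homogeneous_scale[OF part_carrier[OF pq(2), of n], of "- 1"]
        homogeneous_add by (metis add.commute diff_conv_add_uminus poly.scale_minus_left poly.scale_one)
    ultimately show "part n p = part n q" using ev_inj by force
  qed
qed

lemma to_gr_surj: "x \<in> carrier gr \<Longrightarrow> \<exists>p\<in>carrier Pol. to_gr p = x"
proof -
  assume x: "x \<in> carrier gr"
  define N where "N = {n. x n \<noteq> previous F n}"
  have N: "finite N" using x by (simp add: carrier_gr N_def)
  have "\<exists>p. p \<in> P n \<and> x n = coset n (ev p)" for n
  proof -
    obtain a where "a \<in> F n" "x n = coset n a" using x by (auto simp: carrier_gr)
    moreover then obtain p where "p \<in> P n" "eqv n a (ev p)" using ev_surj by blast
    ultimately show ?thesis by (auto simp: coset_eq_iff)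
  qed
  then obtain p where p: "\<And>n. p n \<in> P n" "\<And>n. x n = coset n (ev (p n))" by metis
  define q where "q = (\<Sum>n\<in>N. p n)"
  have "q \<in> carrier Pol"
    unfolding q_def using N
  proof (induction N)
    case empty
    show ?case by (simp add: carrier_polynomial_algebra)
  next
    case (insert n N)
    then show ?case using p(1)[of n] homogeneous_subset_carrier[of I w n] by (auto intro: Pol_closed)
  qed
  moreover have "to_gr q n = x n" for n
  proof -
    have "part n q = (\<Sum>m\<in>N. if m = n then p m else 0)"
      unfolding q_def homogeneous_part.sum
      by (intro sum.cong) (auto simp: homogeneous_part_homogeneous[OF p(1)])
    then have "part n q = (if n \<in> N then p n else 0)" using N by simp
    then show ?thesis using p(2)[of n] by (auto simp: to_gr_def ev.zero coset_zero N_def)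
  qed
  ultimately show ?thesis by blast
qed

lemma to_gr_add: "to_gr p \<oplus>\<^bsub>gr\<^esub> to_gr q = to_gr (p + q)"
proof
  fix n
  show "(to_gr p \<oplus>\<^bsub>gr\<^esub> to_gr q) n = to_gr (p + q) n"
    unfolding to_gr_def associated_graded_def
    by (simp add: coset_add homogeneous_part.add ev.add)
qed

lemma to_gr_scale: "c \<odot>\<^bsub>gr\<^esub> to_gr p = to_gr (free_scale c p)"
proof
  fix n
  show "(c \<odot>\<^bsub>gr\<^esub> to_gr p) n = to_gr (free_scale c p) n"
    unfolding to_gr_def associated_graded_def
    by (simp add: coset_scale homogeneous_part.scale ev.scale)
qed

lemma to_gr_mult:
  assumes "p \<in> carrier Pol" "q \<in> carrier Pol"
  shows "to_gr p \<otimes>\<^bsub>gr\<^esub> to_gr q = to_gr (p * q)"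
proof
  fix n
  have "(to_gr p \<otimes>\<^bsub>gr\<^esub> to_gr q) n = coset n (\<Sum>i\<le>n. ev (part i p) * ev (part (n - i) q))"
    unfolding to_gr_def associated_graded_def
    using coset_mult[of "\<lambda>i. ev (part i p)" "\<lambda>i. ev (part i q)" n] ev_part_F assms by simp
  also have "\<dots> = to_gr (p * q) n"
    unfolding to_gr_def coset_eq_iff homogeneous_part_mult ev.sum
  proof (rule eqv_sum)
    fix i assume "i \<in> {..n}"
    then show "eqv n (ev (part i p) * ev (part (n - i) q)) (ev (part i p * part (n - i) q))"
      using ev_mult[OF part_carrier[OF assms(1), of i] part_carrier[OF assms(2), of "n - i"]] by simp
  qed
  finally show "(to_gr p \<otimes>\<^bsub>gr\<^esub> to_gr q) n = to_gr (p * q) n" .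
qed

lemma to_gr_one: "to_gr 1 = \<one>\<^bsub>gr\<^esub>"
proof
  fix n
  have "1 \<in> P 0" by (simp add: homogeneous_polynomials_iff)
  then have "part n 1 = (if n = 0 then 1 else 0)" by (rule homogeneous_part_homogeneous)
  then show "to_gr 1 n = \<one>\<^bsub>gr\<^esub> n"
    by (auto simp: to_gr_def associated_graded_def ev.zero coset_zero coset_def)
qed

definition from_gr :: "(nat \<Rightarrow> 'h set) \<Rightarrow> (('i \<Rightarrow>\<^sub>0 nat) \<Rightarrow>\<^sub>0 'k)" where
  "from_gr = inv_into (carrier Pol) to_gr"

lemma to_gr_image: "to_gr ` carrier Pol = carrier gr"
  using to_gr_in to_gr_surj by blast

lemma from_gr_to_gr: "p \<in> carrier Pol \<Longrightarrow> from_gr (to_gr p) = p"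
  unfolding from_gr_def by (rule inv_into_f_f[OF to_gr_inj])

lemma from_gr_iso: "from_gr \<in> ring_iso gr Pol"
  unfolding ring_iso_def
proof (intro CollectI conjI ring_hom_memI)
  show "bij_betw from_gr (carrier gr) (carrier Pol)"
    unfolding from_gr_def using bij_betw_inv_into[of to_gr "carrier Pol" "carrier gr"]
    by (simp add: bij_betw_def to_gr_inj to_gr_image)
  show "from_gr \<one>\<^bsub>gr\<^esub> = \<one>\<^bsub>Pol\<^esub>"
    using from_gr_to_gr[OF Pol_closed(1)] by (simp add: to_gr_one Pol_simps)
  fix x assume "x \<in> carrier gr"
  then obtain p where p: "p \<in> carrier Pol" "x = to_gr p" using to_gr_surj by blast
  then show "from_gr x \<in> carrier Pol" by (simp add: from_gr_to_gr)
  fix y assume "y \<in> carrier gr"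
  then obtain q where q: "q \<in> carrier Pol" "y = to_gr q" using to_gr_surj by blast
  show "from_gr (x \<otimes>\<^bsub>gr\<^esub> y) = from_gr x \<otimes>\<^bsub>Pol\<^esub> from_gr y"
    using p q by (simp add: to_gr_mult from_gr_to_gr Pol_closed Pol_simps)
  show "from_gr (x \<oplus>\<^bsub>gr\<^esub> y) = from_gr x \<oplus>\<^bsub>Pol\<^esub> from_gr y"
    using p q by (simp add: to_gr_add from_gr_to_gr Pol_closed Pol_simps)
qed

lemma from_gr_scale: "x \<in> carrier gr \<Longrightarrow> from_gr (c \<odot>\<^bsub>gr\<^esub> x) = free_scale c (from_gr x)"
  using to_gr_surj[of x] by (auto simp: to_gr_scale from_gr_to_gr Pol_closed)

lemma from_gr_component: "from_gr ` associated_graded_component scale F n = P n"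
proof -
  have "to_gr ` P n = associated_graded_component scale F n"
  proof (intro equalityI subsetI)
    fix x assume "x \<in> to_gr ` P n"
    then obtain p where p: "p \<in> P n" "x = to_gr p" by blast
    then have "part m p = 0" if "m \<noteq> n" for m using homogeneous_part_homogeneous[OF p(1)] that by simp
    then show "x \<in> associated_graded_component scale F n"
      using p to_gr_in homogeneous_subset_carrier[of I w n]
      by (auto simp: associated_graded_component_def to_gr_def ev.zero coset_zero)
  next
    fix x assume x: "x \<in> associated_graded_component scale F n"
    then have "x \<in> carrier gr" by (simp add: associated_graded_component_def)
    then obtain p where p: "p \<in> carrier Pol" "x = to_gr p" using to_gr_surj by blast
    have "part m p = 0" if "m \<noteq> n" for m
    proof (rule ev_inj[OF part_carrier[OF p(1)]])
      have "to_gr p m = previous F m" using x p that by (simp add: associated_graded_component_def)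
      then show "ev (part m p) \<in> previous F m" by (simp add: to_gr_def coset_eq_previous_iff)
    qed
    then have "part m p = part m (part n p)" for m
      using homogeneous_part_homogeneous[OF part_carrier[OF p(1), of n], of m] by simp
    then have "p = part n p" by (rule homogeneous_part_eqI)
    then have "p \<in> P n" using part_carrier[OF p(1), of n] by simp
    then show "x \<in> to_gr ` P n" using p by blast
  qed
  moreover have "from_gr ` to_gr ` P n = P n"
    using from_gr_to_gr homogeneous_subset_carrier[of I w n] by (force simp: image_iff)
  ultimately show ?thesis by simp
qed

end

theorem (in derivation_filtration) graded_polynomial_algebra_gr:
  "graded_polynomial_algebra (associated_graded scale F) (associated_graded_component scale F)"
proof -
  obtain I :: "(nat \<Rightarrow> 'h set) set" and w gen where "graded_generators scale F \<D> I w gen"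
    using ex_graded_generators by blast
  then interpret graded_generators scale F \<D> I w gen .
  show ?thesis
    unfolding graded_polynomial_algebra_def
    using from_gr_iso from_gr_scale from_gr_component by blast
qed

section \<open>Gelfand-Kirillov dimension\<close>

context k_algebra
begin

definition word_products :: "'a set \<Rightarrow> nat \<Rightarrow> 'a set" where
  "word_products S n = {prod_list ws | ws. set ws \<subseteq> S \<and> length ws \<le> n}"

text \<open>The growth rate used in \<open>GKdim\<close>, expressed with finite sets and the
  \<open>dim\<close> of \<open>vector_space\<close> so that linear algebra in an ambient algebra
  applies.\<close>

definition algebra_GKdim :: "'a set \<Rightarrow> ereal" where
  "algebra_GKdim A = (SUP S \<in> {S. finite S \<and> S \<subseteq> A}.
     limsup (\<lambda>n. ereal (log (real n) (real (dim (word_products S n))))))"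

lemma finite_word_products: "finite S \<Longrightarrow> finite (word_products S n)"
  unfolding word_products_def
  using finite_lists_length_le[of S n] by (simp add: setcompr_eq_image)

text \<open>The bound is at most \<open>((N + 1) * n) ^ d\<close> for positive \<open>n\<close>,
  whose logarithm to base \<open>n\<close> tends to \<open>d\<close>. In the application
  \<open>N\<close> is a filtration step that contains \<open>S\<close>.\<close>

lemma algebra_GKdim_le:
  assumes "\<And>S. finite S \<Longrightarrow> S \<subseteq> A \<Longrightarrow>
    \<exists>N. \<forall>n. \<exists>T. finite T \<and> card T \<le> (N * n + 1) ^ d \<and> word_products S n \<subseteq> span T"
  shows "algebra_GKdim A \<le> real d"
  unfolding algebra_GKdim_def
proof (rule SUP_least)
  fix S assume "S \<in> {S. finite S \<and> S \<subseteq> A}"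
  then have S: "finite S" "S \<subseteq> A" by simp_all
  obtain N where N: "\<forall>n. \<exists>T. finite T \<and> card T \<le> (N * n + 1) ^ d \<and> word_products S n \<subseteq> span T"
    using assms[OF S] ..
  have dim: "dim (word_products S n) \<le> (N * n + 1) ^ d" for n
  proof -
    obtain T where "finite T" "card T \<le> (N * n + 1) ^ d" "word_products S n \<subseteq> span T"
      using N[rule_format, of n] by blast
    then show ?thesis using dim_le_card le_trans by blast
  qed
  have "log (real n) (real (dim (word_products S n))) \<le> real d * (1 + ln (real (N + 1)) / ln (real n))"
    if n: "n \<ge> 2" for n
  \<comment> \<open>Monotonicity of the logarithm needs a positive argument; at 0 the default value
    0 of \<open>log\<close> satisfies the bound.\<close>
  proof (cases "dim (word_products S n) = 0")
    case True
    then show ?thesis using n by (simp add: log_def)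
  next
    case False
    have "real (dim (word_products S n)) \<le> real ((N * n + 1) ^ d)" using dim of_nat_le_iff by blast
    also have "\<dots> \<le> real (((N + 1) * n) ^ d)"
      using n by (intro of_nat_mono power_mono) auto
    finally have "log n (dim (word_products S n)) \<le> log n (real (((N + 1) * n) ^ d))"
      using n False by (intro log_mono) auto
    also have "real (((N + 1) * n) ^ d) = (real (N + 1) * real n) ^ d" by (simp only: of_nat_mult of_nat_power)
    also have "log n \<dots> = real d * (log n (real (N + 1)) + log n n)"
    proof -
      have "log n ((c * real n) ^ d) = real d * (log n c + log n n)" if "0 < c" for c
        using n that by (simp add: log_nat_power log_mult)
      then show ?thesis by simp
    qed
    also have "\<dots> = real d * (1 + ln (real (N + 1)) / ln (real n))"
      using n by (simp add: log_def)
    finally show ?thesis .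
  qed
  then have "limsup (\<lambda>n. ereal (log (real n) (real (dim (word_products S n)))))
      \<le> limsup (\<lambda>n. ereal (real d * (1 + ln (real (N + 1)) / ln (real n))))"
    by (intro Limsup_mono eventually_sequentiallyI[of 2]) simp
  also have "(\<lambda>n. real d * (1 + ln (real (N + 1)) / ln (real n))) \<longlonglongrightarrow> real d * (1 + 0)"
    by (intro tendsto_add tendsto_diff tendsto_mult tendsto_const real_tendsto_divide_at_top[OF tendsto_const]
        filterlim_compose[OF ln_at_top filterlim_real_sequentially])
  then have "limsup (\<lambda>n. ereal (real d * (1 + ln (real (N + 1)) / ln (real n)))) = real d"
    by (intro lim_imp_Limsup) simp_all
  finally show "limsup (\<lambda>n. ereal (log (real n) (real (dim (word_products S n))))) \<le> real d" .
qed

text \<open>The number \<open>(n div d + 1) ^ d\<close> counts monomials in \<open>d\<close>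
  variables with all exponents at most \<open>n div d\<close>; their degree is at most
  \<open>n\<close>. For positive \<open>d\<close> it is at least (n / d) to the power
  \<open>d\<close>, so its logarithm to base \<open>n\<close> is bounded below by a quantity tending
  to \<open>d\<close>.\<close>

lemma algebra_GKdim_ge:
  assumes S: "finite S" "S \<subseteq> A"
    and B: "\<And>n. \<exists>B\<subseteq>word_products S n. independent B \<and> (n div d + 1) ^ d \<le> card B"
  shows "real d \<le> algebra_GKdim A"
proof -
  have dim: "(n div d + 1) ^ d \<le> dim (word_products S n)" for n
  proof -
    obtain B where B: "B \<subseteq> word_products S n" "independent B" "(n div d + 1) ^ d \<le> card B" using B by blast
    obtain C where C: "C \<subseteq> word_products S n" "independent C" "word_products S n \<subseteq> span C" "card C = dim (word_products S n)"
      using basis_exists by blast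
    have "finite C" using C(1) finite_word_products[OF S(1)] by (rule finite_subset)
    then have "card B \<le> card C" using independent_span_bound[of C B] B C by blast
    then show ?thesis using B C by simp
  qed
  have "real d * (1 - ln (real d) / ln (real n)) \<le> log (real n) (real (dim (word_products S n)))"
    if n: "n \<ge> 2 \<and> n \<ge> d" for n
  proof (cases "d = 0")
    case True
    then have "1 \<le> dim (word_products S n)" using dim[of n] by simp
    then show ?thesis using n True by simp
  next
    case False
    have "n = n div d * d + n mod d" by simp
    also have "\<dots> \<le> n div d * d + d" by (rule add_left_mono) (use mod_less_divisor[of d n] False in simp)
    also have "\<dots> = (n div d + 1) * d" by simp
    finally have "n \<le> (n div d + 1) * d" .
    then have "real n \<le> real (n div d + 1) * real d" by (metis of_nat_le_iff of_nat_mult)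
    then have "real n / real d \<le> real (n div d + 1)" using False by (simp add: pos_divide_le_eq)
    then have "(real n / real d) ^ d \<le> real (n div d + 1) ^ d" by (intro power_mono) auto
    also have "\<dots> \<le> real (dim (word_products S n))" using dim[of n] of_nat_le_iff by (metis of_nat_power)
    finally have "log n ((real n / real d) ^ d) \<le> log n (real (dim (word_products S n)))"
      using n False by (intro log_mono) auto
    moreover have "log n ((real n / real d) ^ d) = real d * (1 - ln (real d) / ln (real n))"
      using n False by (simp add: log_nat_power log_divide) (simp add: log_def)
    ultimately show ?thesis by simp
  qed
  then have "limsup (\<lambda>n. ereal (real d * (1 - ln (real d) / ln (real n))))
      \<le> limsup (\<lambda>n. ereal (log (real n) (real (dim (word_products S n)))))"
    by (intro Limsup_mono eventually_sequentiallyI[of "max 2 d"]) simp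
  moreover have "(\<lambda>n. real d * (1 - ln (real d) / ln (real n))) \<longlonglongrightarrow> real d * (1 - 0)"
    by (intro tendsto_add tendsto_diff tendsto_mult tendsto_const real_tendsto_divide_at_top[OF tendsto_const]
        filterlim_compose[OF ln_at_top filterlim_real_sequentially])
  then have "limsup (\<lambda>n. ereal (real d * (1 - ln (real d) / ln (real n)))) = real d"
    by (intro lim_imp_Limsup) simp_all
  ultimately show ?thesis
    unfolding algebra_GKdim_def using S by (intro SUP_upper2[of S]) auto
qed

end

text \<open>The embedding \<open>\<rho>\<close> transfers \<open>Span\<close> and \<open>dim\<close> of HOL-Algebra to those of \<^locale>\<open>vector_space\<close>.\<close>

locale realized_algebra = ring M + V: k_algebra scale
  for M :: "('k::field, 'a) module" (structure) and scale :: "'k \<Rightarrow> 'v::ring_1 \<Rightarrow> 'v" +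
  fixes \<rho> :: "'a \<Rightarrow> 'v"
  assumes inj: "inj_on \<rho> (carrier M)"
    and rho_add: "x \<in> carrier M \<Longrightarrow> y \<in> carrier M \<Longrightarrow> \<rho> (x \<oplus> y) = \<rho> x + \<rho> y"
    and rho_mult: "x \<in> carrier M \<Longrightarrow> y \<in> carrier M \<Longrightarrow> \<rho> (x \<otimes> y) = \<rho> x * \<rho> y"
    and rho_one: "\<rho> \<one> = 1"
    and smult_closed: "x \<in> carrier M \<Longrightarrow> c \<odot> x \<in> carrier M"
    and rho_smult: "x \<in> carrier M \<Longrightarrow> \<rho> (c \<odot> x) = scale c (\<rho> x)"
begin

lemma rho_zero: "\<rho> \<zero> = 0"
  using rho_add[of \<zero> \<zero>] by simp

lemma scalars_closed: "k \<in> scalars M \<Longrightarrow> k \<in> carrier M"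
  by (auto simp: scalars_def smult_closed)

lemma line_extension_closed:
  "v \<in> carrier M \<Longrightarrow> E \<subseteq> carrier M \<Longrightarrow> line_extension (scalars M) v E \<subseteq> carrier M"
  by (auto simp: line_extension_mem_iff scalars_closed subsetD)

lemma rho_line_extension:
  assumes v: "v \<in> carrier M" and E: "E \<subseteq> carrier M" and B: "\<rho> ` E = V.span B"
  shows "\<rho> ` line_extension (scalars M) v E = V.span (insert (\<rho> v) B)"
proof (intro equalityI subsetI)
  fix x assume "x \<in> \<rho> ` line_extension (scalars M) v E"
  then obtain c e where c: "e \<in> E" "x = \<rho> ((c \<odot> \<one>) \<otimes> v \<oplus> e)"
    by (auto simp: line_extension_mem_iff scalars_def)
  then have "x = scale c (\<rho> v) + \<rho> e"
    using v E by (simp add: rho_add rho_mult rho_smult rho_one smult_closed subsetD V.scale_mult_left)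
  moreover have "\<rho> e \<in> V.span B" using B c by blast
  ultimately show "x \<in> V.span (insert (\<rho> v) B)"
    unfolding V.span_breakdown_eq by (intro exI[of _ c]) simp
next
  fix x assume "x \<in> V.span (insert (\<rho> v) B)"
  then obtain c where "x - scale c (\<rho> v) \<in> \<rho> ` E" unfolding V.span_breakdown_eq B by blast
  then obtain e where e: "e \<in> E" "x - scale c (\<rho> v) = \<rho> e" by blast
  then have "x = \<rho> ((c \<odot> \<one>) \<otimes> v \<oplus> e)"
    using v E by (simp add: rho_add rho_mult rho_smult rho_one smult_closed subsetD V.scale_mult_left algebra_simps)
  moreover have "(c \<odot> \<one>) \<otimes> v \<oplus> e \<in> line_extension (scalars M) v E"
    using e unfolding line_extension_mem_iff scalars_def by blast
  ultimately show "x \<in> \<rho> ` line_extension (scalars M) v E" by (rule image_eqI)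
qed

lemma rho_Span:
  "set us \<subseteq> carrier M \<Longrightarrow> Span (scalars M) us \<subseteq> carrier M \<and> \<rho> ` Span (scalars M) us = V.span (\<rho> ` set us)"
proof (induction us)
  case Nil
  show ?case by (simp add: rho_zero)
next
  case (Cons u us)
  then show ?case
    using line_extension_closed[of u "Span (scalars M) us"] rho_line_extension[of u "Span (scalars M) us" "\<rho> ` set us"]
    by simp
qed

text \<open>Each \<open>Suc_dim\<close> step adjoins a vector outside the space built so far.
  Injectivity of \<rho> keeps its image outside the span, so the image enlarges the basis by
  one.\<close>

lemma dimension_imp_basis:
  "dimension n (scalars M) E \<Longrightarrow> E \<subseteq> carrier M \<and>
    (\<exists>B. V.independent B \<and> finite B \<and> card B = n \<and> \<rho> ` E = V.span B)"
proof (induction n "scalars M" E rule: dimension.induct)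
  case zero_dim
  show ?case by (intro conjI exI[of _ "{}"]) (simp_all add: rho_zero V.independent_empty)
next
  case (Suc_dim v E n)
  then obtain B where B: "V.independent B" "finite B" "card B = n" "\<rho> ` E = V.span B" by blast
  have "\<rho> v \<notin> V.span B"
    unfolding B(4)[symmetric] using Suc_dim inj_on_image_mem_iff[OF inj] by blast
  moreover from this have "V.independent (insert (\<rho> v) B)" using B(1) by (rule V.independent_insertI)
  moreover from calculation have "\<rho> v \<notin> B" using V.span_base by blast
  ultimately show ?case
    using Suc_dim B rho_line_extension[of v E B] line_extension_closed[of v E]
    by (intro conjI exI[of _ "insert (\<rho> v) B"]) simp_all
qed

lemma basis_imp_dimension:
  "finite B \<Longrightarrow> V.independent B \<Longrightarrow> B \<subseteq> \<rho> ` carrier M \<Longrightarrow>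
    \<exists>E. dimension (card B) (scalars M) E \<and> E \<subseteq> carrier M \<and> \<rho> ` E = V.span B"
proof (induction B rule: finite_induct)
  case empty
  show ?case by (intro exI[of _ "{\<zero>}"]) (simp add: rho_zero)
next
  case (insert b B)
  have ind: "V.independent B" "b \<notin> V.span B"
    using insert V.independent_insert[of b B] by (auto split: if_splits)
  then obtain E where E: "dimension (card B) (scalars M) E" "E \<subseteq> carrier M" "\<rho> ` E = V.span B"
    using insert by auto
  obtain v where v: "v \<in> carrier M" "b = \<rho> v" using insert by blast
  have "v \<notin> E" using E(3) v ind by blast
  then have "dimension (Suc (card B)) (scalars M) (line_extension (scalars M) v E)"
    using v E by (intro Suc_dim)
  then show ?case
    using insert.hyps rho_line_extension[OF v(1) E(2,3)] line_extension_closed[OF v(1) E(2)] v(2)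
    by (intro exI[of _ "line_extension (scalars M) v E"]) simp
qed

text \<open>The ring-theoretic \<open>dim\<close> is a definite description, so existence and
  uniqueness of the number are both required. Existence comes from a basis pulled back along \<rho>,
  uniqueness from the basis that any other value would give.\<close>

lemma dim_Span:
  assumes us: "set us \<subseteq> carrier M"
  shows "dim (scalars M) (Span (scalars M) us) = V.dim (\<rho> ` set us)"
proof -
  let ?E = "Span (scalars M) us"
  note E = rho_Span[OF us]
  obtain B where B: "B \<subseteq> \<rho> ` set us" "V.independent B" "\<rho> ` set us \<subseteq> V.span B" "card B = V.dim (\<rho> ` set us)"
    using V.basis_exists by blast
  have "finite B" using B(1) by (rule finite_subset) simp
  moreover have "B \<subseteq> \<rho> ` carrier M" using B us by blast
  ultimately obtain E' where E': "dimension (card B) (scalars M) E'" "E' \<subseteq> carrier M" "\<rho> ` E' = V.span B"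
    using basis_imp_dimension B(2) by blast
  have "V.span B = V.span (\<rho> ` set us)"
    using B V.span_mono V.span_minimal V.subspace_span by (metis subset_antisym)
  then have "\<rho> ` E' = \<rho> ` ?E" using E' E by simp
  then have "E' = ?E" using inj_on_image_eq_iff[OF inj E'(2)] E by blast
  then have "dimension (V.dim (\<rho> ` set us)) (scalars M) ?E" using E'(1) B(4) by (simp only:)
  moreover have "n = V.dim (\<rho> ` set us)" if n: "dimension n (scalars M) ?E" for n
  proof -
    obtain C where "V.independent C" "card C = n" "\<rho> ` ?E = V.span C"
      using dimension_imp_basis[OF n] by blast
    then have "V.dim (\<rho> ` ?E) = n" using V.dim_span_eq_card_independent[of C] by metis
    moreover have "V.dim (\<rho> ` ?E) = V.dim (\<rho> ` set us)" using E V.dim_span by metis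
    ultimately show ?thesis by (simp only:)
  qed
  ultimately show ?thesis
    unfolding dim_def by (rule the_equality)
qed

lemma rho_words:
  assumes "set xs \<subseteq> carrier M"
  shows "set (words M xs n) \<subseteq> carrier M" "\<rho> ` set (words M xs n) = V.word_products (\<rho> ` set xs) n"
proof -
  have foldr: "foldr (\<otimes>) ws \<one> \<in> carrier M \<and> \<rho> (foldr (\<otimes>) ws \<one>) = prod_list (map \<rho> ws)"
    if "set ws \<subseteq> carrier M" for ws
    using that by (induction ws) (simp_all add: rho_one rho_mult)
  have words: "set (words M xs n) = (\<lambda>ws. foldr (\<otimes>) ws \<one>) ` {ws. set ws \<subseteq> set xs \<and> length ws \<le> n}"
  proof -
    have "{ws. set ws \<subseteq> set xs \<and> length ws \<le> n} = (\<Union>i\<in>{0..<Suc n}. {ws. length ws = i \<and> set ws \<subseteq> set xs})"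
      by (auto simp: less_Suc_eq_le)
    then show ?thesis
      unfolding words_def by (simp only: set_map set_concat set_upt image_image set_n_lists UN_simps)
  qed
  show "set (words M xs n) \<subseteq> carrier M" unfolding words using foldr assms by blast
  show "\<rho> ` set (words M xs n) = V.word_products (\<rho> ` set xs) n"
  proof (intro equalityI subsetI)
    fix x assume "x \<in> \<rho> ` set (words M xs n)"
    then obtain ws where "set ws \<subseteq> set xs" "length ws \<le> n" "x = prod_list (map \<rho> ws)"
      unfolding words using foldr assms by auto
    then show "x \<in> V.word_products (\<rho> ` set xs) n"
      unfolding V.word_products_def by (intro CollectI exI[of _ "map \<rho> ws"]) auto
  next
    fix x assume "x \<in> V.word_products (\<rho> ` set xs) n"
    then obtain vs where vs: "set vs \<subseteq> \<rho> ` set xs" "length vs \<le> n" "x = prod_list vs"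
      by (auto simp: V.word_products_def)
    then obtain ws where ws: "set ws \<subseteq> set xs" "vs = map \<rho> ws"
      using ex_map_conv[of vs \<rho>] by (metis in_lists_conv_set lists_eq_set lists_image mem_Collect_eq imageE)
    then show "x \<in> \<rho> ` set (words M xs n)"
      unfolding words using vs foldr assms by (intro image_eqI[of _ _ "foldr (\<otimes>) ws \<one>"] imageI) auto
  qed
qed

theorem GKdim_eq: "GKdim M = V.algebra_GKdim (\<rho> ` carrier M)"
proof -
  have "GKdim M = (SUP xs \<in> {xs. set xs \<subseteq> carrier M}.
      limsup (\<lambda>n. ereal (log (real n) (real (V.dim (V.word_products (\<rho> ` set xs) n))))))"
    unfolding GKdim_def by (intro SUP_cong refl) (simp add: dim_Span rho_words del: Span.simps)
  also have "\<dots> = V.algebra_GKdim (\<rho> ` carrier M)"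
    unfolding V.algebra_GKdim_def
  proof (rule SUP_eq)
    fix xs assume "xs \<in> {xs. set xs \<subseteq> carrier M}"
    then show "\<exists>S\<in>{S. finite S \<and> S \<subseteq> \<rho> ` carrier M}.
        limsup (\<lambda>n. ereal (log (real n) (real (V.dim (V.word_products (\<rho> ` set xs) n)))))
        \<le> limsup (\<lambda>n. ereal (log (real n) (real (V.dim (V.word_products S n)))))"
      by (intro bexI[of _ "\<rho> ` set xs"] order_refl CollectI conjI image_mono finite_imageI) simp_all
  next
    fix S assume "S \<in> {S. finite S \<and> S \<subseteq> \<rho> ` carrier M}"
    then obtain T where T: "T \<subseteq> carrier M" "finite T" "S = \<rho> ` T"
      using finite_subset_image[of S \<rho> "carrier M"] by auto
    then obtain xs where xs: "set xs = T" using finite_list by blast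
    show "\<exists>xs\<in>{xs. set xs \<subseteq> carrier M}.
        limsup (\<lambda>n. ereal (log (real n) (real (V.dim (V.word_products S n)))))
        \<le> limsup (\<lambda>n. ereal (log (real n) (real (V.dim (V.word_products (\<rho> ` set xs) n)))))"
      unfolding T(3) xs[symmetric] by (rule bexI[where x = xs], rule order_refl) (simp add: xs T(1))
  qed
  finally show ?thesis .
qed

end

lemma (in k_algebra) ring_subset_algebra:
  assumes "subspace A" "1 \<in> A" "\<And>x y. x \<in> A \<Longrightarrow> y \<in> A \<Longrightarrow> x * y \<in> A"
  shows "ring (subset_algebra scale A)"
proof (rule ringI)
  show "abelian_group (subset_algebra scale A)"
  proof (rule abelian_groupI)
    fix x assume "x \<in> carrier (subset_algebra scale A)"
    then show "\<exists>y\<in>carrier (subset_algebra scale A). y \<oplus>\<^bsub>subset_algebra scale A\<^esub> x = \<zero>\<^bsub>subset_algebra scale A\<^esub>"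
      using subspace_neg[OF assms(1)] by (intro bexI[of _ "- x"]) (simp_all add: subset_algebra_def)
  qed (use assms in \<open>auto simp: subset_algebra_def subspace_add subspace_0 algebra_simps\<close>)
  show "Group.monoid (subset_algebra scale A)"
    by (rule monoidI) (use assms in \<open>auto simp: subset_algebra_def mult.assoc\<close>)
qed (auto simp: subset_algebra_def algebra_simps)

lemma (in k_algebra) realized_subset_algebra:
  assumes "subspace A" "1 \<in> A" "\<And>x y. x \<in> A \<Longrightarrow> y \<in> A \<Longrightarrow> x * y \<in> A"
  shows "realized_algebra (subset_algebra scale A) scale id"
  by (intro realized_algebra.intro ring_subset_algebra k_algebra_axioms realized_algebra_axioms.intro)
    (use assms in \<open>auto simp: subset_algebra_def subspace_scale\<close>)

section \<open>Counting monomials and the growth of algebras with a monomial basis\<close>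

lemma monomials_of_bounded_weight:
  assumes I: "finite I" and w: "\<And>i. i \<in> I \<Longrightarrow> 0 < w i"
  shows "finite {m. keys m \<subseteq> I \<and> weight w m \<le> k}" (is "finite ?X")
    and "card {m. keys m \<subseteq> I \<and> weight w m \<le> k} \<le> (k + 1) ^ card I"
proof -
  let ?f = "\<lambda>m. restrict (lookup m) I"
  have inj: "inj_on ?f ?X"
  proof (rule inj_onI)
    fix a b assume ab: "a \<in> ?X" "b \<in> ?X" "?f a = ?f b"
    show "a = b"
    proof (rule poly_mapping_eqI)
      fix i
      show "lookup a i = lookup b i"
      proof (cases "i \<in> I")
        case True
        then show ?thesis using fun_cong[OF ab(3), of i] by simp
      next
        case False
        then have "i \<notin> keys a" "i \<notin> keys b" using ab by auto
        then show ?thesis by (simp add: in_keys_iff)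
      qed
    qed
  qed
  \<comment> \<open>Positive weights bound every exponent by the total weight, so the exponents
    embed the monomials into the functions from \<open>I\<close> to \<open>{..k}\<close>.\<close>
  have "lookup m i \<le> k" if m: "m \<in> ?X" and i: "i \<in> I" for m i
  proof -
    have "lookup m i \<le> lookup m i * w i" using w[OF i] by simp
    also have "\<dots> \<le> (\<Sum>i\<in>I. lookup m i * w i)" using I i by (intro member_le_sum) auto
    also have "\<dots> = weight w m" using I m by (intro weight_superset[symmetric]) auto
    finally show ?thesis using m by simp
  qed
  then have sub: "?f ` ?X \<subseteq> I \<rightarrow>\<^sub>E {..k}" by (auto simp: PiE_def)
  have fin: "finite (I \<rightarrow>\<^sub>E {..k})" using I by (intro finite_PiE) auto
  show "finite ?X" using finite_imageD[OF finite_subset[OF sub fin] inj] .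
  have "card ?X = card (?f ` ?X)" by (rule card_image[OF inj, symmetric])
  also have "\<dots> \<le> card (I \<rightarrow>\<^sub>E {..k})" by (rule card_mono[OF fin sub])
  also have "\<dots> = (k + 1) ^ card I" using I by (simp add: card_funcsetE)
  finally show "card ?X \<le> (k + 1) ^ card I" .
qed

lemma many_monomials:
  assumes J: "finite J"
  obtains X :: "('i \<Rightarrow>\<^sub>0 nat) set"
  where "finite X" "card X = (k + 1) ^ card J"
    "\<And>m. m \<in> X \<Longrightarrow> keys m \<subseteq> J \<and> (\<forall>i. lookup m i \<le> k)"
proof
  let ?g = "\<lambda>f. \<Sum>i\<in>J. single i (f i :: nat)"
  have lookup: "lookup (?g f) i = (if i \<in> J then f i else 0)" for f i
    using J by (simp add: lookup_sum lookup_single when_def)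
  have inj: "inj_on ?g (J \<rightarrow>\<^sub>E {..k})"
  proof (rule inj_onI)
    fix f f' assume f: "f \<in> J \<rightarrow>\<^sub>E {..k}" "f' \<in> J \<rightarrow>\<^sub>E {..k}" "?g f = ?g f'"
    show "f = f'"
    proof
      fix i
      show "f i = f' i"
        using arg_cong[OF f(3), of "\<lambda>m. lookup m i"] f(1,2)
        unfolding lookup by (cases "i \<in> J") (auto simp: PiE_def extensional_def)
    qed
  qed
  show "finite (?g ` (J \<rightarrow>\<^sub>E {..k}))" using J by (intro finite_imageI finite_PiE) auto
  show "card (?g ` (J \<rightarrow>\<^sub>E {..k})) = (k + 1) ^ card J"
    unfolding card_image[OF inj] using J by (simp add: card_funcsetE)
  fix m assume "m \<in> ?g ` (J \<rightarrow>\<^sub>E {..k})"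
  then obtain f where "f \<in> J \<rightarrow>\<^sub>E {..k}" "m = ?g f" by blast
  then show "keys m \<subseteq> J \<and> (\<forall>i. lookup m i \<le> k)"
    by (auto simp: in_keys_iff lookup PiE_def split: if_splits)
qed

text \<open>Applies both to the filtered algebra and to the polynomial algebra isomorphic to its
  graded algebra, with the same \<open>I\<close> and \<open>w\<close>. The dimension found below
  depends on \<open>I\<close> alone, which is why the two dimensions agree.\<close>

locale monomial_basis = k_algebra scale
  for scale :: "'k::field \<Rightarrow> 'h::ring_1 \<Rightarrow> 'h" +
  fixes A :: "'h set" and E :: "nat \<Rightarrow> 'h set" and I :: "'i set" and w :: "'i \<Rightarrow> nat"
    and gen :: "'i \<Rightarrow> 'h" and mon :: "('i \<Rightarrow>\<^sub>0 nat) \<Rightarrow> 'h"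
  assumes w_pos: "i \<in> I \<Longrightarrow> 0 < w i"
    and gen_A: "i \<in> I \<Longrightarrow> gen i \<in> A"
    and mon_word: "\<exists>l. mon a = prod_list (map gen l) \<and> set l = keys a \<and> length l = weight (\<lambda>_. 1) a"
    and mon_inj: "inj_on mon {m. keys m \<subseteq> I}"
    and mon_independent: "independent (mon ` {m. keys m \<subseteq> I})"
    and E_one: "1 \<in> E 0"
    and E_mono: "m \<le> n \<Longrightarrow> E m \<subseteq> E n"
    and E_mult: "x \<in> E m \<Longrightarrow> y \<in> E n \<Longrightarrow> x * y \<in> E (m + n)"
    and E_exhaustive: "A \<subseteq> (\<Union>n. E n)"
    and E_span: "E n \<subseteq> span (mon ` {m. keys m \<subseteq> I \<and> weight w m \<le> n})"
begin

lemma word_products_subset: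
  assumes "S \<subseteq> E N"
  shows "word_products S n \<subseteq> E (N * n)"
proof
  fix x assume "x \<in> word_products S n"
  then obtain ws where ws: "set ws \<subseteq> S" "length ws \<le> n" "x = prod_list ws" by (auto simp: word_products_def)
  have "prod_list ws \<in> E (N * length ws)"
    using ws(1)
  proof (induction ws)
    case (Cons a ws)
    then have "a * prod_list ws \<in> E (N + N * length ws)" using assms by (intro E_mult) auto
    then show ?case by simp
  qed (simp add: E_one)
  then show "x \<in> E (N * n)" using ws E_mono[of "N * length ws" "N * n"] by auto
qed

lemma finite_subset_filtration: "finite S \<Longrightarrow> S \<subseteq> A \<Longrightarrow> \<exists>N. S \<subseteq> E N"
proof (induction S rule: finite_induct)
  case (insert x S)
  then obtain m n where "x \<in> E m" "S \<subseteq> E n" using E_exhaustive by blast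
  then have "insert x S \<subseteq> E (max m n)" using E_mono[of m "max m n"] E_mono[of n "max m n"] by auto
  then show ?case by blast
qed simp

text \<open>Lower bound: monomials in finitely many variables with exponents at most
  \<open>n div d\<close> are independent words of length at most \<open>n\<close>. Upper bound: a
  finite set lies in some \<open>E N\<close>, so its words of length at most \<open>n\<close> lie in
  \<open>E (N * n)\<close>, which few monomials span. For infinite \<open>I\<close> the lower bounds
  from finite subsets are unbounded.\<close>

lemma algebra_GKdim_eq: "algebra_GKdim A = (if finite I then ereal (real (card I)) else \<infinity>)"
proof -
  have ge: "real d \<le> algebra_GKdim A" if J: "finite J" "J \<subseteq> I" "card J = d" for J d
  proof (rule algebra_GKdim_ge)
    show "finite (gen ` J)" "gen ` J \<subseteq> A" using J gen_A by auto
    fix n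
    obtain X where X: "finite X" "card X = (n div d + 1) ^ card J"
      "\<And>m. m \<in> X \<Longrightarrow> keys m \<subseteq> J \<and> (\<forall>i. lookup m i \<le> n div d)"
      using many_monomials[OF J(1)] by blast
    have XI: "X \<subseteq> {m. keys m \<subseteq> I}" using X(3) J(2) by blast
    have "mon m \<in> word_products (gen ` J) n" if m: "m \<in> X" for m
    proof -
      obtain l where l: "mon m = prod_list (map gen l)" "set l = keys m" "length l = weight (\<lambda>_. 1) m"
        using mon_word by blast
      have "weight (\<lambda>_. 1) m = (\<Sum>i\<in>J. lookup m i)"
        using weight_superset[of J m "\<lambda>_. 1"] X(3)[OF m] J(1) by simp
      also have "\<dots> \<le> card J * (n div d)" using X(3)[OF m] sum_bounded_above[of J "lookup m" "n div d"] by simp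
      also have "\<dots> \<le> n" using J(3) by simp
      finally show ?thesis
        unfolding word_products_def using l X(3)[OF m]
        by (intro CollectI exI[of _ "map gen l"]) auto
    qed
    moreover have "independent (mon ` X)" using mon_independent image_mono[OF XI] by (rule independent_mono)
    moreover have "card (mon ` X) = card X" using inj_on_subset[OF mon_inj XI] by (rule card_image)
    ultimately show "\<exists>B\<subseteq>word_products (gen ` J) n. independent B \<and> (n div d + 1) ^ d \<le> card B"
      using X(2) J(3) by (intro exI[of _ "mon ` X"]) auto
  qed
  show ?thesis
  proof (cases "finite I")
    case True
    have "algebra_GKdim A \<le> real (card I)"
    proof (rule algebra_GKdim_le)
      fix S assume "finite S" "S \<subseteq> A"
      then obtain N where N: "S \<subseteq> E N" using finite_subset_filtration by blast
      show "\<exists>N. \<forall>n. \<exists>T. finite T \<and> card T \<le> (N * n + 1) ^ card I \<and> word_products S n \<subseteq> span T"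
      proof (intro exI[of _ N] allI)
        fix n
        let ?X = "{m. keys m \<subseteq> I \<and> weight w m \<le> N * n}"
        have X: "finite ?X" "card ?X \<le> (N * n + 1) ^ card I"
          using monomials_of_bounded_weight[OF True, of w] w_pos by blast+
        have "card (mon ` ?X) \<le> (N * n + 1) ^ card I" using card_image_le[OF X(1)] X(2) le_trans by blast
        moreover have "word_products S n \<subseteq> span (mon ` ?X)" using word_products_subset[OF N] E_span by blast
        ultimately show "\<exists>T. finite T \<and> card T \<le> (N * n + 1) ^ card I \<and> word_products S n \<subseteq> span T"
          using X(1) by (intro exI[of _ "mon ` ?X"]) simp
      qed
    qed
    then show ?thesis using ge[OF True] True by (simp add: antisym)
  next
    case False
    have "ereal r \<le> algebra_GKdim A" for r
    proof -
      obtain d where d: "r \<le> real d" using real_arch_simple by blast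
      obtain J where "finite J" "card J = d" "J \<subseteq> I" using infinite_arbitrarily_large[OF False] by blast
      then show ?thesis using ge[of J d] d by (meson ereal_less_eq(3) order_trans)
    qed
    then have "algebra_GKdim A = \<infinity>" by (rule ereal_top)
    then show ?thesis using False by simp
  qed
qed

end

context graded_generators
begin

text \<open>If \<open>ev p = 0\<close>, all parts below the top weight \<open>N\<close> of
  \<open>p\<close> evaluate into \<open>previous F N\<close>; hence so does the top part, which is
  zero by \<open>ev_inj\<close>.\<close>

lemma ev_inj_carrier: "p \<in> carrier Pol \<Longrightarrow> ev p = 0 \<Longrightarrow> p = 0"
proof (rule ccontr)
  assume p: "p \<in> carrier Pol" "ev p = 0" "p \<noteq> 0"
  define N where "N = Max (weight w ` keys p)"
  have "weight w ` keys p \<noteq> {}" using p(3) by simp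
  then have "N \<in> weight w ` keys p" unfolding N_def by (intro Max_in) auto
  then obtain m where m: "m \<in> keys p" "weight w m = N" by blast
  have le: "weight w m \<le> N" if "m \<in> keys p" for m
    unfolding N_def using that by simp
  have "ev (p - part N p) = (\<Sum>m\<in>keys (p - part N p).
      scale (lookup (p - part N p) m) (mon m))"
    by (simp add: ev_def linear_extension_def)
  also have "\<dots> \<in> previous F N"
  proof (intro subspace_sum[OF subspace_previous] subspace_scale[OF subspace_previous])
    fix m assume "m \<in> keys (p - part N p)"
    then have "m \<in> keys p" "weight w m \<noteq> N"
      by (auto simp: in_keys_iff lookup_minus lookup_homogeneous_part split: if_splits)
    then have "weight w m < N" "keys m \<subseteq> I" using le p(1) by (force, auto simp: carrier_polynomial_algebra)
    then show "mon m \<in> previous F N" using mon_F F_subset_previous by blast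
  qed
  finally have "ev p - ev (part N p) \<in> previous F N" by (simp add: ev.diff)
  then have "ev (part N p) \<in> previous F N"
    using subspace_neg[OF subspace_previous] by (force simp: p(2))
  then have "part N p = 0" using ev_inj[OF part_carrier[OF p(1)]] by blast
  then show False using lookup_homogeneous_part[of w N p m] m by (simp add: in_keys_iff)
qed

end

lemma independent_monomials: "poly.independent ((\<lambda>m. single m 1) ` X)"
  unfolding poly.independent_explicit_finite_subsets
proof (intro allI impI ballI)
  fix S and u :: "_ \<Rightarrow> 'a" and v
  assume S: "S \<subseteq> (\<lambda>m. single m 1) ` X" "finite S" "(\<Sum>v\<in>S. free_scale (u v) v) = 0" "v \<in> S"
  then obtain m where m: "v = single m 1" by blast
  have "lookup (free_scale (u x) x) m = (if x = v then u v else 0)" if x: "x \<in> S" for x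
  proof -
    obtain k where k: "x = single k 1" using x S by blast
    show ?thesis
    proof (cases "k = m")
      case False
      then have "x \<noteq> v" unfolding k m by (metis keys_single one_neq_zero singleton_inject)
      then show ?thesis using False by (simp add: k lookup_single)
    qed (simp add: k m)
  qed
  then have "lookup (\<Sum>v\<in>S. free_scale (u v) v) m = (\<Sum>x\<in>S. if x = v then u v else 0)"
    unfolding lookup_sum by (intro sum.cong) auto
  then show "u v = 0" using S by simp
qed

lemma inj_monomials: "inj (\<lambda>m. single m (1 :: 'a::zero_neq_one))"
  by (rule injI) (metis keys_single one_neq_zero singleton_inject)

context graded_generators
begin

lemma length_var_list: "length (var_list m) = weight (\<lambda>_. 1) m"
  using weight_var_list[of "\<lambda>_. 1" m] by (simp add: sum_list_triv)

text \<open>Independence: \<open>ev\<close> is linear and injective on polynomials in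
  \<open>I\<close>, so it carries independent monomials to independent elements. Spanning:
  subtracting a homogeneous \<open>ev p\<close> of the same class from an element of
  \<open>F n\<close> leaves a remainder in the preceding step.\<close>

lemma monomial_basis_F: "monomial_basis scale (\<Union>n. F n) F I w gen mon"
proof unfold_locales
  let ?X = "{m. keys m \<subseteq> I}"
  have in_Pol: "single m 1 \<in> carrier Pol" if "m \<in> ?X" for m
    using that by (simp add: carrier_polynomial_algebra)
  have ev_mon: "ev (single m 1) = mon m" for m by (simp add: ev_single)
  have sub: "poly.subspace (carrier Pol)"
    by (rule poly.subspaceI) (auto intro: Pol_closed simp: carrier_polynomial_algebra[of 0])
  have inj: "inj_on ev (carrier Pol)"
  proof (rule inj_onI)
    fix p q assume pq: "p \<in> carrier Pol" "q \<in> carrier Pol" "ev p = ev q"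
    then have "p - q = 0" using poly.subspace_diff[OF sub] by (intro ev_inj_carrier) (auto simp: ev.diff)
    then show "p = q" by simp
  qed
  show "0 < w i" "gen i \<in> (\<Union>n. F n)" if "i \<in> I" for i using that w_pos gen_F by auto
  show "\<exists>l. mon m = prod_list (map gen l) \<and> set l = keys m \<and> length l = weight (\<lambda>_. 1) m" for m
    by (intro exI[of _ "var_list m"] conjI mon_def set_var_list length_var_list)
  show "inj_on mon ?X"
  proof (rule inj_onI)
    fix a b assume "a \<in> ?X" "b \<in> ?X" "mon a = mon b"
    then have "single a (1::'k) = single b 1"
      using in_Pol by (intro inj_onD[OF inj]) (simp_all add: ev_mon)
    then show "a = b" by (rule injD[OF inj_monomials])
  qed
  have "poly.span ((\<lambda>m. single m 1) ` ?X) \<subseteq> carrier Pol"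
    using in_Pol by (intro poly.span_minimal sub) auto
  then have "inj_on ev (poly.span ((\<lambda>m. single m 1) ` ?X))" by (rule inj_on_subset[OF inj])
  from ev.independent_injective_image[OF independent_monomials this]
  show "independent (mon ` ?X)" by (simp add: image_image ev_mon)
  show "1 \<in> F 0" by (simp add: F_0 span_base)
  show "F n \<subseteq> span (mon ` {m. keys m \<subseteq> I \<and> weight w m \<le> n})" for n
  proof
    fix y assume "y \<in> F n"
    then show "y \<in> span (mon ` {m. keys m \<subseteq> I \<and> weight w m \<le> n})"
    proof (induction n arbitrary: y rule: less_induct)
      case (less n)
      let ?S = "span (mon ` {m. keys m \<subseteq> I \<and> weight w m \<le> n})"
      obtain p where p: "p \<in> P n" "eqv n y (ev p)" using ev_surj less.prems by blast
      have "ev p = (\<Sum>m\<in>keys p. scale (lookup p m) (mon m))"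
        by (simp add: ev_def linear_extension_def)
      also have "\<dots> \<in> ?S"
        using p(1) by (intro span_sum span_scale span_base) (auto simp: homogeneous_polynomials_iff)
      finally have "ev p \<in> ?S" .
      moreover have "y - ev p \<in> ?S"
      proof (cases n)
        case 0
        then show ?thesis using p(2) by (simp add: eqv_def span_zero)
      next
        case (Suc k)
        then have "y - ev p \<in> span (mon ` {m. keys m \<subseteq> I \<and> weight w m \<le> k})"
          using p(2) by (intro less.IH) (simp_all add: eqv_def)
        moreover have "span (mon ` {m. keys m \<subseteq> I \<and> weight w m \<le> k}) \<subseteq> ?S"
          using Suc by (intro span_mono image_mono) auto
        ultimately show ?thesis by blast
      qed
      ultimately have "(y - ev p) + ev p \<in> ?S" by (intro span_add)
      then show ?case by simp
    qed
  qed
qed (use F_mono F_mult in auto)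

lemma monomial_basis_Pol:
  "monomial_basis (free_scale :: 'k \<Rightarrow> _) (carrier Pol)
     (\<lambda>n. {p \<in> carrier Pol. \<forall>m\<in>keys p. weight w m \<le> n}) I w
     (\<lambda>i. single (single i 1) 1) (\<lambda>m. single m 1)"
proof unfold_locales
  let ?E = "\<lambda>n. {p \<in> carrier Pol. \<forall>m\<in>keys p. weight w m \<le> n}"
  show "0 < w i" "single (single i 1) 1 \<in> carrier Pol" if "i \<in> I" for i
    using that w_pos by (auto simp: carrier_polynomial_algebra)
  show "\<exists>l. single m (1::'k) = prod_list (map (\<lambda>i. single (single i 1) 1) l)
      \<and> set l = keys m \<and> length l = weight (\<lambda>_. 1) m" for m :: "'i \<Rightarrow>\<^sub>0 nat"
  proof (intro exI[of _ "var_list m"] conjI)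
    have "prod_list (map (\<lambda>i. single (single i (1::nat)) (1::'k)) l)
        = single (\<Sum>i\<leftarrow>l. single i 1) 1" for l :: "'i list"
      by (induction l) (simp_all add: mult_single)
    from this[of "var_list m"] show "single m (1::'k)
        = prod_list (map (\<lambda>i. single (single i 1) 1) (var_list m))"
      unfolding sum_var_list by (rule sym)
  qed (simp_all add: set_var_list length_var_list)
  show "inj_on (\<lambda>m. single m (1::'k)) {m. keys m \<subseteq> I}"
    by (rule inj_on_subset[OF inj_monomials]) simp
  show "poly.independent ((\<lambda>m. single m (1::'k)) ` {m. keys m \<subseteq> I})"
    by (rule independent_monomials)
  show "1 \<in> ?E 0" by (simp add: Pol_closed)
  show "?E m \<subseteq> ?E n" if "m \<le> n" for m n using that by fastforce
  show "p * q \<in> ?E (m + n)" if pq: "p \<in> ?E m" "q \<in> ?E n" for p q m n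
  proof (intro CollectI conjI ballI)
    show "p * q \<in> carrier Pol" using pq Pol_closed by blast
    fix k assume "k \<in> keys (p * q)"
    then obtain a b where "k = a + b" "a \<in> keys p" "b \<in> keys q"
      using keys_mult by blast
    then show "weight w k \<le> m + n" using pq by (simp add: add_mono)
  qed
  show "carrier Pol \<subseteq> (\<Union>n. ?E n)"
  proof
    fix p assume p: "p \<in> carrier Pol"
    have "weight w m \<le> Max (weight w ` keys p)" if "m \<in> keys p" for m
      using that by simp
    then show "p \<in> (\<Union>n. ?E n)" using p by blast
  qed
  show "?E n \<subseteq> poly.span ((\<lambda>m. single m (1::'k)) ` {m. keys m \<subseteq> I \<and> weight w m \<le> n})" for n
  proof
    fix p assume p: "p \<in> ?E n"
    have "p = (\<Sum>m\<in>keys p. free_scale (lookup p m) (single m 1))"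
      using poly_mapping_sum_single[of p] by simp
    also have "\<dots> \<in> poly.span ((\<lambda>m. single m (1::'k)) ` {m. keys m \<subseteq> I \<and> weight w m \<le> n})"
      using p by (intro poly.span_sum poly.span_scale poly.span_base) (auto simp: carrier_polynomial_algebra)
    finally show "p \<in> poly.span ((\<lambda>m. single m (1::'k)) ` {m. keys m \<subseteq> I \<and> weight w m \<le> n})" .
  qed
qed

lemma Pol_eq: "Pol = subset_algebra free_scale (carrier Pol)"
  by (simp add: polynomial_algebra_def subset_algebra_def)

lemma ring_Pol: "ring Pol"
  by (subst Pol_eq, rule poly.ring_subset_algebra)
    (auto intro: Pol_closed poly.subspaceI simp: carrier_polynomial_algebra[of 0])

text \<open>The ring laws are carried over along \<open>to_gr\<close> instead of being checked on
  cosets. The transported structure has the image of 0 as its zero, which is the zero of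
  \<open>gr\<close>, so the record update is void.\<close>

lemma ring_gr: "ring gr"
proof -
  have "to_gr \<in> ring_iso Pol gr"
    unfolding ring_iso_def
  proof (intro CollectI conjI ring_hom_memI)
    show "bij_betw to_gr (carrier Pol) (carrier gr)" by (simp add: bij_betw_def to_gr_inj to_gr_image)
  qed (simp_all add: to_gr_in to_gr_mult to_gr_add to_gr_one Pol_simps)
  then have "ring (gr\<lparr>zero := to_gr \<zero>\<^bsub>Pol\<^esub>\<rparr>)" by (rule ring.ring_iso_imp_img_ring[OF ring_Pol])
  moreover have "to_gr \<zero>\<^bsub>Pol\<^esub> = \<zero>\<^bsub>gr\<^esub>"
    by (rule ext) (simp add: polynomial_algebra_def associated_graded_def to_gr_def homogeneous_part.zero ev.zero coset_zero)
  moreover have "gr\<lparr>zero := \<zero>\<^bsub>gr\<^esub>\<rparr> = gr" by simp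
  ultimately show ?thesis by (simp only:)
qed

text \<open>Realizes the graded algebra inside the polynomial ring, where its dimension can be
  computed from the monomials.\<close>

lemma realized_gr: "realized_algebra gr free_scale from_gr"
proof (intro realized_algebra.intro ring_gr poly.k_algebra_axioms realized_algebra_axioms.intro)
  note hom = from_gr_iso[unfolded ring_iso_def, simplified, THEN conjunct1]
  show "inj_on from_gr (carrier gr)" using from_gr_iso by (simp add: ring_iso_def bij_betw_def)
  show "from_gr (x \<oplus>\<^bsub>gr\<^esub> y) = from_gr x + from_gr y" "from_gr (x \<otimes>\<^bsub>gr\<^esub> y) = from_gr x * from_gr y"
    if "x \<in> carrier gr" "y \<in> carrier gr" for x y
    using ring_hom_add[OF hom that] ring_hom_mult[OF hom that] by (simp_all add: Pol_simps)
  show "from_gr \<one>\<^bsub>gr\<^esub> = 1" using ring_hom_one[OF hom] by (simp add: Pol_simps)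
  show "c \<odot>\<^bsub>gr\<^esub> x \<in> carrier gr" if "x \<in> carrier gr" for c x
  proof -
    obtain p where "p \<in> carrier Pol" "x = to_gr p" using to_gr_surj[OF \<open>x \<in> carrier gr\<close>] by blast
    then show ?thesis by (simp add: to_gr_scale to_gr_in Pol_closed)
  qed
qed (rule from_gr_scale)

lemma GKdim_gr: "GKdim gr = (if finite I then ereal (real (card I)) else \<infinity>)"
proof -
  have "from_gr ` carrier gr = carrier Pol"
    using from_gr_iso by (simp add: ring_iso_def bij_betw_def)
  then show ?thesis
    using realized_algebra.GKdim_eq[OF realized_gr] monomial_basis.algebra_GKdim_eq[OF monomial_basis_Pol]
    by simp
qed

lemma GKdim_union:
  "GKdim (subset_algebra scale (\<Union>n. F n)) = (if finite I then ereal (real (card I)) else \<infinity>)"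
proof -
  have "realized_algebra (subset_algebra scale (\<Union>n. F n)) scale id"
  proof (rule realized_subset_algebra)
    show "subspace (\<Union>n. F n)"
    proof (rule subspaceI)
      show "x + y \<in> (\<Union>n. F n)" if xy: "x \<in> (\<Union>n. F n)" "y \<in> (\<Union>n. F n)" for x y
      proof -
        obtain m n where "x \<in> F m" "y \<in> F n" using xy by blast
        then have "x \<in> F (max m n)" "y \<in> F (max m n)"
          using F_mono[of m "max m n"] F_mono[of n "max m n"] by auto
        then have "x + y \<in> F (max m n)" by (rule subspace_add[OF subspace_F])
        then show ?thesis by blast
      qed
    qed (use subspace_0[OF subspace_F] subspace_scale[OF subspace_F] in auto)
    show "1 \<in> (\<Union>n. F n)" using span_base[of 1 "{1}"] F_0 by blast
    show "x * y \<in> (\<Union>n. F n)" if "x \<in> (\<Union>n. F n)" "y \<in> (\<Union>n. F n)" for x y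
      using that F_mult by blast
  qed
  from realized_algebra.GKdim_eq[OF this] show ?thesis
    using monomial_basis.algebra_GKdim_eq[OF monomial_basis_F] by (simp add: subset_algebra_def)
qed

end

theorem (in derivation_filtration) GKdim_gr_eq:
  "GKdim (subset_algebra scale (\<Union>n. F n)) = GKdim (associated_graded scale F)"
  "GKdim (associated_graded scale F) \<in> range ereal_of_enat"
proof -
  obtain I :: "(nat \<Rightarrow> 'h set) set" and w gen where "graded_generators scale F \<D> I w gen"
    using ex_graded_generators by blast
  then interpret graded_generators scale F \<D> I w gen .
  show "GKdim (subset_algebra scale (\<Union>n. F n)) = GKdim (associated_graded scale F)"
    by (simp add: GKdim_gr GKdim_union)
  have "GKdim gr = ereal_of_enat (if finite I then enat (card I) else \<infinity>)"
    by (simp add: GKdim_gr)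
  then show "GKdim gr \<in> range ereal_of_enat" by blast
qed

text \<open>Everything restricts to a subalgebra stable under the operators: stability keeps images
  and error terms in \<open>A\<close>, the ambient facts put them into the right step, and
  \<open>previous\<close> commutes with intersecting by \<open>A\<close> because \<open>0\<close>
  lies in \<open>A\<close>.\<close>

lemma derivation_filtration_subalgebra:
  fixes scale :: "'k::field_char_0 \<Rightarrow> 'h::ring_1 \<Rightarrow> 'h"
  assumes "filtered_coproduct scale terms act counit C"
    and A: "module.subspace scale A" "1 \<in> A" "\<And>x y. x \<in> A \<Longrightarrow> y \<in> A \<Longrightarrow> x * y \<in> A"
    and act: "\<And>f x. linear_form scale f \<Longrightarrow> x \<in> A \<Longrightarrow> act f x \<in> A"
  shows "derivation_filtration scale (\<lambda>n. A \<inter> C n) (act ` filtered_coproduct.augmentation scale)"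
proof -
  interpret filtered_coproduct scale terms act counit C by fact
  have previous: "previous (\<lambda>n. A \<inter> C n) n = A \<inter> previous C n" for n
    using subspace_0[OF A(1)] by (cases n) auto
  show ?thesis
  proof (intro derivation_filtration.intro k_algebra_axioms derivation_filtration_axioms.intro)
    show "subspace (A \<inter> C n)" for n by (rule subspace_inter[OF A(1) subspace_C])
    show "A \<inter> C n \<subseteq> A \<inter> C (Suc n)" for n using C_mono_Suc by blast
    show "A \<inter> C 0 = span {1}" using span_minimal[of "{1}" A] A by (auto simp: C_0)
    show "x * y \<in> A \<inter> C (m + n)" if "x \<in> A \<inter> C m" "y \<in> A \<inter> C n" for x y m n
      using that A(3) C_mult by blast
    show "x * y - y * x \<in> previous (\<lambda>n. A \<inter> C n) (m + n)" if "x \<in> A \<inter> C m" "y \<in> A \<inter> C n" for x y m n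
      using that A(3) C_commutator subspace_diff[OF A(1)] by (simp add: previous)
    show "Vector_Spaces.linear scale scale D" if "D \<in> act ` augmentation" for D
      using that act_linear augmentation_linear by blast
    show "D x \<in> previous (\<lambda>n. A \<inter> C n) n" if "D \<in> act ` augmentation" "x \<in> A \<inter> C n" for D x n
      using that act act_lower augmentation_linear by (auto simp: previous)
    show "x \<in> A \<inter> C n" if "x \<in> A \<inter> C (Suc n)"
      "\<And>D. D \<in> act ` augmentation \<Longrightarrow> D x \<in> previous (\<lambda>n. A \<inter> C n) n" for x n
      using that C_detect[of x n] by (auto simp: previous)
    show "D (x * y) - (D x * y + x * D y) \<in> previous (\<lambda>n. A \<inter> C n) (m + n - 1)"
      if D: "D \<in> act ` augmentation" and xy: "x \<in> A \<inter> C m" "y \<in> A \<inter> C n" for D x y m n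
    proof -
      obtain f where f: "f \<in> augmentation" "D = act f" using D by blast
      have "D (x * y) - (D x * y + x * D y) \<in> A"
        using xy f augmentation_linear act A
        by (intro subspace_diff[OF A(1)] subspace_add[OF A(1)]) auto
      then show ?thesis using act_leibniz[OF f(1)] xy f(2) by (auto simp: previous)
    qed
  qed
qed

theorem theorem6p5:
  fixes scale :: "'k::field_char_0 \<Rightarrow> 'h::ring_1 \<Rightarrow> 'h"
    and scaleT :: "'k \<Rightarrow> 't::ab_group_add \<Rightarrow> 't" and tens :: "'h \<Rightarrow> 'h \<Rightarrow> 't"
    and scaleU :: "'k \<Rightarrow> 'u::ab_group_add \<Rightarrow> 'u" and tens3 :: "'t \<Rightarrow> 'h \<Rightarrow> 'u"
    and comult :: "'h \<Rightarrow> 't" and counit :: "'h \<Rightarrow> 'k" and antipode :: "'h \<Rightarrow> 'h"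
    and A :: "'h set" and F :: "nat \<Rightarrow> 'h set"
  assumes "connected_hopf_algebra scale scaleT tens scaleU tens3 comult counit antipode"
    and "hopf_algebra.one_sided_coideal_subalgebra scale scaleT tens comult A"
    and "\<And>n. F n = A \<inter> coalgebra.coradical_filtration scale scaleT tens comult n"
  shows "graded_polynomial_algebra (associated_graded scale F) (associated_graded_component scale F)
    \<and> GKdim (subset_algebra scale A) = GKdim (associated_graded scale F)
    \<and> GKdim (associated_graded scale F) \<in> range ereal_of_enat"
proof -
  interpret connected_hopf_algebra scale scaleT tens scaleU tens3 comult counit antipode by fact
  have F: "F = (\<lambda>n. A \<inter> coradical_filtration n)" using assms(3) by (rule ext)
  have A: "subspace A" "1 \<in> A" "\<And>x y. x \<in> A \<Longrightarrow> y \<in> A \<Longrightarrow> x * y \<in> A"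
    and side: "comult ` A \<subseteq> tensor_subspace UNIV A \<or> comult ` A \<subseteq> tensor_subspace A UNIV"
    using assms(2) by (auto simp: one_sided_coideal_subalgebra_def)
  \<comment> \<open>The form is applied to the tensor factor that is unrestricted, so the result
    lies in the other factor \<open>A\<close>: left evaluations serve \<open>H \<otimes> A\<close>,
    right evaluations serve \<open>A \<otimes> H\<close>.\<close>
  have "\<exists>\<D>. derivation_filtration scale F \<D>"
    using side
  proof
    assume sub: "comult ` A \<subseteq> tensor_subspace UNIV A"
    have "eval_left f x \<in> A" if "linear_form scale f" "x \<in> A" for f x
      unfolding eval_left_def using sub that
      by (intro HH.contract_left_span[OF that(1) A(1), of _ UNIV]) (auto simp: tensor_subspace_def)
    then show ?thesis
      unfolding F using derivation_filtration_subalgebra[OF filtered_coproduct_left A] by blast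
  next
    assume sub: "comult ` A \<subseteq> tensor_subspace A UNIV"
    have "eval_right f x \<in> A" if "linear_form scale f" "x \<in> A" for f x
      unfolding eval_right_def using sub that
      by (intro HH.contract_right_span[OF that(1) A(1), of _ UNIV]) (auto simp: tensor_subspace_def)
    then show ?thesis
      unfolding F using derivation_filtration_subalgebra[OF filtered_coproduct_right A] by blast
  qed
  then obtain \<D> where "derivation_filtration scale F \<D>" ..
  then interpret derivation_filtration scale F \<D> .
  \<comment> \<open>The dimension comparison was proved for the union of the filtration;
    exhaustiveness identifies this union with \<open>A\<close>.\<close>
  have "(\<Union>n. F n) = A"
    unfolding F using coradical_filtration_exhaustive by (auto simp del: coradical_filtration.simps)
  then show ?thesis
    using graded_polynomial_algebra_gr GKdim_gr_eq by simp
qed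

end
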